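(* Assume the Slater condition (there is a positive definite $X^0\in\mathbb{S}^n$ with $\mathcal{R}_\alpha(X^0)=\mathcal{R}_\alpha(\overline X)$). If $\rho_m\to0$, $\sqrt m\,\rho_m\to\infty$ and $\gamma_m=O_p(1)$, then a necessary condition for the rank consistency of $\widehat X_m$ (i.e., $\lim_{m\to\infty}\Pr(\mathrm{rank}(\widehat X_m)=\mathrm{rank}(\overline X))=1$) is that the linear system $$\overline P_2^{\mathbb{T}}\mathcal{Q}_\beta^\dagger(\overline P_2\Lambda\overline P_2^{\mathbb{T}})\overline P_2=\overline P_2^{\mathbb{T}}\mathcal{Q}_\beta^\dagger\big(I_n-F(\overline X)\big)\overline P_2$$ has a positive semidefinite solution $\widehat\Lambda\in\mathbb{S}^{n-r}$.
   Context: Positive semidefinite setting: $\mathbb{S}^n$ denotes either the real symmetric or the Hermitian $n\times n$ matrices, a real inner product space with $\langle X,Y\rangle=\mathrm{Re}\,\mathrm{Tr}(X^{\mathbb{T}}Y)$ ($^{\mathbb{T}}$ = transpose or conjugate transpose); $\|\cdot\|_F$ is the Frobenius norm. $\{\Theta_1,\dots,\Theta_d\}$ is an orthonormal basis of $\mathbb{S}^n$, $\alpha\subseteq\{1,\dots,d\}$, $\beta$ its complement, $\mathcal{R}_\pi(X)=(\langle\Theta_k,X\rangle)_{k\in\pi}$. Let $p_k>0$ ($k\in\beta$), $\sum_{k\in\beta}p_k=1$, $\mathcal{Q}_\beta^\dagger(X)=\sum_{k\in\beta}p_k^{-1}\langle\Theta_k,X\rangle\Theta_k$. The unknown $\overline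 X$ is positive semidefinite of rank $r\ge1$, with eigendecomposition $\overline X=\overline P\mathrm{Diag}(\lambda(\overline X))\overline P^{\mathbb{T}}$, eigenvalues nonincreasing, $\overline P=[\overline P_1\ \overline P_2]$ orthogonal/unitary, $\overline P_1$ having $r$ columns. Observations: $\omega_1,\dots,\omega_m$ i.i.d. with $\Pr(\omega_i=k)=p_k$ for $k\in\beta$, $0$ for $k\in\alpha$; $\xi_i$ i.i.d., independent of the $\omega_i$, $\mathbb{E}\xi_i=0$, $\mathbb{E}\xi_i^2=1$; $\nu>0$; $y_i=\langle\Theta_{\omega_i},\overline X\rangle+\nu\xi_i$; $\mathcal{R}_\Omega(X)=(\langle\Theta_{\omega_i},X\rangle)_{i=1}^m$. $F$ is the spectral operator of a symmetric function $f:\mathbb{R}^n\to\mathbb{R}^n$ ($f(x)=Q^{\mathbb{T}}f(Qx)$ for all signed permutation matrices $Q$); for positive semidefinite $X=P\mathrm{Diag}(\lambda(X))P^{\mathbb{T}}$, $F(X)=P\mathrm{Diag}(f(\lambda(X)))P^{\mathbb{T}}$. Given a positive semidefinite initial estimator $\widetilde X_m$, $\rho_m>0$, $\gamma_m\ge0$, $\widehat X_m$ is an optimal solution of $$\min_{X\in\mathbb{S}^n}\ \frac1{2m}\|y-\mathcal{R}_\Omega(X)\|_2^2+\rho_m\Big(\langle I_n-F(\widetilde X_m),X\rangle+\frac{\gamma_m}2\|X-\widetilde X_m\|_F^2\Big)\ \text{s.t. }\mathcal{R}_\alpha(X)=\mathcal{R}_\alpha(\overline X),\ X\text{ positive semidefinite}.$$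 Standing assumptions: $n$ fixed, $m\to\infty$; $F$ continuous at $\overline X$; $\widetilde X_m\xrightarrow{p}\overline X$. *)

theory Defs
  imports "HOL-Probability.Probability" "Jordan_Normal_Form.Schur_Decomposition" "Jordan_Normal_Form.DL_Rank"
begin

text \<open>Matrices are Jordan_Normal_Form matrices over complex numbers. The space S^n is either
  the Hermitian n x n matrices (realcase = False) or the real symmetric n x n matrices,
  embedded as Hermitian matrices with real entries (realcase = True).\<close>

definition mtrace :: "'a::comm_ring_1 mat \<Rightarrow> 'a" where
  "mtrace A = (\<Sum>i<dim_row A. A $$ (i,i))"

definition inner_S :: "complex mat \<Rightarrow> complex mat \<Rightarrow> real" where
  "inner_S X Y = Re (mtrace (mat_adjoint X * Y))"

definition frob_norm :: "complex mat \<Rightarrow> real" where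
  "frob_norm X = sqrt (inner_S X X)"

definition real_mat :: "complex mat \<Rightarrow> bool" where
  "real_mat X \<longleftrightarrow> (\<forall>i<dim_row X. \<forall>j<dim_col X. Im (X $$ (i,j)) = 0)"

definition Sn :: "bool \<Rightarrow> nat \<Rightarrow> complex mat set" where
  "Sn realcase n = {X \<in> carrier_mat n n. mat_adjoint X = X \<and> (realcase \<longrightarrow> real_mat X)}"

definition psd :: "complex mat \<Rightarrow> bool" where
  "psd X \<longleftrightarrow> X \<in> carrier_mat (dim_row X) (dim_row X) \<and> mat_adjoint X = X \<and>
     (\<forall>v\<in>carrier_vec (dim_row X). Re ((X *\<^sub>v v) \<bullet>c v) \<ge> 0)"

definition pd :: "complex mat \<Rightarrow> bool" where
  "pd X \<longleftrightarrow> X \<in> carrier_mat (dim_row X) (dim_row X) \<and> mat_adjoint X = X \<and>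
     (\<forall>v\<in>carrier_vec (dim_row X). v \<noteq> 0\<^sub>v (dim_row X) \<longrightarrow> Re ((X *\<^sub>v v) \<bullet>c v) > 0)"

definition unitary_n :: "nat \<Rightarrow> complex mat \<Rightarrow> bool" where
  "unitary_n n P \<longleftrightarrow> P \<in> carrier_mat n n \<and> mat_adjoint P * P = 1\<^sub>m n"

definition eig_decomp :: "nat \<Rightarrow> complex mat \<Rightarrow> complex mat \<Rightarrow> (nat \<Rightarrow> real) \<Rightarrow> bool" where
  "eig_decomp n X P lam \<longleftrightarrow> unitary_n n P \<and> (\<forall>i j. i \<le> j \<longrightarrow> j < n \<longrightarrow> lam j \<le> lam i) \<and>
     X = P * mat_diag n (\<lambda>i. complex_of_real (lam i)) * mat_adjoint P"

definition signed_perm_mat :: "nat \<Rightarrow> real mat \<Rightarrow> bool" where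
  "signed_perm_mat n Q \<longleftrightarrow> (\<exists>\<sigma> s. \<sigma> permutes {..<n} \<and> (\<forall>i<n. s i = 1 \<or> s i = -1) \<and>
     Q = mat n n (\<lambda>(i,j). if j = \<sigma> i then s i else 0))"

definition symmetric_fun :: "nat \<Rightarrow> (real vec \<Rightarrow> real vec) \<Rightarrow> bool" where
  "symmetric_fun n f \<longleftrightarrow> (\<forall>x\<in>carrier_vec n. f x \<in> carrier_vec n) \<and>
     (\<forall>x\<in>carrier_vec n. \<forall>Q. signed_perm_mat n Q \<longrightarrow> f x = transpose_mat Q *\<^sub>v f (Q *\<^sub>v x))"

definition spectral_op :: "nat \<Rightarrow> (real vec \<Rightarrow> real vec) \<Rightarrow> complex mat \<Rightarrow> complex mat" where
  "spectral_op n f X = (SOME Y. \<exists>P lam. eig_decomp n X P lam \<and>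
     Y = P * mat_diag n (\<lambda>i. complex_of_real (f (vec n lam) $ i)) * mat_adjoint P)"

definition lin_comb :: "nat \<Rightarrow> (nat \<Rightarrow> complex mat) \<Rightarrow> (nat \<Rightarrow> real) \<Rightarrow> nat set \<Rightarrow> complex mat" where
  "lin_comb n \<Theta> c K = mat n n (\<lambda>(i,j). \<Sum>k\<in>K. complex_of_real (c k) * \<Theta> k $$ (i,j))"

definition Qdag :: "nat \<Rightarrow> (nat \<Rightarrow> complex mat) \<Rightarrow> (nat \<Rightarrow> real) \<Rightarrow> nat set \<Rightarrow> complex mat \<Rightarrow> complex mat" where
  "Qdag n \<Theta> p \<beta> X = lin_comb n \<Theta> (\<lambda>k. inner_S (\<Theta> k) X / p k) \<beta>"

text \<open>Objective of the rank-correction problem, for sample size m, observed indices obsv,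
  observations yv (indexed 0..m-1), initial estimator Xt, parameters rho, gamma.\<close>
definition objective :: "nat \<Rightarrow> (real vec \<Rightarrow> real vec) \<Rightarrow> (nat \<Rightarrow> complex mat) \<Rightarrow> nat \<Rightarrow>
    (nat \<Rightarrow> nat) \<Rightarrow> (nat \<Rightarrow> real) \<Rightarrow> complex mat \<Rightarrow> real \<Rightarrow> real \<Rightarrow> complex mat \<Rightarrow> real" where
  "objective n f \<Theta> m obsv yv Xt rho gamma X =
     (1 / (2 * real m)) * (\<Sum>i<m. (yv i - inner_S (\<Theta> (obsv i)) X)\<^sup>2)
     + rho * (inner_S (1\<^sub>m n - spectral_op n f Xt) X + gamma / 2 * (frob_norm (X - Xt))\<^sup>2)"

definition feasible :: "bool \<Rightarrow> nat \<Rightarrow> (nat \<Rightarrow> complex mat) \<Rightarrow> nat set \<Rightarrow> complex mat \<Rightarrow> complex mat \<Rightarrow> bool" where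
  "feasible realcase n \<Theta> \<alpha> Xbar X \<longleftrightarrow> X \<in> Sn realcase n \<and> psd X \<and>
     (\<forall>k\<in>\<alpha>. inner_S (\<Theta> k) X = inner_S (\<Theta> k) Xbar)"

definition is_optimal :: "bool \<Rightarrow> nat \<Rightarrow> (real vec \<Rightarrow> real vec) \<Rightarrow> (nat \<Rightarrow> complex mat) \<Rightarrow> nat set \<Rightarrow>
    complex mat \<Rightarrow> nat \<Rightarrow> (nat \<Rightarrow> nat) \<Rightarrow> (nat \<Rightarrow> real) \<Rightarrow> complex mat \<Rightarrow> real \<Rightarrow> real \<Rightarrow> complex mat \<Rightarrow> bool" where
  "is_optimal realcase n f \<Theta> \<alpha> Xbar m obsv yv Xt rho gamma X \<longleftrightarrow>
     feasible realcase n \<Theta> \<alpha> Xbar X \<and>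
     (\<forall>Z. feasible realcase n \<Theta> \<alpha> Xbar Z \<longrightarrow>
        objective n f \<Theta> m obsv yv Xt rho gamma X \<le> objective n f \<Theta> m obsv yv Xt rho gamma Z)"

end

theory Submission
  imports Defs
begin

text \<open>
  By the law of large numbers in second-moment form, there are outcomes at arbitrarily large sample
  sizes along which the empirical frequencies, the noise averages divided by \<open>\<rho>\<close>, the initial
  estimators and the values of \<open>F\<close> are all as close to their limits as desired while the estimator has
  the rank \<open>r\<close> of \<open>Xbar\<close>; it suffices to argue along one such sequence. The first-order optimality
  condition, tested against \<open>Xbar\<close>, bounds the rescaled errors \<open>(Xhat - Xbar) / \<rho>\<close>, so they
  have a limit point \<open>D\<close>, supported on \<open>\<beta>\<close>. The vanishing minors of order \<open>r + 1\<close> force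
  \<open>P2\<^sup>* D P2 = 0\<close>. In the limit the optimality condition says that \<open>Xbar\<close> minimises a linear
  functional over the feasible set; the Slater condition yields a positive semidefinite dual slack
  \<open>S = P2 \<Lambda> P2\<^sup>*\<close>, whose \<open>\<beta>\<close>-coordinates are \<open>p k * D k\<close> plus those of
  \<open>I - F(Xbar)\<close>. Dividing by \<open>p k\<close> and compressing with \<open>P2\<close> gives the linear system.
\<close>

section \<open>Sesquilinear forms of Hermitian matrices\<close>

text \<open>The conclusion is deterministic, so convergence in probability need not be upgraded to
  almost sure convergence: it is enough that good outcomes exist for arbitrarily large sample sizes.
  The scale \<rho> is dictated by the penalty, whose gradient has that order. The noise averages
  have order \<open>1 / sqrt m\<close>, which is negligible against \<rho> because
  \<open>sqrt m * \<rho> m\<close> diverges, and the proximal term contributes only a bounded factor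
  times vanishing quantities. Hence the errors divided by \<rho> obey a condition whose coefficients
  converge to non-random limits. The obstacle is that the rank is not continuous, so constancy of
  the rank says nothing in the limit by itself. Minors do pass to the limit, and they show that the
  null block of the error is of smaller order than \<rho>, although the error as a whole need not
  be. Real and Hermitian matrices are treated together; they differ mainly in the self-duality of
  the cone and in the compressed solution. The form \<open>sesq\<close> takes functions, not
  vectors, so that columns, combinations and limits are plain terms.\<close>

definition sesq :: "nat \<Rightarrow> complex mat \<Rightarrow> (nat \<Rightarrow> complex) \<Rightarrow> (nat \<Rightarrow> complex) \<Rightarrow> complex" where
  "sesq n X u v = (\<Sum>i<n. \<Sum>l<n. cnj (u i) * X $$ (i,l) * v l)"

lemma mat_adjoint_dim [simp]:
  "dim_row (mat_adjoint A) = dim_col A" "dim_col (mat_adjoint A) = dim_row A"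
  by (auto simp: mat_adjoint_def)

lemma mat_adjoint_index [simp]:
  fixes A :: "complex mat"
  assumes "i < dim_col A" "j < dim_row A"
  shows "mat_adjoint A $$ (i,j) = cnj (A $$ (j,i))"
  using assms by (simp add: mat_adjoint_def mat_of_rows_def conjugate_complex_def)

lemma mat_adjoint_carrier [simp]:
  "A \<in> carrier_mat m n \<Longrightarrow> mat_adjoint A \<in> carrier_mat n m"
  by (auto intro: carrier_matI)

lemma mult_mat_index:
  assumes "A \<in> carrier_mat m k" "B \<in> carrier_mat k n" "i < m" "j < n"
  shows "(A * B) $$ (i,j) = (\<Sum>l<k. A $$ (i,l) * B $$ (l,j))"
  using assms by (auto simp: scalar_prod_def atLeast0LessThan)

lemma inner_S_eq:
  assumes "X \<in> carrier_mat n n" "Y \<in> carrier_mat n n"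
  shows "inner_S X Y = (\<Sum>i<n. \<Sum>j<n. Re (cnj (X $$ (i,j)) * Y $$ (i,j)))"
proof -
  have "mtrace (mat_adjoint X * Y) = (\<Sum>j<n. \<Sum>i<n. cnj (X $$ (i,j)) * Y $$ (i,j))"
    using assms mult_mat_index[of "mat_adjoint X" n n Y n] by (auto simp: mtrace_def)
  then show ?thesis
    unfolding inner_S_def by (simp only: Re_sum) (rule sum.swap)
qed

lemma Sn_iff:
  "X \<in> Sn rc n \<longleftrightarrow> X \<in> carrier_mat n n \<and> (\<forall>i<n. \<forall>j<n. X $$ (i,j) = cnj (X $$ (j,i))) \<and>
     (rc \<longrightarrow> (\<forall>i<n. \<forall>j<n. Im (X $$ (i,j)) = 0))"
proof -
  have *: "mat_adjoint X = X \<longleftrightarrow> (\<forall>i<n. \<forall>j<n. X $$ (i,j) = cnj (X $$ (j,i)))"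
    if X: "X \<in> carrier_mat n n"
  proof
    assume h: "mat_adjoint X = X"
    have "X $$ (i,j) = cnj (X $$ (j,i))" if "i < n" "j < n" for i j
      using that X mat_adjoint_index[of i X j, unfolded h] by simp
    then show "\<forall>i<n. \<forall>j<n. X $$ (i,j) = cnj (X $$ (j,i))" by blast
  next
    assume h: "\<forall>i<n. \<forall>j<n. X $$ (i,j) = cnj (X $$ (j,i))"
    show "mat_adjoint X = X"
    proof (rule eq_matI)
      fix i j assume "i < dim_row X" "j < dim_col X"
      then have "i < n" "j < n" using X by auto
      with X h[rule_format, of i j] show "mat_adjoint X $$ (i,j) = X $$ (i,j)"
        by (metis carrier_matD mat_adjoint_index)
    qed (use X in auto)
  qed
  show ?thesis
  proof (cases "X \<in> carrier_mat n n")
    case True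
    show ?thesis
      unfolding Sn_def real_mat_def mem_Collect_eq *[OF True] carrier_matD[OF True] ..
  qed (auto simp: Sn_def)
qed

lemma SnD:
  assumes "X \<in> Sn rc n"
  shows "X \<in> carrier_mat n n" "\<And>i j. i < n \<Longrightarrow> j < n \<Longrightarrow> cnj (X $$ (i,j)) = X $$ (j,i)"
    "\<And>i j. rc \<Longrightarrow> i < n \<Longrightarrow> j < n \<Longrightarrow> Im (X $$ (i,j)) = 0"
  using assms unfolding Sn_iff by (blast, metis, blast)

lemma quad_eq_sesq:
  assumes "X \<in> carrier_mat n n" "v \<in> carrier_vec n"
  shows "(X *\<^sub>v v) \<bullet>c v = sesq n X (\<lambda>i. v $ i) (\<lambda>i. v $ i)"
proof -
  have "(X *\<^sub>v v) \<bullet>c v = (\<Sum>i<n. (\<Sum>l<n. X $$ (i,l) * v $ l) * cnj (v $ i))"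
    using assms by (auto simp: scalar_prod_def atLeast0LessThan conjugate_complex_def)
  then show ?thesis
    by (simp add: sesq_def sum_distrib_left sum_distrib_right mult_ac)
qed

lemma sesq_cong:
  assumes "\<And>i. i < n \<Longrightarrow> u i = u' i" "\<And>i. i < n \<Longrightarrow> v i = v' i"
    and "\<And>i j. i < n \<Longrightarrow> j < n \<Longrightarrow> X $$ (i,j) = X' $$ (i,j)"
  shows "sesq n X u v = sesq n X' u' v'"
  unfolding sesq_def using assms by (intro sum.cong refl) auto

lemma psd_sesq_nonneg:
  assumes "X \<in> carrier_mat n n" "psd X"
  shows "0 \<le> Re (sesq n X u u)"
proof -
  have "0 \<le> Re ((X *\<^sub>v vec n u) \<bullet>c vec n u)"
    using assms unfolding psd_def by auto
  also have "(X *\<^sub>v vec n u) \<bullet>c vec n u = sesq n X u u"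
    unfolding quad_eq_sesq[OF assms(1) vec_carrier] by (rule sesq_cong) auto
  finally show ?thesis .
qed

lemma psdI_sesq:
  assumes "X \<in> Sn rc n" "\<And>u. 0 \<le> Re (sesq n X u u)"
  shows "psd X"
  using assms unfolding psd_def Sn_def by (auto simp: quad_eq_sesq)

lemma pd_sesq_pos:
  assumes "X \<in> carrier_mat n n" "pd X" "i < n" "u i \<noteq> 0"
  shows "0 < Re (sesq n X u u)"
proof -
  have "vec n u \<noteq> 0\<^sub>v n"
    using assms(3,4) by (metis index_vec index_zero_vec(1))
  then have "0 < Re ((X *\<^sub>v vec n u) \<bullet>c vec n u)"
    using assms unfolding pd_def by auto
  also have "(X *\<^sub>v vec n u) \<bullet>c vec n u = sesq n X u u"
    unfolding quad_eq_sesq[OF assms(1) vec_carrier] by (rule sesq_cong) auto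
  finally show ?thesis .
qed

lemma sesq_cnj:
  assumes "X \<in> Sn rc n"
  shows "cnj (sesq n X u v) = sesq n X v u"
proof -
  have "cnj (sesq n X u v) = (\<Sum>i<n. \<Sum>l<n. cnj (v l) * X $$ (l,i) * u i)"
    unfolding sesq_def using SnD(2)[OF assms] by (simp add: mult_ac)
  also have "\<dots> = sesq n X v u" unfolding sesq_def by (rule sum.swap)
  finally show ?thesis .
qed

lemma sesq_add_right: "sesq n X u (\<lambda>i. v i + w i) = sesq n X u v + sesq n X u w"
  by (simp add: sesq_def algebra_simps sum.distrib)

lemma sesq_add_left: "sesq n X (\<lambda>i. v i + w i) u = sesq n X v u + sesq n X w u"
  by (simp add: sesq_def algebra_simps sum.distrib)

lemma sesq_scale_right: "sesq n X u (\<lambda>i. c * v i) = c * sesq n X u v"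
  by (simp add: sesq_def sum_distrib_left algebra_simps)

lemma sesq_scale_left: "sesq n X (\<lambda>i. c * v i) u = cnj c * sesq n X v u"
  by (simp add: sesq_def sum_distrib_left algebra_simps)

lemma sesq_sum_right: "sesq n X u (\<lambda>i. \<Sum>a\<in>A. c a * v a i) = (\<Sum>a\<in>A. c a * sesq n X u (v a))"
  by (induction A rule: infinite_finite_induct)
    (simp_all add: sesq_add_right sesq_scale_right, simp_all add: sesq_def)

lemma sesq_sum_left: "sesq n X (\<lambda>i. \<Sum>a\<in>A. c a * v a i) u = (\<Sum>a\<in>A. cnj (c a) * sesq n X (v a) u)"
  by (induction A rule: infinite_finite_induct)
    (simp_all add: sesq_add_left sesq_scale_left, simp_all add: sesq_def)

lemma sesq_sum_mat:
  assumes "\<And>i j. i < n \<Longrightarrow> j < n \<Longrightarrow> X $$ (i,j) = (\<Sum>k\<in>K. c k * Y k $$ (i,j))"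
  shows "sesq n X u v = (\<Sum>k\<in>K. c k * sesq n (Y k) u v)"
proof -
  have "sesq n X u v = (\<Sum>i<n. \<Sum>l<n. \<Sum>k\<in>K. c k * (cnj (u i) * Y k $$ (i,l) * v l))"
    unfolding sesq_def using assms
    by (intro sum.cong refl) (simp add: sum_distrib_left sum_distrib_right mult_ac)
  also have "\<dots> = (\<Sum>i<n. \<Sum>k\<in>K. \<Sum>l<n. c k * (cnj (u i) * Y k $$ (i,l) * v l))"
    by (intro sum.cong refl sum.swap)
  also have "\<dots> = (\<Sum>k\<in>K. \<Sum>i<n. \<Sum>l<n. c k * (cnj (u i) * Y k $$ (i,l) * v l))"
    by (rule sum.swap)
  finally show ?thesis by (simp add: sesq_def sum_distrib_left)
qed

lemma sesq_smult_add:
  assumes "X \<in> carrier_mat n n" "Y \<in> carrier_mat n n"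
  shows "sesq n (a \<cdot>\<^sub>m X + b \<cdot>\<^sub>m Y) u v = a * sesq n X u v + b * sesq n Y u v"
proof -
  have "sesq n (a \<cdot>\<^sub>m X + b \<cdot>\<^sub>m Y) u v =
      (\<Sum>i<n. \<Sum>l<n. a * (cnj (u i) * X $$ (i,l) * v l) + b * (cnj (u i) * Y $$ (i,l) * v l))"
    unfolding sesq_def using assms by (intro sum.cong refl) (simp add: algebra_simps)
  then show ?thesis by (simp add: sesq_def sum.distrib sum_distrib_left)
qed

text \<open>The first-order condition for a minimiser of a semidefinite form on a subspace: the linear
  term of the expansion around a null vector must vanish.\<close>

lemma null_vector_orthogonal:
  fixes a b :: real and z :: complex
  assumes "\<And>t::complex. 0 \<le> 2 * Re (t * z) + (cmod t)\<^sup>2 * b"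
  shows "z = 0"
proof (rule ccontr)
  assume z: "z \<noteq> 0"
  \<comment> \<open>The test value \<open>t = - s * cnj z\<close> turns the expansion into
    \<open>s * (cmod z)^2 * (s * b - 2)\<close>, and this \<open>s\<close> keeps
    \<open>s * b\<close> at most 1, whatever the sign of \<open>b\<close>.\<close>
  define s where "s = 1 / (1 + \<bar>b\<bar>)"
  have s: "s > 0" "s * b \<le> 1"
    unfolding s_def by (simp_all add: field_simps)
  have "0 \<le> 2 * Re ((- complex_of_real s * cnj z) * z) + (cmod (- complex_of_real s * cnj z))\<^sup>2 * b"
    by (rule assms)
  also have "Re ((- complex_of_real s * cnj z) * z) = - s * (cmod z)\<^sup>2"
    unfolding cmod_power2 by (simp add: power2_eq_square algebra_simps)
  also have "(cmod (- complex_of_real s * cnj z))\<^sup>2 = s\<^sup>2 * (cmod z)\<^sup>2"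
    by (simp add: norm_mult power_mult_distrib)
  finally have "0 \<le> s * (cmod z)\<^sup>2 * (s * b - 2)"
    by (simp add: algebra_simps power2_eq_square)
  moreover have "s * (cmod z)\<^sup>2 * (s * b - 2) < 0"
    using s z by (intro mult_pos_neg) auto
  ultimately show False by simp
qed

text \<open>Nonnegativity is asked only along the line through \<open>v\<close> in direction
  \<open>w\<close>. This serves a form that is semidefinite merely on a subspace, as in the
  construction of eigenvectors, as well as the dual slack, which is semidefinite everywhere.\<close>

lemma sesq_null_orthogonal:
  assumes X: "X \<in> Sn rc n" and nonneg: "\<And>t. 0 \<le> Re (sesq n X (\<lambda>i. v i + t * w i) (\<lambda>i. v i + t * w i))"
    and null: "Re (sesq n X v v) = 0"
  shows "sesq n X v w = 0"
proof (rule null_vector_orthogonal)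
  fix t :: complex
  have "sesq n X (\<lambda>i. v i + t * w i) (\<lambda>i. v i + t * w i) =
    sesq n X v v + t * sesq n X v w + cnj (t * sesq n X v w) + (t * cnj t) * sesq n X w w"
    by (simp add: sesq_add_left sesq_add_right sesq_scale_left sesq_scale_right sesq_cnj[OF X]
      algebra_simps)
  also have "Re \<dots> = 2 * Re (t * sesq n X v w) + (cmod t)\<^sup>2 * Re (sesq n X w w)"
    using null by (simp add: complex_norm_square[symmetric] del: complex_mult_cnj)
  finally show "0 \<le> 2 * Re (t * sesq n X v w) + (cmod t)\<^sup>2 * Re (sesq n X w w)"
    using nonneg[of t] by simp
qed

lemma eig_decompD:
  assumes "eig_decomp n X P lam"
  shows "P \<in> carrier_mat n n" "X \<in> carrier_mat n n"
    "\<And>a b. a < n \<Longrightarrow> b < n \<Longrightarrow> (\<Sum>i<n. cnj (P $$ (i,a)) * P $$ (i,b)) = (if a = b then 1 else 0)"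
    "\<And>i l. i < n \<Longrightarrow> l < n \<Longrightarrow> (\<Sum>a<n. P $$ (i,a) * cnj (P $$ (l,a))) = (if i = l then 1 else 0)"
    "\<And>i l. i < n \<Longrightarrow> l < n \<Longrightarrow> X $$ (i,l) = (\<Sum>a<n. complex_of_real (lam a) * (P $$ (i,a) * cnj (P $$ (l,a))))"
    "\<And>i j. i \<le> j \<Longrightarrow> j < n \<Longrightarrow> lam j \<le> lam i"
proof -
  have P: "P \<in> carrier_mat n n" and U: "mat_adjoint P * P = 1\<^sub>m n"
    and X: "X = P * mat_diag n (\<lambda>i. complex_of_real (lam i)) * mat_adjoint P"
    using assms by (auto simp: eig_decomp_def unitary_n_def)
  show "P \<in> carrier_mat n n" by fact
  show "X \<in> carrier_mat n n"
    unfolding X using P mat_adjoint_carrier[OF P] by (auto intro!: carrier_matI)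
  have U': "P * mat_adjoint P = 1\<^sub>m n"
    using mat_mult_left_right_inverse[OF mat_adjoint_carrier[OF P] P U] .
  show "(\<Sum>i<n. cnj (P $$ (i,a)) * P $$ (i,b)) = (if a = b then 1 else 0)" if "a < n" "b < n" for a b
    using arg_cong[OF U, of "\<lambda>A. A $$ (a,b)"] that P
      mult_mat_index[OF mat_adjoint_carrier[OF P] P that] by simp
  show "(\<Sum>a<n. P $$ (i,a) * cnj (P $$ (l,a))) = (if i = l then 1 else 0)" if "i < n" "l < n" for i l
    using arg_cong[OF U', of "\<lambda>A. A $$ (i,l)"] that P
      mult_mat_index[OF P mat_adjoint_carrier[OF P] that] by simp
  have PD: "P * mat_diag n (\<lambda>i. complex_of_real (lam i)) = mat n n (\<lambda>(i,a). P $$ (i,a) * lam a)"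
    using mat_diag_mult_right[OF P] by simp
  show "X $$ (i,l) = (\<Sum>a<n. complex_of_real (lam a) * (P $$ (i,a) * cnj (P $$ (l,a))))"
    if "i < n" "l < n" for i l
    using that P mult_mat_index[OF _ mat_adjoint_carrier[OF P] that,
        of "P * mat_diag n (\<lambda>i. complex_of_real (lam i))"]
    by (simp add: X PD mult_ac)
  show "\<And>i j. i \<le> j \<Longrightarrow> j < n \<Longrightarrow> lam j \<le> lam i"
    using assms by (simp add: eig_decomp_def)
qed

text \<open>Bolzano-Weierstrass by induction on the number of coordinates: a further subsequence
  makes the next coordinate converge and preserves the limits already obtained.\<close>

lemma bounded_coordinates_convergent_subseq:
  fixes x :: "nat \<Rightarrow> nat \<Rightarrow> 'a::heine_borel"
  assumes "\<And>k. k < d \<Longrightarrow> bounded (range (\<lambda>j. x j k))"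
  shows "\<exists>\<sigma> l. strict_mono (\<sigma> :: nat \<Rightarrow> nat) \<and> (\<forall>k<d. (\<lambda>j. x (\<sigma> j) k) \<longlonglongrightarrow> l k)"
  using assms
proof (induction d)
  case 0
  then show ?case by (intro exI[of _ id]) (auto simp: strict_mono_def)
next
  case (Suc d)
  then obtain \<sigma> l where \<sigma>: "strict_mono (\<sigma> :: nat \<Rightarrow> nat)" and l: "\<forall>k<d. (\<lambda>j. x (\<sigma> j) k) \<longlonglongrightarrow> l k"
    using less_Suc_eq by metis
  have "bounded (range (\<lambda>j. x (\<sigma> j) d))"
    by (rule bounded_subset[OF Suc.prems[of d]]) auto
  then obtain l' \<tau> where \<tau>: "strict_mono (\<tau> :: nat \<Rightarrow> nat)" and l': "((\<lambda>j. x (\<sigma> j) d) \<circ> \<tau>) \<longlonglongrightarrow> l'"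
    using bounded_imp_convergent_subsequence[of "\<lambda>j. x (\<sigma> j) d"] by blast
  have "(\<lambda>j. x ((\<sigma> \<circ> \<tau>) j) k) \<longlonglongrightarrow> (l(d := l')) k" if "k < Suc d" for k
  proof (cases "k = d")
    case True
    then show ?thesis using l' by (simp add: o_def)
  next
    case False
    then have "(\<lambda>j. x (\<sigma> j) k) \<longlonglongrightarrow> l k" using l that by auto
    from LIMSEQ_subseq_LIMSEQ[OF this \<tau>] show ?thesis using False by (simp add: o_def)
  qed
  then show ?case using strict_mono_o[OF \<sigma> \<tau>] by blast
qed

section \<open>Spectral theorem and rank\<close>

definition cinner :: "nat \<Rightarrow> (nat \<Rightarrow> complex) \<Rightarrow> (nat \<Rightarrow> complex) \<Rightarrow> complex" where
  "cinner n v w = (\<Sum>i<n. cnj (v i) * w i)"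

lemma cinner_self: "cinner n v v = complex_of_real (\<Sum>i<n. (cmod (v i))\<^sup>2)"
  unfolding cinner_def of_real_sum complex_norm_square by (simp only: mult.commute)

lemma cinner_cnj: "cnj (cinner n v w) = cinner n w v"
  by (simp add: cinner_def mult.commute)

lemma cinner_self_eq_0_iff: "cinner n v v = 0 \<longleftrightarrow> (\<forall>i<n. v i = 0)"
  unfolding cinner_self of_real_eq_0_iff by (subst sum_nonneg_eq_0_iff) auto

lemma cinner_scale_right: "cinner n v (\<lambda>i. c * w i) = c * cinner n v w"
  by (simp add: cinner_def sum_distrib_left algebra_simps)

lemma cinner_add_right: "cinner n v (\<lambda>i. w i + w' i) = cinner n v w + cinner n v w'"
  by (simp add: cinner_def algebra_simps sum.distrib)

lemma sesq_eq_cinner: "sesq n X u v = cinner n u (\<lambda>i. \<Sum>l<n. X $$ (i,l) * v l)"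
  by (simp add: sesq_def cinner_def sum_distrib_left mult.assoc)

lemma cinner_rescale:
  "cinner n (\<lambda>i. complex_of_real t * w i) (\<lambda>i. complex_of_real t * w i) = complex_of_real (t\<^sup>2) * cinner n w w"
  by (simp add: cinner_def sum_distrib_left power2_eq_square algebra_simps)

lemma unit_rescaling_exists:
  assumes "cinner n w w \<noteq> 0"
  shows "\<exists>t>0. cinner n (\<lambda>i. complex_of_real t * w i) (\<lambda>i. complex_of_real t * w i) = 1"
proof -
  define s where "s = (\<Sum>i<n. (cmod (w i))\<^sup>2)"
  have w: "cinner n w w = complex_of_real s" by (simp add: cinner_self s_def)
  then have "s > 0" using assms unfolding s_def by (metis of_real_0 sum_nonneg zero_le_power2 less_eq_real_def)
  have "(1 / sqrt s)\<^sup>2 * s = 1" using \<open>s > 0\<close> by (simp add: power_divide)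
  then have "cinner n (\<lambda>i. complex_of_real (1 / sqrt s) * w i) (\<lambda>i. complex_of_real (1 / sqrt s) * w i) = 1"
    unfolding cinner_rescale w by (metis of_real_1 of_real_mult)
  then show ?thesis using \<open>s > 0\<close> by (intro exI[of _ "1 / sqrt s"] conjI) auto
qed

text \<open>The vectors, conjugated and padded by zero rows, form a singular square matrix; a
  normalised kernel vector is orthogonal to all of them.\<close>

lemma orthogonal_unit_vector_exists:
  assumes "k < n"
  shows "\<exists>v. cinner n v v = 1 \<and> (\<forall>a<k. cinner n (u a) v = 0)"
proof -
  define M where "M = mat n n (\<lambda>(a,i). if a < k then cnj (u a i) else 0)"
  have M: "M \<in> carrier_mat n n" by (simp add: M_def)
  \<comment> \<open>Row \<open>k\<close> of \<open>M\<close> is one of the zero rows, since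
    \<open>k < n\<close>; so singularity is easiest to see on the transpose.\<close>
  have "transpose_mat M *\<^sub>v unit_vec n k = 0\<^sub>v n"
    using assms by (intro eq_vecI) (auto simp: M_def)
  moreover have "unit_vec n k \<noteq> (0\<^sub>v n :: complex vec)"
    using assms by (simp add: unit_vec_nonzero)
  ultimately have "\<exists>v. v \<in> carrier_vec n \<and> v \<noteq> 0\<^sub>v n \<and> transpose_mat M *\<^sub>v v = 0\<^sub>v n"
    by (intro exI[of _ "unit_vec n k"] conjI unit_vec_carrier)
  then have "det (transpose_mat M) = 0"
    using det_0_iff_vec_prod_zero_field[of "transpose_mat M" n] M by simp
  then have "det M = 0" using det_transpose[OF M] by simp
  then obtain x where x: "x \<in> carrier_vec n" "x \<noteq> 0\<^sub>v n" "M *\<^sub>v x = 0\<^sub>v n"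
    using det_0_iff_vec_prod_zero_field[OF M] by auto
  have orth: "cinner n (u a) (\<lambda>i. x $ i) = 0" if "a < k" for a
  proof -
    have "(M *\<^sub>v x) $ a = 0" using x(3) that assms by simp
    then show ?thesis
      using that assms x(1) by (simp add: M_def scalar_prod_def cinner_def atLeast0LessThan)
  qed
  have "cinner n (\<lambda>i. x $ i) (\<lambda>i. x $ i) \<noteq> 0"
    using x(1,2) by (auto simp: cinner_self_eq_0_iff vec_eq_iff)
  then obtain t where t: "cinner n (\<lambda>i. complex_of_real t * x $ i) (\<lambda>i. complex_of_real t * x $ i) = 1"
    using unit_rescaling_exists by blast
  moreover have "\<forall>a<k. cinner n (u a) (\<lambda>i. complex_of_real t * x $ i) = 0"
    unfolding cinner_scale_right using orth by simp
  ultimately show ?thesis by blast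
qed

lemma unit_vector_entry_le: 
  assumes "cinner n v v = 1" "i < n" shows "cmod (v i) \<le> 1"
proof -
  have "(\<Sum>i<n. (cmod (v i))\<^sup>2) = 1"
    using assms(1) unfolding cinner_self of_real_eq_1_iff .
  moreover have "(cmod (v i))\<^sup>2 \<le> (\<Sum>i<n. (cmod (v i))\<^sup>2)"
    using assms(2) by (intro member_le_sum) auto
  ultimately show ?thesis by (simp add: power_le_one_iff)
qed

lemma tendsto_sesq:
  assumes "\<And>i. i < n \<Longrightarrow> ((\<lambda>j. u j i) \<longlongrightarrow> u' i) F" "\<And>i. i < n \<Longrightarrow> ((\<lambda>j. v j i) \<longlongrightarrow> v' i) F"
    and "\<And>i l. i < n \<Longrightarrow> l < n \<Longrightarrow> ((\<lambda>j. X j $$ (i,l)) \<longlongrightarrow> X' $$ (i,l)) F"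
  shows "((\<lambda>j. sesq n (X j) (u j) (v j)) \<longlongrightarrow> sesq n X' u' v') F"
  unfolding sesq_def by (intro tendsto_sum tendsto_mult tendsto_cnj) (auto intro: assms)

lemma unit_sequence_convergent_subseq:
  assumes "\<And>j. cinner n (v j) (v j) = 1"
  shows "\<exists>\<sigma> l. strict_mono (\<sigma> :: nat \<Rightarrow> nat) \<and> (\<forall>i<n. (\<lambda>j. v (\<sigma> j) i) \<longlonglongrightarrow> l i) \<and> cinner n l l = 1"
proof -
  have "bounded (range (\<lambda>j. v j i))" if "i < n" for i
    using unit_vector_entry_le[OF assms that] by (intro boundedI[of _ 1]) auto
  then obtain \<sigma> l where \<sigma>: "strict_mono (\<sigma> :: nat \<Rightarrow> nat)" and l: "\<forall>i<n. (\<lambda>j. v (\<sigma> j) i) \<longlonglongrightarrow> l i"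
    using bounded_coordinates_convergent_subseq[of n v] by auto
  have "(\<lambda>j. cinner n (v (\<sigma> j)) (v (\<sigma> j))) \<longlonglongrightarrow> cinner n l l"
    unfolding cinner_def using l by (intro tendsto_intros) auto
  then have "cinner n l l = 1" using assms by (simp add: LIMSEQ_const_iff)
  with \<sigma> l show ?thesis by blast
qed

text \<open>The supremum over the unit sphere of the orthogonal complement is attained by
  compactness. The last clause is stated in homogeneous form, so that later competitors
  \<open>w\<close> need not be normalised.\<close>

lemma quadratic_form_maximiser:
  assumes X: "X \<in> Sn rc n" and k: "k < n"
  shows "\<exists>v. cinner n v v = 1 \<and> (\<forall>a<k. cinner n (u a) v = 0) \<and>
    (\<forall>w. (\<forall>a<k. cinner n (u a) w = 0) \<longrightarrow>
       Re (sesq n X w w) \<le> Re (sesq n X v v) * Re (cinner n w w))"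
proof -
  define U where "U = {v. cinner n v v = 1 \<and> (\<forall>a<k. cinner n (u a) v = 0)}"
  define Q where "Q = (\<lambda>v. Re (sesq n X v v))"
  have "U \<noteq> {}" using orthogonal_unit_vector_exists[OF k] by (auto simp: U_def)
  have bdd: "Q v \<le> (\<Sum>i<n. \<Sum>l<n. cmod (X $$ (i,l)))" if "v \<in> U" for v
  proof -
    have "Q v \<le> cmod (sesq n X v v)" unfolding Q_def by (rule complex_Re_le_cmod)
    also have "\<dots> \<le> (\<Sum>i<n. \<Sum>l<n. cmod (cnj (v i) * X $$ (i,l) * v l))"
      unfolding sesq_def by (intro order_trans[OF norm_sum] sum_mono order_refl)
    also have "\<dots> \<le> (\<Sum>i<n. \<Sum>l<n. cmod (X $$ (i,l)))"
    proof (intro sum_mono)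
      fix i l assume "i \<in> {..<n}" "l \<in> {..<n}"
      then have "cmod (v i) \<le> 1" "cmod (v l) \<le> 1"
        using unit_vector_entry_le that by (auto simp: U_def)
      then have "cmod (v i) * cmod (v l) * cmod (X $$ (i,l)) \<le> 1 * 1 * cmod (X $$ (i,l))"
        by (intro mult_mono) auto
      then show "cmod (cnj (v i) * X $$ (i,l) * v l) \<le> cmod (X $$ (i,l))"
        by (simp add: norm_mult mult_ac)
    qed
    finally show ?thesis .
  qed
  define s where "s = Sup (Q ` U)"
  have bA: "bdd_above (Q ` U)" using bdd by (auto simp: bdd_above_def)
  have "\<exists>v\<in>U. s - 1 / real (Suc j) < Q v" for j
    using less_cSup_iff[of "Q ` U" "s - 1 / real (Suc j)"] \<open>U \<noteq> {}\<close> bA by (auto simp: s_def)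
  then obtain v where v: "\<And>j. v j \<in> U" "\<And>j. s - 1 / real (Suc j) < Q (v j)" by metis
  obtain \<sigma> l where \<sigma>: "strict_mono (\<sigma> :: nat \<Rightarrow> nat)" and l: "\<forall>i<n. (\<lambda>j. v (\<sigma> j) i) \<longlonglongrightarrow> l i"
    and l1: "cinner n l l = 1"
    using unit_sequence_convergent_subseq[of n v] v(1) by (auto simp: U_def)
  have "cinner n (u a) l = 0" if "a < k" for a
  proof -
    have "(\<lambda>j. cinner n (u a) (v (\<sigma> j))) \<longlonglongrightarrow> cinner n (u a) l"
      unfolding cinner_def using l by (intro tendsto_intros) auto
    then show ?thesis using v(1) that by (simp add: U_def LIMSEQ_const_iff)
  qed
  moreover have Ql: "s \<le> Q l"
  proof (rule LIMSEQ_le)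
    show "(\<lambda>j. s - 1 / real (Suc j)) \<longlonglongrightarrow> s"
      using tendsto_diff[OF tendsto_const LIMSEQ_inverse_real_of_nat, of s] by (simp add: inverse_eq_divide)
    show "(\<lambda>j. Q (v (\<sigma> j))) \<longlonglongrightarrow> Q l"
      unfolding Q_def using l by (intro tendsto_Re tendsto_sesq) auto
    have "s - 1 / real (Suc j) \<le> Q (v (\<sigma> j))" for j
    proof -
      have "1 / real (Suc (\<sigma> j)) \<le> 1 / real (Suc j)"
        using seq_suble[OF \<sigma>, of j] by (simp add: frac_le)
      then show ?thesis using v(2)[of "\<sigma> j"] by linarith
    qed
    then show "\<exists>N. \<forall>j\<ge>N. s - 1 / real (Suc j) \<le> Q (v (\<sigma> j))" by blast
  qed
  moreover have "Q w \<le> Q l * Re (cinner n w w)" if w: "\<forall>a<k. cinner n (u a) w = 0" for w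
  proof (cases "cinner n w w = 0")
    case True
    then have "\<forall>i<n. w i = 0" by (simp add: cinner_self_eq_0_iff)
    then show ?thesis using True by (simp add: Q_def sesq_def)
  next
    case False
    then obtain t where t: "t > 0"
      "cinner n (\<lambda>i. complex_of_real t * w i) (\<lambda>i. complex_of_real t * w i) = 1"
      using unit_rescaling_exists by blast
    have "1 = t\<^sup>2 * Re (cinner n w w)"
      using arg_cong[OF t(2), of Re] unfolding cinner_rescale by (simp flip: of_real_power)
    have "\<forall>a<k. cinner n (u a) (\<lambda>i. complex_of_real t * w i) = 0"
      unfolding cinner_scale_right using w by simp
    then have "Q (\<lambda>i. complex_of_real t * w i) \<le> s"
      unfolding s_def using bA t(2) by (intro cSUP_upper) (auto simp: U_def)
    moreover have "Q (\<lambda>i. complex_of_real t * w i) = t\<^sup>2 * Q w"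
      unfolding Q_def sesq_scale_left sesq_scale_right by (simp add: power2_eq_square)
    ultimately have "t\<^sup>2 * Q w \<le> Q l * (t\<^sup>2 * Re (cinner n w w))"
      using Ql \<open>1 = t\<^sup>2 * Re (cinner n w w)\<close> by simp
    then have "t\<^sup>2 * Q w \<le> t\<^sup>2 * (Q l * Re (cinner n w w))" by (simp add: mult_ac)
    then show ?thesis using t(1) by simp
  qed
  ultimately show ?thesis using l1 unfolding Q_def by blast
qed

text \<open>Let \<open>v\<close> maximise the form on the complement of the eigenvectors found so
  far, with value \<open>q\<close>. Then \<open>Y = q I - X\<close> is semidefinite on that
  complement and vanishes at \<open>v\<close>, so \<open>Y v\<close> is orthogonal to the
  complement. It also lies in the complement, because the earlier vectors are eigenvectors. Hence
  \<open>Y v = 0\<close>. The maximality clause is carried through the induction because it later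
  yields the ordering of the eigenvalues.\<close>

lemma hermitian_eigenvectors:
  assumes X: "X \<in> Sn rc n" and "k \<le> n"
  shows "\<exists>u lam. (\<forall>a<k. \<forall>b<k. cinner n (u a) (u b) = (if a = b then 1 else 0)) \<and>
    (\<forall>a<k. \<forall>i<n. (\<Sum>l<n. X $$ (i,l) * u a l) = complex_of_real (lam a) * u a i) \<and>
    (\<forall>a<k. \<forall>w. (\<forall>b<a. cinner n (u b) w = 0) \<longrightarrow> Re (sesq n X w w) \<le> lam a * Re (cinner n w w))"
  using \<open>k \<le> n\<close>
proof (induction k)
  case 0
  then show ?case by simp
next
  case (Suc k)
  then obtain u and lam :: "nat \<Rightarrow> real"
    where on: "\<forall>a<k. \<forall>b<k. cinner n (u a) (u b) = (if a = b then 1 else 0)"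
      and ev: "\<forall>a<k. \<forall>i<n. (\<Sum>l<n. X $$ (i,l) * u a l) = complex_of_real (lam a) * u a i"
      and mx: "\<forall>a<k. \<forall>w. (\<forall>b<a. cinner n (u b) w = 0) \<longrightarrow> Re (sesq n X w w) \<le> lam a * Re (cinner n w w)"
    by auto
  obtain v where v1: "cinner n v v = 1" and vo: "\<forall>a<k. cinner n (u a) v = 0"
    and vm: "\<forall>w. (\<forall>a<k. cinner n (u a) w = 0) \<longrightarrow>
       Re (sesq n X w w) \<le> Re (sesq n X v v) * Re (cinner n w w)"
    using quadratic_form_maximiser[OF X, of k u] Suc.prems by auto
  define q where "q = Re (sesq n X v v)"
  define Y where "Y = mat n n (\<lambda>(i,l). (if i = l then complex_of_real q else 0) - X $$ (i,l))"
  have Y: "Y \<in> Sn False n"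
    using SnD(1,2)[OF X] unfolding Sn_iff Y_def by auto
  have Yv: "(\<Sum>l<n. Y $$ (i,l) * w l) = q * w i - (\<Sum>l<n. X $$ (i,l) * w l)" if "i < n" for i and w :: "nat \<Rightarrow> complex"
  proof -
    have "(\<Sum>l<n. Y $$ (i,l) * w l) = (\<Sum>l<n. (if l = i then q * w i else 0) - X $$ (i,l) * w l)"
      using that by (intro sum.cong) (auto simp: Y_def algebra_simps)
    then show ?thesis using that by (simp add: sum_subtractf)
  qed
  have sY: "sesq n Y w w' = q * cinner n w w' - sesq n X w w'" for w w'
  proof -
    have "sesq n Y w w' = (\<Sum>i<n. cnj (w i) * (q * w' i) - cnj (w i) * (\<Sum>l<n. X $$ (i,l) * w' l))"
      unfolding sesq_eq_cinner cinner_def by (intro sum.cong) (auto simp: Yv right_diff_distrib)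
    then show ?thesis
      by (simp add: sum_subtractf sesq_eq_cinner cinner_def sum_distrib_left mult_ac)
  qed
  define z where "z = (\<lambda>i. \<Sum>l<n. Y $$ (i,l) * v l)"
  have null: "sesq n Y v w = 0" if w: "\<forall>a<k. cinner n (u a) w = 0" for w
  proof (rule sesq_null_orthogonal[OF Y])
    fix t
    have "\<forall>a<k. cinner n (u a) (\<lambda>i. v i + t * w i) = 0"
      using vo w by (simp add: cinner_add_right cinner_scale_right)
    then show "0 \<le> Re (sesq n Y (\<lambda>i. v i + t * w i) (\<lambda>i. v i + t * w i))"
      using vm by (simp add: sY q_def)
    show "Re (sesq n Y v v) = 0" by (simp add: sY v1 q_def)
  qed
  have zo: "\<forall>a<k. cinner n (u a) z = 0"
  proof (intro allI impI)
    fix a assume a: "a < k"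
    have "cinner n (u a) z = sesq n Y (u a) v" by (simp add: z_def sesq_eq_cinner)
    also have "\<dots> = cnj (sesq n Y v (u a))" by (simp add: sesq_cnj[OF Y])
    also have "sesq n Y v (u a) = cinner n v (\<lambda>i. (q - lam a) * u a i)"
      unfolding sesq_eq_cinner cinner_def
      by (intro sum.cong refl) (use ev a in \<open>simp add: Yv left_diff_distrib\<close>)
    also have "\<dots> = (q - lam a) * cnj (cinner n (u a) v)"
      by (simp only: cinner_scale_right cinner_cnj)
    also have "\<dots> = 0" using vo a by simp
    finally show "cinner n (u a) z = 0" by simp
  qed
  have "cinner n z z = sesq n Y z v" by (simp add: z_def sesq_eq_cinner)
  also have "\<dots> = cnj (sesq n Y v z)" by (simp add: sesq_cnj[OF Y])
  also have "\<dots> = 0" using null[OF zo] by simp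
  finally have "\<forall>i<n. z i = 0" by (simp add: cinner_self_eq_0_iff)
  then have evv: "\<forall>i<n. (\<Sum>l<n. X $$ (i,l) * v l) = q * v i"
    by (simp add: z_def Yv)
  have vo': "\<forall>a<k. cinner n v (u a) = 0" using vo by (metis cinner_cnj complex_cnj_zero)
  show ?case
  proof (intro exI[of _ "u(k := v)"] exI[of _ "lam(k := q)"] conjI)
    show "\<forall>a<Suc k. \<forall>b<Suc k. cinner n ((u(k := v)) a) ((u(k := v)) b) = (if a = b then 1 else 0)"
      using on v1 vo vo' by (auto simp: less_Suc_eq)
    show "\<forall>a<Suc k. \<forall>i<n. (\<Sum>l<n. X $$ (i,l) * (u(k := v)) a l) =
        complex_of_real ((lam(k := q)) a) * (u(k := v)) a i"
      using ev evv by (auto simp: less_Suc_eq)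
    show "\<forall>a<Suc k. \<forall>w. (\<forall>b<a. cinner n ((u(k := v)) b) w = 0) \<longrightarrow>
        Re (sesq n X w w) \<le> (lam(k := q)) a * Re (cinner n w w)"
      using mx vm by (auto simp: less_Suc_eq q_def)
  qed
qed

text \<open>The spectral theorem with ordered eigenvalues. \<open>eig_decomp\<close> admits a
  complex unitary \<open>P\<close> for a real matrix as well, so complex eigenvectors suffice in
  both cases.\<close>

theorem eig_decomp_exists:
  assumes X: "X \<in> Sn rc n"
  shows "\<exists>P lam. eig_decomp n X P lam"
proof -
  obtain u and lam :: "nat \<Rightarrow> real"
    where on: "\<forall>a<n. \<forall>b<n. cinner n (u a) (u b) = (if a = b then 1 else 0)"
      and ev: "\<forall>a<n. \<forall>i<n. (\<Sum>l<n. X $$ (i,l) * u a l) = complex_of_real (lam a) * u a i"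
      and mx: "\<forall>a<n. \<forall>w. (\<forall>b<a. cinner n (u b) w = 0) \<longrightarrow> Re (sesq n X w w) \<le> lam a * Re (cinner n w w)"
    using hermitian_eigenvectors[OF X order_refl] by auto
  define P where "P = mat n n (\<lambda>(i,a). u a i)"
  have P: "P \<in> carrier_mat n n" by (simp add: P_def)
  have Xc: "X \<in> carrier_mat n n" by (rule SnD(1)[OF X])
  have U: "mat_adjoint P * P = 1\<^sub>m n"
  proof (rule eq_matI)
    fix a b assume "a < dim_row (1\<^sub>m n :: complex mat)" "b < dim_col (1\<^sub>m n :: complex mat)"
    then have ab: "a < n" "b < n" by auto
    show "(mat_adjoint P * P) $$ (a,b) = 1\<^sub>m n $$ (a,b)"
      unfolding mult_mat_index[OF mat_adjoint_carrier[OF P] P ab]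
      using ab on P by (simp add: P_def cinner_def)
  qed (use P in auto)
  then have un: "unitary_n n P" using P by (simp add: unitary_n_def)
  have U': "P * mat_adjoint P = 1\<^sub>m n"
    using mat_mult_left_right_inverse[OF mat_adjoint_carrier[OF P] P U] .
  have "X * P = P * mat_diag n (\<lambda>i. complex_of_real (lam i))"
    unfolding mat_diag_mult_right[OF P]
  proof (rule eq_matI)
    fix i a assume "i < dim_row (mat n n (\<lambda>(i,j). P $$ (i,j) * complex_of_real (lam j)))"
      "a < dim_col (mat n n (\<lambda>(i,j). P $$ (i,j) * complex_of_real (lam j)))"
    then have ia: "i < n" "a < n" by auto
    show "(X * P) $$ (i,a) = mat n n (\<lambda>(i,j). P $$ (i,j) * complex_of_real (lam j)) $$ (i,a)"
      unfolding mult_mat_index[OF Xc P ia] using ia ev by (simp add: P_def)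
  qed (use P Xc in auto)
  then have "P * mat_diag n (\<lambda>i. complex_of_real (lam i)) * mat_adjoint P = X * (P * mat_adjoint P)"
    using assoc_mult_mat[OF Xc P mat_adjoint_carrier[OF P]] by simp
  then have "X = P * mat_diag n (\<lambda>i. complex_of_real (lam i)) * mat_adjoint P"
    using U' Xc by simp
  \<comment> \<open>The later eigenvector \<open>u b\<close> is an admissible competitor in the
    maximum that defines \<open>lam a\<close>.\<close>
  moreover have "lam b \<le> lam a" if "a \<le> b" "b < n" for a b
  proof -
    have "\<forall>c<a. cinner n (u c) (u b) = 0" using on that by auto
    then have "Re (sesq n X (u b) (u b)) \<le> lam a * Re (cinner n (u b) (u b))"
      using mx that by auto
    moreover have "sesq n X (u b) (u b) = cinner n (u b) (\<lambda>i. lam b * u b i)"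
      unfolding sesq_eq_cinner cinner_def using ev that by (intro sum.cong) auto
    ultimately show ?thesis using on that by (simp add: cinner_scale_right)
  qed
  ultimately show ?thesis using un by (auto simp: eig_decomp_def)
qed

text \<open>A decomposition exists, so the \<open>SOME\<close> in \<open>spectral_op\<close> picks a
  product of square factors of size \<open>n\<close>; its inner products with matrices of that size
  can then be expanded entrywise.\<close>

corollary spectral_op_carrier:
  assumes "X \<in> Sn rc n"
  shows "spectral_op n f X \<in> carrier_mat n n"
proof -
  let ?R = "\<lambda>Y. \<exists>P lam. eig_decomp n X P lam \<and>
     Y = P * mat_diag n (\<lambda>i. complex_of_real (f (vec n lam) $ i)) * mat_adjoint P"
  have "\<exists>Y. ?R Y" using eig_decomp_exists[OF assms] by blast
  then have "?R (spectral_op n f X)" unfolding spectral_op_def by (rule someI_ex)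
  then show ?thesis using eig_decompD(1) by (auto intro!: carrier_matI dest!: eig_decompD(1))
qed

text \<open>A nonzero determinant of \<open>L * (X * R)\<close> makes the \<open>k\<close> columns
  of \<open>X * R\<close> distinct and independent, and they lie in the column space of
  \<open>X\<close>.\<close>

lemma (in vec_space) minor_le_rank:
  assumes X: "X \<in> carrier_mat n n" and R: "R \<in> carrier_mat n k" and L: "L \<in> carrier_mat k n"
    and nz: "det (L * (X * R)) \<noteq> 0"
  shows "k \<le> rank X"
proof -
  let ?W = "X * R"
  have W: "?W \<in> carrier_mat n k" using X R by simp
  have M: "L * ?W \<in> carrier_mat k k" using L W by simp
  have dist: "distinct (cols ?W)"
  proof (rule ccontr)
    assume "\<not> distinct (cols ?W)"
    then obtain i j where ij: "i \<noteq> j" "i < k" "j < k" "col ?W i = col ?W j"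
      using W by (auto simp: distinct_conv_nth)
    then have "col (L * ?W) i = col (L * ?W) j"
      using W L by (simp add: col_mult2[OF L W])
    then show False using det_identical_cols[OF M ij(1,2,3)] nz by simp
  qed
  have indpt: "lin_indpt (set (cols ?W))"
  proof
    assume "lin_dep (set (cols ?W))"
    then obtain v where v: "v \<in> carrier_vec k" "v \<noteq> 0\<^sub>v k" "?W *\<^sub>v v = 0\<^sub>v n"
      using lin_depE[OF W _ dist] by blast
    have "(L * ?W) *\<^sub>v v = L *\<^sub>v (?W *\<^sub>v v)" using assoc_mult_mat_vec[OF L W v(1)] .
    also have "\<dots> = 0\<^sub>v k" unfolding v(3) by (rule eq_vecI) (use L in auto)
    finally show False using det_0_iff_vec_prod_zero_field[OF M] v nz by auto
  qed
  have colsX: "set (cols X) \<subseteq> carrier_vec n" using X cols_dim by blast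
  have "set (cols ?W) \<subseteq> span (set (cols X))"
  proof
    fix x assume "x \<in> set (cols ?W)"
    then obtain j where j: "j < k" "x = col ?W j" using W by (auto simp: in_set_conv_nth)
    then have "x = X *\<^sub>v col R j" using col_mult2[OF X R] by simp
    moreover have "X *\<^sub>v col R j \<in> col_space X"
      unfolding col_space_eq[OF X] using X R j by (auto intro!: bexI[of _ "col R j"])
    ultimately show "x \<in> span (set (cols X))" by (simp add: col_space_def)
  qed
  then have sub: "span (set (cols ?W)) \<subseteq> span (set (cols X))"
    using span_is_submodule[OF colsX] by (intro span_is_subset) auto
  have ssX: "subspace class_ring (span (set (cols X))) V"
    using colsX span_is_subspace by blast
  have ssW: "subspace class_ring (span (set (cols ?W))) V"
    using W cols_dim span_is_subspace by (metis carrier_matD(1))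
  have "vectorspace.dim class_ring (span_vs (set (cols ?W))) \<le> rank X"
    using vectorspace.subspace_dim[OF subspace_is_vs[OF ssX] nested_subspaces[OF ssX ssW sub]
        fin_dim_span_cols[OF X]] fin_dim_span_cols[OF W]
    unfolding rank_def by simp
  then show ?thesis using lin_indpt_full_rank[OF W dist indpt] by (simp add: rank_def)
qed

text \<open>The array of form values factors as \<open>U * (X * V)\<close>, so it is a minor of
  \<open>X\<close> taken in arbitrary frames. Choosing eigenvectors as frames makes these minors
  easy to evaluate.\<close>

lemma sesq_minor_zero:
  assumes X: "X \<in> carrier_mat n n" and rk: "vec_space.rank n X < k"
  shows "det (mat k k (\<lambda>(a,b). sesq n X (u a) (v b))) = 0"
proof (rule ccontr)
  assume nz: "det (mat k k (\<lambda>(a,b). sesq n X (u a) (v b))) \<noteq> 0"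
  define U where "U = mat k n (\<lambda>(a,i). cnj (u a i))"
  define V where "V = mat n k (\<lambda>(i,b). v b i)"
  have U: "U \<in> carrier_mat k n" and V: "V \<in> carrier_mat n k" by (simp_all add: U_def V_def)
  have XV: "X * V \<in> carrier_mat n k" using X V by simp
  have "U * (X * V) = mat k k (\<lambda>(a,b). sesq n X (u a) (v b))"
  proof (rule eq_matI)
    fix a b assume "a < dim_row (mat k k (\<lambda>(a,b). sesq n X (u a) (v b)))"
      "b < dim_col (mat k k (\<lambda>(a,b). sesq n X (u a) (v b)))"
    then have ab: "a < k" "b < k" by auto
    have "(U * (X * V)) $$ (a,b) = (\<Sum>i<n. cnj (u a i) * (\<Sum>l<n. X $$ (i,l) * v b l))"
    proof -
      have "(X * V) $$ (i,b) = (\<Sum>l<n. X $$ (i,l) * v b l)" if "i < n" for i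
        unfolding mult_mat_index[OF X V that ab(2)] using ab by (simp add: V_def)
      moreover have "U $$ (a,i) = cnj (u a i)" if "i < n" for i using that ab by (simp add: U_def)
      ultimately show ?thesis unfolding mult_mat_index[OF U XV ab] by (intro sum.cong) auto
    qed
    then show "(U * (X * V)) $$ (a,b) = mat k k (\<lambda>(a,b). sesq n X (u a) (v b)) $$ (a,b)"
      using ab by (simp add: sesq_eq_cinner cinner_def)
  qed (use U V in auto)
  then have "k \<le> vec_space.rank n X"
    using vec_space.minor_le_rank[OF X V U] nz by simp
  then show False using rk by simp
qed

text \<open>Subadditivity of the rank, one dyad at a time.\<close>

lemma rank_sum_rank1_le:
  fixes g h :: "nat \<Rightarrow> nat \<Rightarrow> complex"
  assumes "X \<in> carrier_mat n n"
    and "\<And>i l. i < n \<Longrightarrow> l < n \<Longrightarrow> X $$ (i,l) = (\<Sum>a<s. g a i * h a l)"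
  shows "vec_space.rank n X \<le> s"
  using assms
proof (induction s arbitrary: X)
  case 0
  then have "X = 0\<^sub>m n n" by (intro eq_matI) auto
  then show ?case using vec_space.rank_0I[of n n] by simp
next
  case (Suc s)
  define Y where "Y = mat n n (\<lambda>(i,l). \<Sum>a<s. g a i * h a l)"
  define Z where "Z = mat n n (\<lambda>(i,l). g s i * h s l)"
  have c: "Y \<in> carrier_mat n n" "Z \<in> carrier_mat n n" by (simp_all add: Y_def Z_def)
  have "X = Y + Z" using Suc.prems by (intro eq_matI) (auto simp: Y_def Z_def)
  then have "vec_space.rank n X \<le> vec_space.rank n Y + vec_space.rank n Z"
    using vec_space.rank_subadditive[OF c] by simp
  moreover have "vec_space.rank n Y \<le> s" by (rule Suc.IH) (auto simp: Y_def)
  moreover have "vec_space.rank n Z \<le> 1"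
    by (rule vec_space.rank_le_1_product_entries[OF c(2), of "g s" "h s"]) (auto simp: Z_def)
  ultimately show ?case by simp
qed

lemma eig_decomp_sesq:
  assumes E: "eig_decomp n X P lam" and ab: "a < n" "b < n"
  shows "sesq n X (\<lambda>i. P $$ (i,a)) (\<lambda>i. P $$ (i,b)) = (if a = b then complex_of_real (lam a) else 0)"
proof -
  have col: "(\<Sum>l<n. X $$ (i,l) * P $$ (l,b)) = lam b * P $$ (i,b)" if i: "i < n" for i
  proof -
    have "(\<Sum>l<n. X $$ (i,l) * P $$ (l,b)) =
        (\<Sum>l<n. \<Sum>c<n. lam c * P $$ (i,c) * (cnj (P $$ (l,c)) * P $$ (l,b)))"
      using i eig_decompD(5)[OF E] by (intro sum.cong refl) (simp add: sum_distrib_left mult_ac)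
    also have "\<dots> = (\<Sum>c<n. lam c * P $$ (i,c) * (\<Sum>l<n. cnj (P $$ (l,c)) * P $$ (l,b)))"
      by (subst sum.swap) (simp add: sum_distrib_left)
    also have "\<dots> = (\<Sum>c<n. if c = b then lam c * P $$ (i,c) else 0)"
      using eig_decompD(3)[OF E] ab by (intro sum.cong) auto
    finally show ?thesis using ab by simp
  qed
  have "sesq n X (\<lambda>i. P $$ (i,a)) (\<lambda>i. P $$ (i,b)) =
      cinner n (\<lambda>i. P $$ (i,a)) (\<lambda>i. lam b * P $$ (i,b))"
    unfolding sesq_eq_cinner cinner_def by (intro sum.cong refl) (simp add: col)
  also have "\<dots> = lam b * (\<Sum>i<n. cnj (P $$ (i,a)) * P $$ (i,b))"
    unfolding cinner_scale_right by (simp add: cinner_def)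
  finally show ?thesis using eig_decompD(3)[OF E ab] by simp
qed

text \<open>Monotonicity makes the indices of positive eigenvalues an initial segment
  \<open>{..<s}\<close>. The spectral sum has \<open>s\<close> nonzero dyads, hence rank at most
  \<open>s\<close>; the diagonal minor of the first \<open>s\<close> eigenvectors is a product of
  positive numbers, hence rank at least \<open>s\<close>. So splitting the columns of
  \<open>P\<close> at the rank separates the positive eigenvalues from the zero ones.\<close>

lemma psd_eigenvalues_rank:
  assumes E: "eig_decomp n X P lam" and psd: "psd X"
  shows "vec_space.rank n X \<le> n" "\<And>a. a < vec_space.rank n X \<Longrightarrow> 0 < lam a"
    "\<And>a. vec_space.rank n X \<le> a \<Longrightarrow> a < n \<Longrightarrow> lam a = 0"
proof -
  note X = eig_decompD(2)[OF E]
  define s where "s = card {a. a < n \<and> 0 < lam a}"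
  have nonneg: "0 \<le> lam a" if "a < n" for a
    using psd_sesq_nonneg[OF X psd, of "\<lambda>i. P $$ (i,a)"] eig_decomp_sesq[OF E that that] by simp
  have down: "b \<in> {a. a < n \<and> 0 < lam a}" if "a \<in> {a. a < n \<and> 0 < lam a}" "b \<le> a" for a b
    using that eig_decompD(6)[OF E, of b a] by auto
  have S: "{a. a < n \<and> 0 < lam a} = {..<s}"
  proof -
    obtain t where "{a. a < n \<and> 0 < lam a} = {..<t}"
    proof -
      let ?S = "{a. a < n \<and> 0 < lam a}"
      define t where "t = (LEAST t. t \<notin> ?S)"
      have "n \<notin> ?S" by simp
      then have t: "t \<notin> ?S" unfolding t_def by (rule LeastI)
      have "a \<in> ?S" if "a < t" for a using not_less_Least[of a "\<lambda>t. t \<notin> ?S"] that by (auto simp: t_def)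
      moreover have "a < t" if "a \<in> ?S" for a using t down[OF that, of t] by (meson not_le)
      ultimately have "?S = {..<t}" by blast
      then show thesis by (rule that)
    qed
    then show ?thesis by (simp add: s_def)
  qed
  have sn: "s \<le> n" using card_mono[of "{..<n}" "{a. a < n \<and> 0 < lam a}"] by (auto simp: s_def)
  have zero: "lam a = 0" if "s \<le> a" "a < n" for a
    using that nonneg[of a] S by (metis (mono_tags, lifting) less_eq_real_def lessThan_iff mem_Collect_eq not_le)
  have "vec_space.rank n X \<le> s"
  proof (rule rank_sum_rank1_le[OF X])
    fix i l assume il: "i < n" "l < n"
    have "X $$ (i,l) = (\<Sum>a<n. complex_of_real (lam a) * (P $$ (i,a) * cnj (P $$ (l,a))))"
      using eig_decompD(5)[OF E il] .
    also have "\<dots> = (\<Sum>a<s. complex_of_real (lam a) * (P $$ (i,a) * cnj (P $$ (l,a))))"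
      using sn zero by (intro sum.mono_neutral_right) auto
    finally show "X $$ (i,l) = (\<Sum>a<s. (\<lambda>a i. lam a * P $$ (i,a)) a i * (\<lambda>a l. cnj (P $$ (l,a))) a l)"
      by (simp add: mult_ac)
  qed
  moreover have "s \<le> vec_space.rank n X"
  proof (rule ccontr)
    assume "\<not> s \<le> vec_space.rank n X"
    then have "det (mat s s (\<lambda>(a,b). sesq n X (\<lambda>i. P $$ (i,a)) (\<lambda>i. P $$ (i,b)))) = 0"
      by (intro sesq_minor_zero[OF X]) auto
    moreover have "mat s s (\<lambda>(a,b). sesq n X (\<lambda>i. P $$ (i,a)) (\<lambda>i. P $$ (i,b)))
        = mat s s (\<lambda>(a,b). if a = b then complex_of_real (lam a) else 0)"
      using sn by (intro cong_mat) (auto simp: eig_decomp_sesq[OF E])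
    moreover have "det (mat s s (\<lambda>(a,b). if a = b then complex_of_real (lam a) else 0)) =
        prod_list (diag_mat (mat s s (\<lambda>(a,b). if a = b then complex_of_real (lam a) else 0)))"
      by (rule det_lower_triangular[of s]) auto
    moreover have "prod_list (diag_mat (mat s s (\<lambda>(a,b). if a = b then complex_of_real (lam a) else 0))) \<noteq> 0"
    proof -
      have "\<forall>a<s. lam a \<noteq> 0" using S by (metis (mono_tags, lifting) lessThan_iff less_irrefl mem_Collect_eq)
      then show ?thesis unfolding prod_list_zero_iff diag_mat_def by auto
    qed
    ultimately show False by simp
  qed
  ultimately have rs: "vec_space.rank n X = s" by simp
  show "vec_space.rank n X \<le> n" using rs sn by simp
  show "0 < lam a" if "a < vec_space.rank n X" for a using that S rs by auto
  show "lam a = 0" if "vec_space.rank n X \<le> a" "a < n" for a using that zero rs by auto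
qed

section \<open>Rank constancy and Lagrange multipliers\<close>

text \<open>By the Leibniz expansion the determinant is a polynomial in the entries.\<close>

lemma tendsto_det:
  fixes f :: "'b \<Rightarrow> nat \<times> nat \<Rightarrow> complex"
  assumes "\<And>x y. x < k \<Longrightarrow> y < k \<Longrightarrow> ((\<lambda>j. f j (x,y)) \<longlongrightarrow> g (x,y)) F"
  shows "((\<lambda>j. det (mat k k (f j))) \<longlongrightarrow> det (mat k k g)) F"
proof -
  have lim: "((\<lambda>j. f j (i, q i)) \<longlongrightarrow> g (i, q i)) F" if "q permutes {0..<k}" "i \<in> {0..<k}" for q i
    using permutes_in_image[OF that(1), of i] that(2) by (intro assms) auto
  have expand: "det (mat k k h) = (\<Sum>q | q permutes {0..<k}. signof q * (\<Prod>i = 0..<k. h (i, q i)))"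
    for h :: "nat \<times> nat \<Rightarrow> complex"
    unfolding det_def'[OF mat_carrier]
  proof (intro sum.cong refl arg_cong2[of _ _ _ _ "(*)"] prod.cong)
    fix q i assume "q \<in> {q. q permutes {0..<k}}" "i \<in> {0..<k}"
    then show "mat k k h $$ (i, q i) = h (i, q i)"
      using permutes_in_image[of q "{0..<k}" i] by auto
  qed
  show ?thesis
    unfolding expand using lim by (intro tendsto_sum tendsto_mult tendsto_const tendsto_prod) auto
qed

text \<open>Every minor of order \<open>r + 1\<close> of a rank-\<open>r\<close> matrix vanishes. Divide the last row of the
  minor spanned by the first \<open>r\<close> eigenvectors and one null vector by \<open>\<rho>\<close>: in the limit it becomes
  lower triangular, with the positive eigenvalues and the compressed entry of the limit
  direction on the diagonal.\<close>

lemma rank_constant_direction_compression_zero: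
  fixes D :: "nat \<Rightarrow> complex mat"
  assumes E: "eig_decomp n X P lam" and psd: "psd X"
    and Xj: "\<And>j. Xj j \<in> carrier_mat n n" and rk: "\<And>j. vec_space.rank n (Xj j) = vec_space.rank n X"
    and exp: "\<And>j i l. i < n \<Longrightarrow> l < n \<Longrightarrow> Xj j $$ (i,l) = X $$ (i,l) + complex_of_real (\<rho> j) * D j $$ (i,l)"
    and \<rho>: "\<And>j. \<rho> j > 0" "\<rho> \<longlonglongrightarrow> 0"
    and D: "\<And>i l. i < n \<Longrightarrow> l < n \<Longrightarrow> (\<lambda>j. D j $$ (i,l)) \<longlonglongrightarrow> D' $$ (i,l)"
    and a: "vec_space.rank n X \<le> a" "a < n" and b: "vec_space.rank n X \<le> b" "b < n"
  shows "sesq n D' (\<lambda>i. P $$ (i,a)) (\<lambda>i. P $$ (i,b)) = 0"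
proof -
  define r where "r = vec_space.rank n X"
  note ev = psd_eigenvalues_rank[OF E psd, folded r_def]
  have ra: "r \<le> a" "r \<le> b" using a b by (auto simp: r_def)
  \<comment> \<open>Index \<open>r\<close> stands for the bordering null vector: \<open>a\<close>
    for the last row, \<open>b\<close> for the last column. Allowing them to differ gives the
    off-diagonal entries of the compression as well.\<close>
  define u where "u = (\<lambda>x i. P $$ (i, if x < r then x else a))"
  define v where "v = (\<lambda>y i. P $$ (i, if y < r then y else b))"
  \<comment> \<open>Only the last row is divided by \<rho>. The form of \<open>X\<close> vanishes
    there, so exactly the form of \<open>D j\<close> is left.\<close>
  define s where "s = (\<lambda>j x. complex_of_real (if x < r then 1 else 1 / \<rho> j))"
  define g where "g = (\<lambda>(x,y). if x < r then (if x = y then complex_of_real (lam x) else 0) else sesq n D' (u x) (v y))"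
  have split: "sesq n (Xj j) p q = sesq n X p q + \<rho> j * sesq n (D j) p q" for j p q
  proof -
    have "sesq n (Xj j) p q = (\<Sum>i<n. \<Sum>l<n. cnj (p i) * X $$ (i,l) * q l + \<rho> j * (cnj (p i) * D j $$ (i,l) * q l))"
      unfolding sesq_def by (intro sum.cong refl) (simp add: exp algebra_simps)
    then show ?thesis by (simp add: sesq_def sum.distrib sum_distrib_left)
  qed
  have Xuv: "sesq n X (u x) (v y) = (if x < r \<and> x = y then complex_of_real (lam x) else 0)" for x y
    unfolding u_def v_def
    using ra a(2) b(2) ev(1) by (subst eig_decomp_sesq[OF E]) (auto simp: ev(3) not_less)
  have Dlim: "(\<lambda>j. sesq n (D j) p q) \<longlonglongrightarrow> sesq n D' p q" for p q
    using D by (intro tendsto_sesq) auto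
  have "(\<lambda>j. det (mat (Suc r) (Suc r) (\<lambda>(x,y). sesq n (Xj j) (\<lambda>i. s j x * u x i) (v y))))
      \<longlonglongrightarrow> det (mat (Suc r) (Suc r) g)"
  proof (rule tendsto_det)
    fix x y assume "x < Suc r" "y < Suc r"
    have eq: "sesq n (Xj j) (\<lambda>i. s j x * u x i) (v y) =
        s j x * sesq n X (u x) (v y) + s j x * \<rho> j * sesq n (D j) (u x) (v y)" for j
      by (simp only: sesq_scale_left split) (simp add: s_def algebra_simps)
    have "(\<lambda>j. s j x * sesq n X (u x) (v y) + s j x * \<rho> j * sesq n (D j) (u x) (v y)) \<longlonglongrightarrow> g (x, y)"
    proof (cases "x < r")
      case True
      have "(\<lambda>j. sesq n X (u x) (v y) + complex_of_real (\<rho> j) * sesq n (D j) (u x) (v y))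
          \<longlonglongrightarrow> sesq n X (u x) (v y) + complex_of_real 0 * sesq n D' (u x) (v y)"
        by (intro tendsto_add tendsto_const tendsto_mult tendsto_of_real \<rho> Dlim)
      moreover have "s j x = 1" for j using True by (simp add: s_def)
      ultimately show ?thesis using True by (simp add: g_def Xuv)
    next
      case False
      have "s j x * complex_of_real (\<rho> j) = 1" for j
        using False \<rho>(1)[of j] by (simp add: s_def flip: of_real_mult)
      then show ?thesis using False Dlim by (simp add: g_def Xuv)
    qed
    then show "(\<lambda>j. case (x, y) of (x, y) \<Rightarrow> sesq n (Xj j) (\<lambda>i. s j x * u x i) (v y)) \<longlonglongrightarrow> g (x, y)"
      by (simp only: split_conv eq)
  qed
  moreover have "det (mat (Suc r) (Suc r) (\<lambda>(x,y). sesq n (Xj j) (\<lambda>i. s j x * u x i) (v y))) = 0" for j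
    by (rule sesq_minor_zero[OF Xj]) (simp add: rk r_def)
  ultimately have "det (mat (Suc r) (Suc r) g) = 0" by (simp add: LIMSEQ_const_iff)
  moreover have "det (mat (Suc r) (Suc r) g) = prod_list (diag_mat (mat (Suc r) (Suc r) g))"
    by (rule det_lower_triangular[of "Suc r"]) (auto simp: g_def)
  ultimately have "0 \<in> set (diag_mat (mat (Suc r) (Suc r) g))"
    by (metis prod_list_zero_iff)
  then obtain x where x: "x < Suc r" "g (x,x) = 0"
    by (auto simp: diag_mat_def simp del: upt_Suc)
  then have "\<not> x < r" using ev(2)[of x] by (auto simp: g_def)
  then show ?thesis using x by (simp add: g_def u_def v_def)
qed

text \<open>Lagrange multipliers for affine equality constraints on an abstract convex set. The elements
  of \<open>K\<close> only need to admit convex combinations as seen by \<open>\<phi>\<close> and the constraint functions.\<close>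

lemma lagrange_multiplier_single:
  fixes \<phi> g :: "'a \<Rightarrow> real"
  assumes mix: "\<And>x y t. x \<in> K \<Longrightarrow> y \<in> K \<Longrightarrow> 0 \<le> t \<Longrightarrow> t \<le> 1 \<Longrightarrow>
      \<exists>z\<in>K. g z = (1 - t) * g x + t * g y \<and> \<phi> z = (1 - t) * \<phi> x + t * \<phi> y"
    and opt: "\<And>z. z \<in> K \<Longrightarrow> g z = 0 \<Longrightarrow> 0 \<le> \<phi> z"
    and x: "x \<in> K" "g x > 0" and y: "y \<in> K" "g y < 0"
  shows "\<exists>\<eta>. \<forall>z\<in>K. 0 \<le> \<phi> z + \<eta> * g z"
proof -
  \<comment> \<open>The weight \<open>t\<close> places the mixture of \<open>p\<close> and
    \<open>q\<close> on the hyperplane \<open>g = 0\<close>, where optimality applies; clearing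
    denominators gives the comparison of slopes.\<close>
  have key: "- \<phi> p / g p \<le> \<phi> q / (- g q)"
    if pq: "p \<in> K" "g p > 0" "q \<in> K" "g q < 0" for p q
  proof -
    define t where "t = g p / (g p - g q)"
    have t: "0 \<le> t" "t \<le> 1" "1 - t = - g q / (g p - g q)" using that by (auto simp: t_def field_simps)
    obtain z where z: "z \<in> K" "g z = (1 - t) * g p + t * g q" "\<phi> z = (1 - t) * \<phi> p + t * \<phi> q"
      using mix[OF pq(1,3) t(1,2)] by blast
    have "g z = 0" unfolding z(2) t(3) using that by (simp add: t_def field_simps)
    then have "0 \<le> (1 - t) * \<phi> p + t * \<phi> q" using opt z by metis
    also have "\<dots> = (- g q * \<phi> p + g p * \<phi> q) / (g p - g q)"
      unfolding t(3) by (simp add: t_def add_divide_distrib diff_divide_distrib)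
    finally have "0 \<le> - g q * \<phi> p + g p * \<phi> q"
      using that by (simp add: zero_le_divide_iff)
    then show ?thesis using that by (simp add: field_simps)
  qed
  \<comment> \<open>Every number between the slopes from the two sides is a multiplier. The points
    \<open>x\<close> and \<open>y\<close> make both sides nonempty, so the supremum is
    finite.\<close>
  define A where "A = (\<lambda>p. - \<phi> p / g p) ` {p \<in> K. g p > 0}"
  define \<eta> where "\<eta> = Sup A"
  have bdd: "bdd_above A" 
    unfolding A_def by (rule bdd_aboveI[of _ "\<phi> y / (- g y)"]) (use key[OF _ _ y] in blast)
  have lower: "- \<phi> p / g p \<le> \<eta>" if "p \<in> K" "g p > 0" for p
    unfolding \<eta>_def using that bdd by (intro cSup_upper) (auto simp: A_def)
  have upper: "\<eta> \<le> \<phi> q / (- g q)" if "q \<in> K" "g q < 0" for q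
    unfolding \<eta>_def using that x key by (intro cSup_least) (auto simp: A_def)
  have "0 \<le> \<phi> z + \<eta> * g z" if z: "z \<in> K" for z
  proof (cases "g z" "0::real" rule: linorder_cases)
    case less
    from upper[OF z less] less show ?thesis by (simp add: field_simps)
  next
    case equal
    then show ?thesis using opt z by simp
  next
    case greater
    from lower[OF z greater] greater show ?thesis by (simp add: field_simps)
  qed
  then show ?thesis by blast
qed

text \<open>Constraints are absorbed into the functional one at a time. When \<open>k\<close> is
  treated, the multipliers for \<open>B\<close> are fixed and the remaining constraints still hold
  exactly, on the set \<open>K'\<close>. This is why the Slater points must violate \<open>k\<close>
  with either sign while satisfying all the others.\<close>

lemma lagrange_multipliers:
  fixes \<phi> :: "'a \<Rightarrow> real" and g :: "'k \<Rightarrow> 'a \<Rightarrow> real"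
  assumes "finite A"
    and mix: "\<And>x y t. x \<in> K \<Longrightarrow> y \<in> K \<Longrightarrow> 0 \<le> t \<Longrightarrow> t \<le> 1 \<Longrightarrow>
      \<exists>z\<in>K. (\<forall>k\<in>A. g k z = (1 - t) * g k x + t * g k y) \<and> \<phi> z = (1 - t) * \<phi> x + t * \<phi> y"
    and opt: "\<And>z. z \<in> K \<Longrightarrow> (\<forall>k\<in>A. g k z = 0) \<Longrightarrow> 0 \<le> \<phi> z"
    and slater: "\<And>k. k \<in> A \<Longrightarrow> \<exists>x\<in>K. g k x > 0 \<and> (\<forall>l\<in>A - {k}. g l x = 0)"
      "\<And>k. k \<in> A \<Longrightarrow> \<exists>x\<in>K. g k x < 0 \<and> (\<forall>l\<in>A - {k}. g l x = 0)"
  shows "\<exists>\<eta>. \<forall>z\<in>K. 0 \<le> \<phi> z + (\<Sum>k\<in>A. \<eta> k * g k z)"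
proof -
  have "\<exists>\<eta>. \<forall>z\<in>K. (\<forall>k\<in>A - B. g k z = 0) \<longrightarrow> 0 \<le> \<phi> z + (\<Sum>k\<in>B. \<eta> k * g k z)"
    if "finite B" "B \<subseteq> A" for B
    using that
  proof (induction B rule: finite_induct)
    case empty
    then show ?case using opt by auto
  next
    case (insert k B)
    then obtain \<eta> where \<eta>: "\<forall>z\<in>K. (\<forall>l\<in>A - B. g l z = 0) \<longrightarrow> 0 \<le> \<phi> z + (\<Sum>l\<in>B. \<eta> l * g l z)" by auto
    define K' where "K' = {z\<in>K. \<forall>l\<in>A - insert k B. g l z = 0}"
    define \<psi> where "\<psi> = (\<lambda>z. \<phi> z + (\<Sum>l\<in>B. \<eta> l * g l z))"
    have kA: "k \<in> A" and BA: "B \<subseteq> A" using insert.prems by auto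
    obtain x where x: "x \<in> K" "g k x > 0" "\<forall>l\<in>A - {k}. g l x = 0" using slater(1)[OF kA] by blast
    obtain y where y: "y \<in> K" "g k y < 0" "\<forall>l\<in>A - {k}. g l y = 0" using slater(2)[OF kA] by blast
    have "\<exists>e. \<forall>z\<in>K'. 0 \<le> \<psi> z + e * g k z"
    proof (rule lagrange_multiplier_single[of K' "g k" \<psi> x y])
      fix p q and t :: real assume pq: "p \<in> K'" "q \<in> K'" and t: "0 \<le> t" "t \<le> 1"
      then obtain z where z: "z \<in> K" "\<forall>k\<in>A. g k z = (1 - t) * g k p + t * g k q"
        "\<phi> z = (1 - t) * \<phi> p + t * \<phi> q"
        using mix[of p q t] by (auto simp: K'_def)
      have "(\<Sum>l\<in>B. \<eta> l * g l z) = (\<Sum>l\<in>B. (1 - t) * (\<eta> l * g l p) + t * (\<eta> l * g l q))"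
      proof (intro sum.cong refl)
        fix l assume "l \<in> B"
        then have gl: "g l z = (1 - t) * g l p + t * g l q" using z(2) BA by blast
        show "\<eta> l * g l z = (1 - t) * (\<eta> l * g l p) + t * (\<eta> l * g l q)"
          unfolding gl by (simp add: algebra_simps)
      qed
      also have "\<dots> = (1 - t) * (\<Sum>l\<in>B. \<eta> l * g l p) + t * (\<Sum>l\<in>B. \<eta> l * g l q)"
        by (simp add: sum.distrib sum_distrib_left)
      finally have "\<psi> z = (1 - t) * \<psi> p + t * \<psi> q" by (simp add: \<psi>_def z(3) algebra_simps)
      moreover have "z \<in> K'" using z pq by (auto simp: K'_def)
      ultimately show "\<exists>z\<in>K'. g k z = (1 - t) * g k p + t * g k q \<and> \<psi> z = (1 - t) * \<psi> p + t * \<psi> q"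
        using z kA by auto
    qed (use x y \<eta> in \<open>auto simp: K'_def \<psi>_def\<close>)
    then obtain e where e: "\<forall>z\<in>K'. 0 \<le> \<psi> z + e * g k z" by blast
    have "(\<Sum>l\<in>insert k B. (\<eta>(k := e)) l * g l z) = e * g k z + (\<Sum>l\<in>B. \<eta> l * g l z)" for z
    proof -
      have "(\<Sum>l\<in>B. (\<eta>(k := e)) l * g l z) = (\<Sum>l\<in>B. \<eta> l * g l z)"
        using insert.hyps by (intro sum.cong) auto
      then show ?thesis using insert.hyps by simp
    qed
    then have "\<forall>z\<in>K. (\<forall>l\<in>A - insert k B. g l z = 0) \<longrightarrow>
        0 \<le> \<phi> z + (\<Sum>l\<in>insert k B. (\<eta>(k := e)) l * g l z)"
      using e by (simp add: K'_def \<psi>_def algebra_simps)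
    then show ?case by blast
  qed
  from this[OF \<open>finite A\<close> order_refl] show ?thesis by simp
qed

section \<open>Duality in coordinates\<close>

lemma inner_S_commute:
  assumes "X \<in> carrier_mat n n" "Y \<in> carrier_mat n n"
  shows "inner_S X Y = inner_S Y X"
  unfolding inner_S_eq[OF assms] inner_S_eq[OF assms(2,1)] by (intro sum.cong refl) (simp add: mult.commute)

lemma inner_S_sum_right:
  assumes "A \<in> carrier_mat n n" "X \<in> carrier_mat n n" "\<And>k. k \<in> K \<Longrightarrow> Y k \<in> carrier_mat n n"
    and "\<And>i l. i < n \<Longrightarrow> l < n \<Longrightarrow> X $$ (i,l) = (\<Sum>k\<in>K. complex_of_real (c k) * Y k $$ (i,l))"
  shows "inner_S A X = (\<Sum>k\<in>K. c k * inner_S A (Y k))"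
proof -
  have "inner_S A X = (\<Sum>i<n. \<Sum>l<n. \<Sum>k\<in>K. c k * Re (cnj (A $$ (i,l)) * Y k $$ (i,l)))"
    unfolding inner_S_eq[OF assms(1,2)]
    by (intro sum.cong refl) (simp add: assms(4) sum_distrib_left Re_sum sum.distrib algebra_simps)
  also have "\<dots> = (\<Sum>k\<in>K. \<Sum>i<n. \<Sum>l<n. c k * Re (cnj (A $$ (i,l)) * Y k $$ (i,l)))"
    by (subst sum.swap[of _ "{..<n}" K for K], subst sum.swap) (intro sum.cong refl sum.swap)
  also have "\<dots> = (\<Sum>k\<in>K. c k * inner_S A (Y k))"
    by (intro sum.cong refl) (simp only: inner_S_eq[OF assms(1) assms(3)] sum_distrib_left)
  finally show ?thesis .
qed

abbreviation rcomb :: "real \<Rightarrow> complex mat \<Rightarrow> real \<Rightarrow> complex mat \<Rightarrow> complex mat" where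
  "rcomb a X b Y \<equiv> complex_of_real a \<cdot>\<^sub>m X + complex_of_real b \<cdot>\<^sub>m Y"

lemma inner_S_rcomb:
  assumes "A \<in> carrier_mat n n" "X \<in> carrier_mat n n" "Y \<in> carrier_mat n n"
  shows "inner_S A (rcomb a X b Y) = a * inner_S A X + b * inner_S A Y"
proof -
  have "inner_S A (rcomb a X b Y) =
      (\<Sum>k\<in>{True, False}. (if k then a else b) * inner_S A (if k then X else Y))"
    using assms by (intro inner_S_sum_right[of _ n]) auto
  then show ?thesis by simp
qed

lemma Sn_rcomb:
  assumes "X \<in> Sn rc n" "Y \<in> Sn rc n"
  shows "rcomb a X b Y \<in> Sn rc n"
  using SnD[OF assms(1)] SnD[OF assms(2)] unfolding Sn_iff by auto

lemma psd_rcomb: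
  assumes "X \<in> Sn rc n" "Y \<in> Sn rc n" "psd X" "psd Y" "0 \<le> a" "0 \<le> b"
  shows "psd (rcomb a X b Y)"
proof (rule psdI_sesq[OF Sn_rcomb[OF assms(1,2)]])
  fix u
  show "0 \<le> Re (sesq n (rcomb a X b Y) u u)"
    unfolding sesq_smult_add[OF SnD(1)[OF assms(1)] SnD(1)[OF assms(2)]]
    using psd_sesq_nonneg[OF SnD(1)[OF assms(1)] assms(3), of u] assms(5,6)
      psd_sesq_nonneg[OF SnD(1)[OF assms(2)] assms(4), of u] by simp
qed

text \<open>Positive definite matrices are interior to the cone, by compactness of the unit sphere.
  Otherwise there are unit vectors with negative values for perturbations \<open>t\<close> tending
  to 0, and a limit vector has a nonpositive value under \<open>X\<close>.\<close>

lemma pd_perturbation_psd: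
  assumes X: "X \<in> Sn rc n" and pd: "pd X" and T: "T \<in> Sn rc n"
  shows "\<exists>e>0. \<forall>t. \<bar>t\<bar> \<le> e \<longrightarrow> psd (rcomb 1 X t T)"
proof (rule ccontr)
  note Xc = SnD(1)[OF X] and Tc = SnD(1)[OF T]
  assume *: "\<not> ?thesis"
  have "\<exists>t v. \<bar>t\<bar> \<le> 1 / real (Suc j) \<and> cinner n v v = 1 \<and> Re (sesq n X v v) + t * Re (sesq n T v v) < 0"
    for j
  proof -
    obtain t where t: "\<bar>t\<bar> \<le> 1 / real (Suc j)" "\<not> psd (rcomb 1 X t T)"
      using * by (metis of_nat_0_less_iff zero_less_Suc zero_less_divide_1_iff)
    then obtain u where "Re (sesq n (rcomb 1 X t T) u u) < 0"
      using psdI_sesq[OF Sn_rcomb[OF X T]] not_less by metis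
    then have u: "Re (sesq n X u u) + t * Re (sesq n T u u) < 0"
      unfolding sesq_smult_add[OF Xc Tc] by simp
    have "cinner n u u \<noteq> 0"
    proof
      assume "cinner n u u = 0"
      then have "sesq n X u u = 0" "sesq n T u u = 0" by (simp_all add: cinner_self_eq_0_iff sesq_def)
      then show False using u by simp
    qed
    then obtain s where s: "s > 0" "cinner n (\<lambda>i. complex_of_real s * u i) (\<lambda>i. complex_of_real s * u i) = 1"
      using unit_rescaling_exists by blast
    have "Re (sesq n Y (\<lambda>i. complex_of_real s * u i) (\<lambda>i. complex_of_real s * u i)) = s\<^sup>2 * Re (sesq n Y u u)"
      for Y unfolding sesq_scale_left sesq_scale_right by (simp add: power2_eq_square)
    moreover have "s\<^sup>2 * Re (sesq n X u u) + t * (s\<^sup>2 * Re (sesq n T u u)) < 0"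
      using mult_pos_neg[OF _ u, of "s\<^sup>2"] s(1) by (simp add: algebra_simps)
    ultimately show ?thesis using t(1) s(2) by (metis (no_types, lifting))
  qed
  then obtain t v where tv: "\<And>j. \<bar>t j\<bar> \<le> 1 / real (Suc j)" "\<And>j. cinner n (v j) (v j) = 1"
    "\<And>j. Re (sesq n X (v j) (v j)) + t j * Re (sesq n T (v j) (v j)) < 0" by metis
  obtain \<sigma> l where \<sigma>: "strict_mono (\<sigma> :: nat \<Rightarrow> nat)" and l: "\<forall>i<n. (\<lambda>j. v (\<sigma> j) i) \<longlonglongrightarrow> l i"
    and l1: "cinner n l l = 1"
    using unit_sequence_convergent_subseq[of n v] tv(2) by auto
  have "(\<lambda>j. 1 / real (Suc j)) \<longlonglongrightarrow> 0"
    using LIMSEQ_inverse_real_of_nat by (simp add: inverse_eq_divide)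
  then have "t \<longlonglongrightarrow> 0"
    using tv(1) by (intro Lim_null_comparison[of t "\<lambda>j. 1 / real (Suc j)"]) auto
  from LIMSEQ_subseq_LIMSEQ[OF this \<sigma>] have t0: "(\<lambda>j. t (\<sigma> j)) \<longlonglongrightarrow> 0" by (simp add: o_def)
  have lim: "(\<lambda>j. sesq n Y (v (\<sigma> j)) (v (\<sigma> j))) \<longlonglongrightarrow> sesq n Y l l" for Y
    using l by (intro tendsto_sesq) auto
  have "(\<lambda>j. Re (sesq n X (v (\<sigma> j)) (v (\<sigma> j))) + t (\<sigma> j) * Re (sesq n T (v (\<sigma> j)) (v (\<sigma> j))))
      \<longlonglongrightarrow> Re (sesq n X l l) + 0 * Re (sesq n T l l)"
    by (intro tendsto_intros lim t0)
  then have "Re (sesq n X l l) + 0 * Re (sesq n T l l) \<le> 0"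
    by (rule LIMSEQ_le_const2) (use tv(3) less_imp_le in blast)
  moreover obtain i where "i < n" "l i \<noteq> 0"
    using l1 cinner_self_eq_0_iff[of n l] by auto
  ultimately show False using pd_sesq_pos[OF Xc pd] by fastforce
qed

text \<open>Self-duality of the cone. In the Hermitian case the test matrix is the dyad of
  \<open>u\<close>. In the real case that dyad may fail to be real, so it is averaged with its
  conjugate; a real \<open>S\<close> has the same pairing with both.\<close>

lemma dual_cone_psd:
  assumes S: "S \<in> Sn rc n" and dual: "\<And>W. W \<in> Sn rc n \<Longrightarrow> psd W \<Longrightarrow> 0 \<le> inner_S S W"
  shows "0 \<le> Re (sesq n S u u)"
proof -
  define w where "w = (\<lambda>i. if rc then cnj (u i) else u i)"
  define W where "W = mat n n (\<lambda>(i,l). (u i * cnj (u l) + w i * cnj (w l)) / 2)"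
  have W: "W \<in> Sn rc n" by (auto simp: Sn_iff W_def w_def)
  have eq: "sesq n W v v = (cinner n v u * cnj (cinner n v u) + cinner n v w * cnj (cinner n v w)) / 2" for v
  proof -
    have "sesq n W v v = (\<Sum>i<n. \<Sum>l<n. ((cnj (v i) * u i) * cnj (cnj (v l) * u l) +
        (cnj (v i) * w i) * cnj (cnj (v l) * w l)) / 2)"
      unfolding sesq_def by (intro sum.cong refl) (simp add: W_def field_simps)
    also have "\<dots> = (\<Sum>i<n. \<Sum>l<n. (cnj (v i) * u i) * cnj (cnj (v l) * u l)) / 2 +
        (\<Sum>i<n. \<Sum>l<n. (cnj (v i) * w i) * cnj (cnj (v l) * w l)) / 2"
      by (simp only: add_divide_distrib sum.distrib sum_divide_distrib)
    finally show ?thesis by (simp only: cinner_def cnj_sum sum_product add_divide_distrib)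
  qed
  have re: "Re (sesq n W v v) = ((cmod (cinner n v u))\<^sup>2 + (cmod (cinner n v w))\<^sup>2) / 2" for v
    unfolding eq cmod_power2 by (simp add: power2_eq_square)
  have "psd W" by (intro psdI_sesq[OF W], unfold re) simp
  then have "0 \<le> inner_S S W" using dual[OF W] by blast
  also have "inner_S S W = Re (sesq n S u u)"
    unfolding inner_S_eq[OF SnD(1)[OF S] SnD(1)[OF W]] sesq_def Re_sum
  proof (intro sum.cong refl)
    fix i l assume "i \<in> {..<n}" "l \<in> {..<n}"
    then show "Re (cnj (S $$ (i,l)) * W $$ (i,l)) = Re (cnj (u i) * S $$ (i,l) * u l)"
      using SnD(3)[OF S, of i l] by (cases rc) (auto simp: W_def w_def algebra_simps)
  qed
  finally show ?thesis .
qed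

text \<open>Expands a pairing into eigenvalues times diagonal form values, so that a zero pairing of
  semidefinite matrices can be read off term by term.\<close>

lemma inner_S_eig_decomp:
  assumes S: "S \<in> carrier_mat n n" and E: "eig_decomp n X P lam"
  shows "inner_S S X = (\<Sum>a<n. lam a * Re (sesq n S (\<lambda>i. P $$ (i,a)) (\<lambda>i. P $$ (i,a))))"
proof -
  define Y where "Y = (\<lambda>a. mat n n (\<lambda>(i,l). P $$ (i,a) * cnj (P $$ (l,a))))"
  have Y: "Y a \<in> carrier_mat n n" for a by (simp add: Y_def)
  have "inner_S S X = (\<Sum>a<n. lam a * inner_S S (Y a))"
    using eig_decompD(5)[OF E] by (intro inner_S_sum_right[OF S eig_decompD(2)[OF E] Y]) (simp add: Y_def)
  moreover have "inner_S S (Y a) = Re (sesq n S (\<lambda>i. P $$ (i,a)) (\<lambda>i. P $$ (i,a)))" for a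
    unfolding inner_S_eq[OF S Y] sesq_def Re_sum
    by (intro sum.cong refl) (simp add: Y_def algebra_simps)
  ultimately show ?thesis by simp
qed

text \<open>Conjugating \<open>S\<close> into the basis of columns of \<open>P\<close> and back:
  since \<open>P\<close> times its adjoint is the identity, the vectors \<open>e i\<close> below are
  the standard basis vectors.\<close>

lemma unitary_expansion:
  assumes E: "eig_decomp n X P lam" and "i < n" "l < n"
  shows "S $$ (i,l) = (\<Sum>a<n. \<Sum>b<n. P $$ (i,a) * sesq n S (\<lambda>i. P $$ (i,a)) (\<lambda>i. P $$ (i,b)) * cnj (P $$ (l,b)))"
proof -
  define e where "e = (\<lambda>i j. \<Sum>a<n. cnj (P $$ (i,a)) * P $$ (j,a))"
  have e: "e i j = (if i = j then 1 else 0)" if "i < n" "j < n" for i j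
    using eig_decompD(4)[OF E that(2,1)] by (simp add: e_def mult.commute)
  have "sesq n S (e i) (e l) = (\<Sum>i'<n. \<Sum>l'<n. (if i' = i then if l' = l then S $$ (i,l) else 0 else 0))"
    unfolding sesq_def using assms by (intro sum.cong refl) (auto simp: e)
  also have "\<dots> = (\<Sum>i'<n. if i' = i then \<Sum>l'<n. (if l' = l then S $$ (i,l) else 0) else 0)"
    by (intro sum.cong refl) auto
  also have "\<dots> = S $$ (i,l)" using assms by simp
  finally have "S $$ (i,l) = sesq n S (e i) (e l)" by simp
  also have "\<dots> = (\<Sum>a<n. P $$ (i,a) * (\<Sum>b<n. cnj (P $$ (l,b)) * sesq n S (\<lambda>i. P $$ (i,a)) (\<lambda>i. P $$ (i,b))))"
    unfolding e_def sesq_sum_left sesq_sum_right complex_cnj_cnj ..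
  also have "\<dots> = (\<Sum>a<n. \<Sum>b<n. P $$ (i,a) * sesq n S (\<lambda>i. P $$ (i,a)) (\<lambda>i. P $$ (i,b)) * cnj (P $$ (l,b)))"
    by (simp add: sum_distrib_left mult_ac)
  finally show ?thesis .
qed

section \<open>Coordinates in an orthonormal basis and semidefinite duality\<close>

locale Sn_basis =
  fixes rc :: bool and n d :: nat and \<Theta> :: "nat \<Rightarrow> complex mat"
  assumes basis_in: "\<And>k. k < d \<Longrightarrow> \<Theta> k \<in> Sn rc n"
    and basis_orth: "\<And>j k. j < d \<Longrightarrow> k < d \<Longrightarrow> inner_S (\<Theta> j) (\<Theta> k) = (if j = k then 1 else 0)"
    and basis_span: "\<And>X. X \<in> Sn rc n \<Longrightarrow> \<exists>c. X = lin_comb n \<Theta> c {..<d}"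
begin

lemma basis_carrier: "k < d \<Longrightarrow> \<Theta> k \<in> carrier_mat n n"
  using SnD(1)[OF basis_in] .

lemma lin_comb_carrier: "lin_comb n \<Theta> c K \<in> carrier_mat n n"
  by (simp add: lin_comb_def)

lemma lin_comb_index: "i < n \<Longrightarrow> l < n \<Longrightarrow> lin_comb n \<Theta> c K $$ (i,l) = (\<Sum>k\<in>K. complex_of_real (c k) * \<Theta> k $$ (i,l))"
  by (simp add: lin_comb_def)

lemma lin_comb_Sn:
  assumes "K \<subseteq> {..<d}"
  shows "lin_comb n \<Theta> c K \<in> Sn rc n"
  unfolding Sn_iff
proof (intro conjI impI allI lin_comb_carrier)
  fix i j assume ij: "i < n" "j < n"
  show "lin_comb n \<Theta> c K $$ (i,j) = cnj (lin_comb n \<Theta> c K $$ (j,i))"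
    unfolding lin_comb_index[OF ij] lin_comb_index[OF ij(2,1)] cnj_sum
    using assms ij SnD(2)[OF basis_in] by (intro sum.cong refl) auto
  assume rc
  then show "Im (lin_comb n \<Theta> c K $$ (i,j)) = 0"
    unfolding lin_comb_index[OF ij] Im_sum
    using assms ij SnD(3)[OF basis_in] by (intro sum.neutral) auto
qed

lemma inner_S_lin_comb:
  assumes "A \<in> carrier_mat n n" "K \<subseteq> {..<d}"
  shows "inner_S A (lin_comb n \<Theta> c K) = (\<Sum>k\<in>K. c k * inner_S A (\<Theta> k))"
  using assms(2) basis_carrier
  by (intro inner_S_sum_right[OF assms(1) lin_comb_carrier _ lin_comb_index]) auto

lemma coordinate_lin_comb:
  assumes "k < d"
  shows "inner_S (\<Theta> k) (lin_comb n \<Theta> c {..<d}) = c k"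
proof -
  have "inner_S (\<Theta> k) (lin_comb n \<Theta> c {..<d}) = (\<Sum>j<d. if j = k then c k else 0)"
    unfolding inner_S_lin_comb[OF basis_carrier[OF assms] order_refl]
    using assms by (intro sum.cong refl) (auto simp: basis_orth)
  then show ?thesis using assms by simp
qed

lemma coordinate_expansion:
  assumes "X \<in> Sn rc n"
  shows "X = lin_comb n \<Theta> (\<lambda>k. inner_S (\<Theta> k) X) {..<d}"
proof -
  obtain c where c: "X = lin_comb n \<Theta> c {..<d}" using basis_span[OF assms] by blast
  have "lin_comb n \<Theta> (\<lambda>k. inner_S (\<Theta> k) X) {..<d} = lin_comb n \<Theta> c {..<d}"
    unfolding lin_comb_def by (intro cong_mat refl) (auto simp: c coordinate_lin_comb intro!: sum.cong)
  then show ?thesis using c by simp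
qed

text \<open>Strong duality for a linear semidefinite programme solved by \<open>Xb\<close>: \<open>S\<close> is the dual slack.\<close>

lemma dual_slack_exists:
  assumes \<alpha>: "\<alpha> \<subseteq> {..<d}" and Xb: "Xb \<in> Sn rc n" "psd Xb"
    and X0: "X0 \<in> Sn rc n" "pd X0" "\<forall>k\<in>\<alpha>. inner_S (\<Theta> k) X0 = inner_S (\<Theta> k) Xb"
    and opt: "\<And>Z. feasible rc n \<Theta> \<alpha> Xb Z \<Longrightarrow>
      0 \<le> (\<Sum>k\<in>{..<d} - \<alpha>. G k * (inner_S (\<Theta> k) Z - inner_S (\<Theta> k) Xb))"
  shows "\<exists>S\<in>Sn rc n. (\<forall>k\<in>{..<d} - \<alpha>. inner_S (\<Theta> k) S = G k) \<and>
    (\<forall>W\<in>Sn rc n. psd W \<longrightarrow> 0 \<le> inner_S S W) \<and> inner_S S Xb = 0"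
proof -
  define K where "K = {Z \<in> Sn rc n. psd Z}"
  define g where "g = (\<lambda>k Z. inner_S (\<Theta> k) Z - inner_S (\<Theta> k) Xb)"
  define \<phi> where "\<phi> = (\<lambda>Z. \<Sum>k\<in>{..<d} - \<alpha>. G k * g k Z)"
  \<comment> \<open>By orthonormality, moving the Slater point along a basis matrix changes one
    constraint only, and small moves in both directions stay in the cone.\<close>
  have slack: "\<exists>e>0. \<forall>t. \<bar>t\<bar> \<le> e \<longrightarrow> rcomb 1 X0 t (\<Theta> k) \<in> K \<and>
      (\<forall>l\<in>\<alpha>. g l (rcomb 1 X0 t (\<Theta> k)) = (if l = k then t else 0))" if k: "k \<in> \<alpha>" for k
  proof -
    have kd: "k < d" using k \<alpha> by auto
    have "g l (rcomb 1 X0 t (\<Theta> k)) = (if l = k then t else 0)" if l: "l \<in> \<alpha>" for l t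
    proof -
      have ld: "l < d" using l \<alpha> by auto
      show ?thesis
        unfolding g_def inner_S_rcomb[OF basis_carrier[OF ld] SnD(1)[OF X0(1)] basis_carrier[OF kd]]
        using X0(3) l by (simp add: basis_orth[OF ld kd])
    qed
    moreover obtain e where "e > 0" "\<And>t. \<bar>t\<bar> \<le> e \<Longrightarrow> psd (rcomb 1 X0 t (\<Theta> k))"
      using pd_perturbation_psd[OF X0(1,2) basis_in[OF kd]] by blast
    ultimately show ?thesis
      unfolding K_def using Sn_rcomb[OF X0(1) basis_in[OF kd]] by blast
  qed
  have "\<exists>\<eta>. \<forall>z\<in>K. 0 \<le> \<phi> z + (\<Sum>k\<in>\<alpha>. \<eta> k * g k z)"
  proof (rule lagrange_multipliers)
    show "finite \<alpha>" using \<alpha> finite_subset by blast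
  next
    fix x y and t :: real assume xy: "x \<in> K" "y \<in> K" and t: "0 \<le> t" "t \<le> 1"
    have z: "rcomb (1 - t) x t y \<in> K"
      unfolding K_def mem_Collect_eq
      by (intro conjI Sn_rcomb psd_rcomb) (use xy t in \<open>auto simp: K_def\<close>)
    have gz: "g k (rcomb (1 - t) x t y) = (1 - t) * g k x + t * g k y" if "k < d" for k
      using inner_S_rcomb[OF basis_carrier[OF that], of x y "1 - t" t] xy SnD(1)
      by (auto simp: K_def g_def algebra_simps)
    have "\<phi> (rcomb (1 - t) x t y) = (\<Sum>k\<in>{..<d} - \<alpha>. (1 - t) * (G k * g k x) + t * (G k * g k y))"
      unfolding \<phi>_def by (intro sum.cong refl) (subst gz, auto simp: distrib_left)
    also have "\<dots> = (1 - t) * \<phi> x + t * \<phi> y"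
      by (simp add: \<phi>_def sum.distrib sum_distrib_left)
    finally show "\<exists>z\<in>K. (\<forall>k\<in>\<alpha>. g k z = (1 - t) * g k x + t * g k y) \<and> \<phi> z = (1 - t) * \<phi> x + t * \<phi> y"
      using z gz \<alpha> by (intro bexI[OF _ z]) auto
  next
    fix z assume "z \<in> K" "\<forall>k\<in>\<alpha>. g k z = 0"
    then show "0 \<le> \<phi> z"
      using opt[of z] by (auto simp: feasible_def K_def g_def \<phi>_def)
  next
    fix k assume k: "k \<in> \<alpha>"
    from slack[OF k] obtain e where e: "e > 0" "\<forall>t. \<bar>t\<bar> \<le> e \<longrightarrow> rcomb 1 X0 t (\<Theta> k) \<in> K \<and>
      (\<forall>l\<in>\<alpha>. g l (rcomb 1 X0 t (\<Theta> k)) = (if l = k then t else 0))" by blast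
    show "\<exists>x\<in>K. g k x > 0 \<and> (\<forall>l\<in>\<alpha> - {k}. g l x = 0)"
      using e k by (intro bexI[of _ "rcomb 1 X0 e (\<Theta> k)"]) auto
    show "\<exists>x\<in>K. g k x < 0 \<and> (\<forall>l\<in>\<alpha> - {k}. g l x = 0)"
      using e(1) e(2)[rule_format, of "-e"] k by (intro bexI[of _ "rcomb 1 X0 (-e) (\<Theta> k)"]) auto
  qed
  then obtain \<eta> where \<eta>: "\<forall>z\<in>K. 0 \<le> \<phi> z + (\<Sum>k\<in>\<alpha>. \<eta> k * g k z)" by blast
  \<comment> \<open>The slack has the prescribed gradient as its \<beta>-coordinates and the
    multipliers as its \<alpha>-coordinates.\<close>
  define s where "s = (\<lambda>k. if k \<in> \<alpha> then \<eta> k else G k)"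
  define S where "S = lin_comb n \<Theta> s {..<d}"
  have S: "S \<in> Sn rc n" unfolding S_def by (rule lin_comb_Sn) simp
  have inS: "inner_S S Z = (\<Sum>k<d. s k * inner_S (\<Theta> k) Z)" if "Z \<in> Sn rc n" for Z
  proof -
    have "inner_S S Z = inner_S Z S" using that S by (intro inner_S_commute SnD(1))
    also have "\<dots> = (\<Sum>k<d. s k * inner_S Z (\<Theta> k))"
      unfolding S_def using SnD(1)[OF that] by (rule inner_S_lin_comb) simp
    also have "\<dots> = (\<Sum>k<d. s k * inner_S (\<Theta> k) Z)"
      by (intro sum.cong refl) (subst inner_S_commute[OF SnD(1)[OF that] basis_carrier], auto)
    finally show ?thesis .
  qed
  have ge: "inner_S S Xb \<le> inner_S S Z" if Z: "Z \<in> K" for Z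
  proof -
    have "inner_S S Z - inner_S S Xb = (\<Sum>k<d. s k * g k Z)"
      using Z Xb by (simp add: inS K_def g_def right_diff_distrib sum_subtractf)
    also have "\<dots> = (\<Sum>k\<in>{..<d} - \<alpha>. s k * g k Z) + (\<Sum>k\<in>\<alpha>. s k * g k Z)"
      using \<alpha> by (intro sum.subset_diff) auto
    also have "\<dots> = \<phi> Z + (\<Sum>k\<in>\<alpha>. \<eta> k * g k Z)"
      unfolding \<phi>_def by (intro arg_cong2[of _ _ _ _ "(+)"] sum.cong) (auto simp: s_def)
    finally show ?thesis using \<eta> Z by auto
  qed
  have scale: "rcomb t Xb 0 Xb \<in> K" "inner_S S (rcomb t Xb 0 Xb) = t * inner_S S Xb" if "0 \<le> t" for t
  proof -
    show "rcomb t Xb 0 Xb \<in> K"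
      unfolding K_def mem_Collect_eq using that Xb by (intro conjI Sn_rcomb psd_rcomb) auto
    show "inner_S S (rcomb t Xb 0 Xb) = t * inner_S S Xb"
      unfolding inner_S_rcomb[OF SnD(1)[OF S] SnD(1)[OF Xb(1)] SnD(1)[OF Xb(1)]] by simp
  qed
  \<comment> \<open>\<open>Xb\<close> minimises a linear functional over the whole cone; comparing
    it with 0 and with its double forces the minimum to be 0.\<close>
  have "inner_S S Xb = 0"
    using ge[OF scale(1)[of 0]] ge[OF scale(1)[of 2]] unfolding scale(2)[of 0, OF order_refl]
      scale(2)[of 2, OF zero_le_numeral] by simp
  moreover have "inner_S (\<Theta> k) S = G k" if "k \<in> {..<d} - \<alpha>" for k
    using that by (simp add: S_def coordinate_lin_comb s_def)
  moreover have "0 \<le> inner_S S W" if "W \<in> Sn rc n" "psd W" for W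
    using ge[of W] that \<open>inner_S S Xb = 0\<close> by (simp add: K_def)
  ultimately show ?thesis using S by blast
qed

text \<open>Completing the square bounds each summand below by
  \<open>\<mu> / 2 * (D k)^2 - C^2 / (2 * \<mu>)\<close>. Summing over \<open>B\<close> and using
  that the total is at most 0 yields the constant \<open>card B * C^2 / \<mu>^2\<close>. This strong
  convexity estimate is what bounds the rescaled errors.\<close>

lemma coordinates_bounded:
  fixes a c D :: "nat \<Rightarrow> real" and \<mu> C :: real
  assumes "finite B" and \<mu>: "0 < \<mu>" "\<And>k. k \<in> B \<Longrightarrow> \<mu> \<le> a k" and c: "\<And>k. k \<in> B \<Longrightarrow> \<bar>c k\<bar> \<le> C"
    and le: "(\<Sum>k\<in>B. (a k * D k + c k) * D k) \<le> 0" and k: "k \<in> B"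
  shows "\<bar>D k\<bar> \<le> sqrt (card B * C\<^sup>2 / \<mu>\<^sup>2)"
proof -
  have lower: "\<mu> / 2 * (D k)\<^sup>2 - C\<^sup>2 / (2 * \<mu>) \<le> (a k * D k + c k) * D k" if "k \<in> B" for k
  proof -
    have "0 \<le> (\<mu> * D k + c k)\<^sup>2 / (2 * \<mu>)" using \<mu>(1) by simp
    also have "\<dots> = \<mu> / 2 * (D k)\<^sup>2 + c k * D k + (c k)\<^sup>2 / (2 * \<mu>)"
      using \<mu>(1) by (simp add: power2_eq_square field_simps)
    finally have 1: "0 \<le> \<mu> / 2 * (D k)\<^sup>2 + c k * D k + (c k)\<^sup>2 / (2 * \<mu>)" .
    have "(c k)\<^sup>2 \<le> C\<^sup>2" using power_mono[OF c[OF that] abs_ge_zero, of 2] by simp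
    then have 2: "(c k)\<^sup>2 / (2 * \<mu>) \<le> C\<^sup>2 / (2 * \<mu>)" using \<mu>(1) by (simp add: divide_right_mono)
    have 3: "\<mu> * (D k)\<^sup>2 \<le> a k * (D k)\<^sup>2" using \<mu>(2)[OF that] by (intro mult_right_mono) auto
    have "(a k * D k + c k) * D k = a k * (D k)\<^sup>2 + c k * D k" by (simp add: power2_eq_square algebra_simps)
    then show ?thesis using 1 2 3 by linarith
  qed
  have "(\<Sum>k\<in>B. \<mu> / 2 * (D k)\<^sup>2 - C\<^sup>2 / (2 * \<mu>)) \<le> 0"
    by (rule order_trans[OF sum_mono[OF lower] le])
  then have "\<mu> / 2 * (\<Sum>k\<in>B. (D k)\<^sup>2) \<le> card B * (C\<^sup>2 / (2 * \<mu>))"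
    by (simp add: sum_subtractf sum_distrib_left)
  moreover have "(D k)\<^sup>2 \<le> (\<Sum>k\<in>B. (D k)\<^sup>2)"
    using assms(1) k by (intro member_le_sum) auto
  then have "\<mu> / 2 * (D k)\<^sup>2 \<le> \<mu> / 2 * (\<Sum>k\<in>B. (D k)\<^sup>2)"
    using \<mu>(1) by (intro mult_left_mono) auto
  ultimately have "\<mu> / 2 * (D k)\<^sup>2 \<le> card B * (C\<^sup>2 / (2 * \<mu>))" by linarith
  then have "(D k)\<^sup>2 \<le> card B * C\<^sup>2 / \<mu>\<^sup>2"
    using \<mu>(1) by (simp add: field_simps power2_eq_square)
  then show ?thesis by (metis real_sqrt_abs real_sqrt_le_mono)
qed

text \<open>Subsequential limit of the optimality conditions: \<open>Dh\<close> is a limit of the rescaled errors and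
  \<open>S\<close> the dual slack of the limiting linear programme.\<close>

lemma limit_optimality_uniform:
  fixes Xb :: "complex mat" and Xj :: "nat \<Rightarrow> complex mat" and \<rho> :: "nat \<Rightarrow> real" and a c :: "nat \<Rightarrow> nat \<Rightarrow> real"
  defines "D \<equiv> \<lambda>j k. (inner_S (\<Theta> k) (Xj j) - inner_S (\<Theta> k) Xb) / \<rho> j"
  assumes \<alpha>: "\<alpha> \<subseteq> {..<d}" and \<beta>: "\<beta> = {..<d} - \<alpha>" and Xb: "Xb \<in> Sn rc n" "psd Xb"
    and slater: "\<exists>X0\<in>Sn rc n. pd X0 \<and> (\<forall>k\<in>\<alpha>. inner_S (\<Theta> k) X0 = inner_S (\<Theta> k) Xb)"
    and E: "eig_decomp n Xb P lam"
    and feas: "\<And>j. feasible rc n \<Theta> \<alpha> Xb (Xj j)"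
    and rk: "\<And>j. vec_space.rank n (Xj j) = vec_space.rank n Xb"
    and \<rho>: "\<And>j. \<rho> j > 0" "\<rho> \<longlonglongrightarrow> 0"
    and a: "\<And>k. k \<in> \<beta> \<Longrightarrow> (\<lambda>j. a j k) \<longlonglongrightarrow> p k" and c: "\<And>k. k \<in> \<beta> \<Longrightarrow> (\<lambda>j. c j k) \<longlonglongrightarrow> c' k"
    and \<mu>: "0 < \<mu>" "\<And>j k. k \<in> \<beta> \<Longrightarrow> \<mu> \<le> a j k"
    and vi: "\<And>j Z. feasible rc n \<Theta> \<alpha> Xb Z \<Longrightarrow>
      0 \<le> (\<Sum>k\<in>\<beta>. (a j k * D j k + c j k) * (inner_S (\<Theta> k) Z - inner_S (\<Theta> k) (Xj j)))"
  shows "\<exists>Dh. \<exists>S\<in>Sn rc n. (\<forall>k\<in>\<beta>. inner_S (\<Theta> k) S = p k * Dh k + c' k) \<and>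
    (\<forall>W\<in>Sn rc n. psd W \<longrightarrow> 0 \<le> inner_S S W) \<and> inner_S S Xb = 0 \<and>
    (\<forall>x y. vec_space.rank n Xb \<le> x \<and> x < n \<and> vec_space.rank n Xb \<le> y \<and> y < n \<longrightarrow>
      sesq n (lin_comb n \<Theta> Dh \<beta>) (\<lambda>i. P $$ (i,x)) (\<lambda>i. P $$ (i,y)) = 0)"
proof -
  have fin: "finite \<beta>" and \<beta>d: "\<beta> \<subseteq> {..<d}" by (auto simp: \<beta>)
  have XS: "Xj j \<in> Sn rc n" and Xpsd: "psd (Xj j)" for j using feas[of j] by (auto simp: feasible_def)
  have Xin: "inner_S (\<Theta> k) (Xj j) = inner_S (\<Theta> k) Xb + \<rho> j * D j k" for j k
    using \<rho>(1)[of j] by (simp add: D_def)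
  have D\<alpha>: "D j k = 0" if "k \<in> \<alpha>" for j k
    using feas[of j] that by (simp add: feasible_def D_def)
  have "\<exists>C. \<forall>k\<in>\<beta>. \<forall>j. \<bar>c j k\<bar> \<le> C"
  proof -
    have "\<exists>C. \<forall>j. \<bar>c j k\<bar> \<le> C" if "k \<in> \<beta>" for k
      using convergent_imp_Bseq[of "\<lambda>j. c j k"] c[OF that] by (auto simp: convergent_def Bseq_def)
    then obtain C where C: "\<And>k j. k \<in> \<beta> \<Longrightarrow> \<bar>c j k\<bar> \<le> C k" by metis
    have "\<bar>c j k\<bar> \<le> Max (C ` \<beta>)" if "k \<in> \<beta>" for j k
      by (rule order_trans[OF C[OF that] Max_ge]) (use fin that in auto)
    then show ?thesis by blast
  qed
  then obtain C where C: "\<And>k j. k \<in> \<beta> \<Longrightarrow> \<bar>c j k\<bar> \<le> C" by blast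
  have "\<bar>D j k\<bar> \<le> sqrt (card \<beta> * C\<^sup>2 / \<mu>\<^sup>2)" if k: "k \<in> \<beta>" for j k
  proof (rule coordinates_bounded[OF fin \<mu>(1) \<mu>(2) C _ k])
    have "feasible rc n \<Theta> \<alpha> Xb Xb" using Xb by (simp add: feasible_def)
    \<comment> \<open>At \<open>Z = Xb\<close> the displacement from \<open>Xj j\<close> has
      coordinates \<open>- \<rho> j * D j k\<close>, so the inequality becomes quadratic in
      \<open>D\<close>.\<close>
    from vi[OF this, of j] have "0 \<le> - \<rho> j * (\<Sum>k\<in>\<beta>. (a j k * D j k + c j k) * D j k)"
      unfolding Xin by (simp add: sum_negf sum_distrib_left mult_ac)
    then show "(\<Sum>k\<in>\<beta>. (a j k * D j k + c j k) * D j k) \<le> 0"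
      using \<rho>(1)[of j] by (simp add: mult_le_0_iff)
  qed
  then have "\<bar>D j k\<bar> \<le> sqrt (card \<beta> * C\<^sup>2 / \<mu>\<^sup>2)" if "k < d" for j k
    using that D\<alpha>[of k j] by (cases "k \<in> \<alpha>") (auto simp: \<beta>)
  then have "bounded (range (\<lambda>j. D j k))" if "k < d" for k
    using that by (intro boundedI[of _ "sqrt (card \<beta> * C\<^sup>2 / \<mu>\<^sup>2)"]) auto
  then obtain \<sigma> Dh where \<sigma>: "strict_mono (\<sigma> :: nat \<Rightarrow> nat)" and Dh: "\<forall>k<d. (\<lambda>j. D (\<sigma> j) k) \<longlonglongrightarrow> Dh k"
    using bounded_coordinates_convergent_subseq[of d D] by blast
  have sub: "(\<lambda>j. x (\<sigma> j)) \<longlonglongrightarrow> l" if "x \<longlonglongrightarrow> l" for x :: "nat \<Rightarrow> real" and l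
    using LIMSEQ_subseq_LIMSEQ[OF that \<sigma>] by (simp add: o_def)
  have "\<exists>S\<in>Sn rc n. (\<forall>k\<in>{..<d} - \<alpha>. inner_S (\<Theta> k) S = p k * Dh k + c' k) \<and>
    (\<forall>W\<in>Sn rc n. psd W \<longrightarrow> 0 \<le> inner_S S W) \<and> inner_S S Xb = 0"
  proof -
    obtain X0 where X0: "X0 \<in> Sn rc n" "pd X0" "\<forall>k\<in>\<alpha>. inner_S (\<Theta> k) X0 = inner_S (\<Theta> k) Xb"
      using slater by blast
    show ?thesis
    proof (rule dual_slack_exists[OF \<alpha> Xb X0])
      fix Z assume Z: "feasible rc n \<Theta> \<alpha> Xb Z"
      \<comment> \<open>The displacement is measured from \<open>Xj\<close>, which differs from
        \<open>Xb\<close> by \<rho> times a convergent sequence; in the limit it is therefore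
        measured from \<open>Xb\<close>.\<close>
      have "(\<lambda>j. \<Sum>k\<in>\<beta>. (a (\<sigma> j) k * D (\<sigma> j) k + c (\<sigma> j) k) *
            (inner_S (\<Theta> k) Z - (inner_S (\<Theta> k) Xb + \<rho> (\<sigma> j) * D (\<sigma> j) k)))
          \<longlonglongrightarrow> (\<Sum>k\<in>\<beta>. (p k * Dh k + c' k) * (inner_S (\<Theta> k) Z - (inner_S (\<Theta> k) Xb + 0 * Dh k)))"
        using Dh \<beta>d by (intro tendsto_sum tendsto_mult tendsto_add tendsto_diff tendsto_const
            sub[OF a] sub[OF c] sub[OF \<rho>(2)]) auto
      then have "0 \<le> (\<Sum>k\<in>\<beta>. (p k * Dh k + c' k) * (inner_S (\<Theta> k) Z - (inner_S (\<Theta> k) Xb + 0 * Dh k)))"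
        using vi[OF Z] by (intro LIMSEQ_le_const) (auto simp: Xin)
      then show "0 \<le> (\<Sum>k\<in>{..<d} - \<alpha>. (p k * Dh k + c' k) * (inner_S (\<Theta> k) Z - inner_S (\<Theta> k) Xb))"
        by (simp add: \<beta>)
    qed
  qed
  moreover have "sesq n (lin_comb n \<Theta> Dh \<beta>) (\<lambda>i. P $$ (i,x)) (\<lambda>i. P $$ (i,y)) = 0"
    if "vec_space.rank n Xb \<le> x" "x < n" "vec_space.rank n Xb \<le> y" "y < n" for x y
  proof (rule rank_constant_direction_compression_zero[OF E Xb(2), of "\<lambda>j. Xj (\<sigma> j)" "\<lambda>j. \<rho> (\<sigma> j)"
        "\<lambda>j. lin_comb n \<Theta> (D (\<sigma> j)) \<beta>"])
    fix j i l assume il: "i < n" "l < n"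
    have "Xj (\<sigma> j) $$ (i,l) = (\<Sum>k<d. complex_of_real (inner_S (\<Theta> k) Xb + \<rho> (\<sigma> j) * D (\<sigma> j) k) * \<Theta> k $$ (i,l))"
      using arg_cong[OF coordinate_expansion[OF XS[of "\<sigma> j"]], of "\<lambda>X. X $$ (i,l)"] lin_comb_index[OF il]
      by (simp add: Xin)
    also have "\<dots> = (\<Sum>k<d. complex_of_real (inner_S (\<Theta> k) Xb) * \<Theta> k $$ (i,l)) +
        \<rho> (\<sigma> j) * (\<Sum>k<d. complex_of_real (D (\<sigma> j) k) * \<Theta> k $$ (i,l))"
      by (simp add: algebra_simps sum.distrib sum_distrib_left)
    also have "(\<Sum>k<d. complex_of_real (inner_S (\<Theta> k) Xb) * \<Theta> k $$ (i,l)) = Xb $$ (i,l)"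
      using arg_cong[OF coordinate_expansion[OF Xb(1)], of "\<lambda>X. X $$ (i,l)"] lin_comb_index[OF il] by simp
    also have "(\<Sum>k<d. complex_of_real (D (\<sigma> j) k) * \<Theta> k $$ (i,l)) = lin_comb n \<Theta> (D (\<sigma> j)) \<beta> $$ (i,l)"
      unfolding lin_comb_index[OF il] by (rule sum.mono_neutral_right) (auto simp: \<beta> D\<alpha>)
    finally show "Xj (\<sigma> j) $$ (i,l) = Xb $$ (i,l) + complex_of_real (\<rho> (\<sigma> j)) * lin_comb n \<Theta> (D (\<sigma> j)) \<beta> $$ (i,l)" .
  next
    fix i l assume il: "i < n" "l < n"
    show "(\<lambda>j. lin_comb n \<Theta> (D (\<sigma> j)) \<beta> $$ (i,l)) \<longlonglongrightarrow> lin_comb n \<Theta> Dh \<beta> $$ (i,l)"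
      unfolding lin_comb_index[OF il]
      using Dh \<beta>d by (intro tendsto_sum tendsto_mult tendsto_const tendsto_of_real) auto
  qed (use that XS SnD(1) rk \<rho>(1) sub[OF \<rho>(2)] in auto)
  ultimately show ?thesis unfolding \<beta> by blast
qed

end

section \<open>First-order optimality conditions\<close>

lemma sum_shift_zero:
  fixes f :: "nat \<Rightarrow> 'a::comm_monoid_add"
  assumes "r \<le> n" "\<And>a. a < r \<Longrightarrow> f a = 0"
  shows "(\<Sum>a<n. f a) = (\<Sum>a<n - r. f (r + a))"
proof -
  have "(\<Sum>a<n. f a) = (\<Sum>a\<in>{r..<n}. f a)"
    using assms by (intro sum.mono_neutral_right) auto
  also have "\<dots> = (\<Sum>a<n - r. f (r + a))"
    by (rule sum.reindex_bij_witness[of _ "\<lambda>a. r + a" "\<lambda>a. a - r"]) auto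
  finally show ?thesis .
qed

text \<open>The hypothesis removes the rows below \<open>r\<close> of \<open>S\<close> in the basis
  \<open>P\<close>, Hermitian symmetry removes the corresponding columns, and the surviving trailing
  block is \<open>L\<close>.\<close>

lemma rank_columns_compression:
  assumes E: "eig_decomp n X P lam" and S: "S \<in> Sn rc n" and r: "r \<le> n"
    and null: "\<And>a v. a < r \<Longrightarrow> sesq n S (\<lambda>i. P $$ (i,a)) v = 0"
  defines "P2 \<equiv> mat n (n - r) (\<lambda>(i,j). P $$ (i, r + j))"
    and "L \<equiv> mat (n - r) (n - r) (\<lambda>(a,b). sesq n S (\<lambda>i. P $$ (i, r + a)) (\<lambda>i. P $$ (i, r + b)))"
  shows "P2 * L * mat_adjoint P2 = S"
proof -
  have P2: "P2 \<in> carrier_mat n (n - r)" and L: "L \<in> carrier_mat (n - r) (n - r)"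
    by (simp_all add: P2_def L_def)
  have null': "sesq n S u (\<lambda>i. P $$ (i,b)) = 0" if "b < r" for u b
    using sesq_cnj[OF S, of "\<lambda>i. P $$ (i,b)" u] null[OF that, of u] by simp
  define s where "s = (\<lambda>a b. sesq n S (\<lambda>i. P $$ (i,a)) (\<lambda>i. P $$ (i,b)))"
  show ?thesis
  proof (rule eq_matI)
    fix i l assume "i < dim_row S" "l < dim_col S"
    then have il: "i < n" "l < n" using SnD(1)[OF S] by auto
    have "S $$ (i,l) = (\<Sum>a<n. \<Sum>b<n. P $$ (i,a) * s a b * cnj (P $$ (l,b)))"
      unfolding s_def by (rule unitary_expansion[OF E il])
    also have "\<dots> = (\<Sum>b<n. \<Sum>a<n. P $$ (i,a) * s a b * cnj (P $$ (l,b)))"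
      by (rule sum.swap)
    also have "\<dots> = (\<Sum>b<n - r. \<Sum>a<n. P $$ (i,a) * s a (r + b) * cnj (P $$ (l,r + b)))"
      using r null' by (intro sum_shift_zero) (auto simp: s_def)
    also have "\<dots> = (\<Sum>b<n - r. \<Sum>a<n - r. P $$ (i,r + a) * s (r + a) (r + b) * cnj (P $$ (l,r + b)))"
      using r null by (intro sum.cong refl sum_shift_zero) (auto simp: s_def)
    also have "\<dots> = (\<Sum>b<n - r. (P2 * L) $$ (i,b) * mat_adjoint P2 $$ (b,l))"
    proof (intro sum.cong refl)
      fix b assume b: "b \<in> {..<n - r}"
      have "(P2 * L) $$ (i,b) = (\<Sum>a<n - r. P $$ (i,r + a) * s (r + a) (r + b))"
        using b il by (subst mult_mat_index[OF P2 L]) (auto simp: P2_def L_def s_def)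
      then show "(\<Sum>a<n - r. P $$ (i,r + a) * s (r + a) (r + b) * cnj (P $$ (l,r + b))) =
          (P2 * L) $$ (i,b) * mat_adjoint P2 $$ (b,l)"
        using b il by (simp add: P2_def sum_distrib_right)
    qed
    also have "\<dots> = (P2 * L * mat_adjoint P2) $$ (i,l)"
      using mult_mat_index[OF mult_carrier_mat[OF P2 L] mat_adjoint_carrier[OF P2] il] by simp
    finally show "(P2 * L * mat_adjoint P2) $$ (i,l) = S $$ (i,l)" by simp
  qed (use P2 SnD(1)[OF S] in auto)
qed

lemma compression_index:
  assumes "Y \<in> carrier_mat n n" "Q \<in> carrier_mat n k" "a < k" "b < k"
  shows "(mat_adjoint Q * Y * Q) $$ (a,b) = sesq n Y (\<lambda>i. Q $$ (i,a)) (\<lambda>i. Q $$ (i,b))"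
proof -
  note QA = mat_adjoint_carrier[OF assms(2)]
  have "(mat_adjoint Q * Y * Q) $$ (a,b) = (\<Sum>l<n. (mat_adjoint Q * Y) $$ (a,l) * Q $$ (l,b))"
    using mult_mat_index[OF mult_carrier_mat[OF QA assms(1)] assms(2,3,4)] .
  also have "\<dots> = (\<Sum>l<n. \<Sum>i<n. cnj (Q $$ (i,a)) * Y $$ (i,l) * Q $$ (l,b))"
  proof (intro sum.cong refl)
    fix l assume "l \<in> {..<n}"
    then have "(mat_adjoint Q * Y) $$ (a,l) = (\<Sum>i<n. cnj (Q $$ (i,a)) * Y $$ (i,l))"
      using assms by (subst mult_mat_index[OF QA assms(1)]) auto
    then show "(mat_adjoint Q * Y) $$ (a,l) * Q $$ (l,b) = (\<Sum>i<n. cnj (Q $$ (i,a)) * Y $$ (i,l) * Q $$ (l,b))"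
      by (simp add: sum_distrib_right)
  qed
  also have "\<dots> = sesq n Y (\<lambda>i. Q $$ (i,a)) (\<lambda>i. Q $$ (i,b))"
    unfolding sesq_def by (rule sum.swap)
  finally show ?thesis .
qed

text \<open>Compressing a real matrix by complex vectors would in general give only a Hermitian
  matrix; this is where a real \<open>P\<close> is used in the real case.\<close>

lemma compressed_Sn:
  assumes S: "S \<in> Sn rc n" and real: "rc \<Longrightarrow> (\<And>a i. a < k \<Longrightarrow> i < n \<Longrightarrow> Im (v a i) = 0)"
  shows "mat k k (\<lambda>(a,b). sesq n S (v a) (v b)) \<in> Sn rc k"
  unfolding Sn_iff
proof (intro conjI impI allI)
  fix a b assume ab: "a < k" "b < k"
  show "mat k k (\<lambda>(a,b). sesq n S (v a) (v b)) $$ (a,b) = cnj (mat k k (\<lambda>(a,b). sesq n S (v a) (v b)) $$ (b,a))"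
    using ab sesq_cnj[OF S] by simp
  assume rc
  then have "Im (cnj (v a i) * S $$ (i,l) * v b l) = 0" if "i < n" "l < n" for i l
    using real ab that SnD(3)[OF S] by simp
  then show "Im (mat k k (\<lambda>(a,b). sesq n S (v a) (v b)) $$ (a,b)) = 0"
    using ab unfolding sesq_def by (simp add: Im_sum del: times_complex.sel)
qed simp

lemma compressed_psd:
  assumes S: "S \<in> Sn rc n" and L: "mat k k (\<lambda>(a,b). sesq n S (v a) (v b)) \<in> Sn rc k"
    and nonneg: "\<And>u. 0 \<le> Re (sesq n S u u)"
  shows "psd (mat k k (\<lambda>(a,b). sesq n S (v a) (v b)))"
proof (rule psdI_sesq[OF L])
  fix c
  have "sesq k (mat k k (\<lambda>(a,b). sesq n S (v a) (v b))) c c =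
      sesq n S (\<lambda>i. \<Sum>a<k. c a * v a i) (\<lambda>i. \<Sum>b<k. c b * v b i)"
    unfolding sesq_sum_left sesq_sum_right unfolding sesq_def[of k]
    by (simp add: sum_distrib_left mult_ac)
  then show "0 \<le> Re (sesq k (mat k k (\<lambda>(a,b). sesq n S (v a) (v b))) c c)"
    using nonneg by simp
qed

section \<open>Frobenius geometry and the variational inequality\<close>

lemma inner_S_self_nonneg: "X \<in> carrier_mat n n \<Longrightarrow> 0 \<le> inner_S X X"
  by (simp add: inner_S_eq sum_nonneg)

lemma frob_norm_square: "X \<in> carrier_mat n n \<Longrightarrow> (frob_norm X)\<^sup>2 = inner_S X X"
  by (simp add: frob_norm_def inner_S_self_nonneg)

lemma minus_eq_rcomb:
  assumes "A \<in> carrier_mat n n" "B \<in> carrier_mat n n"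
  shows "A - B = rcomb 1 A (-1) B"
  using assms by (intro eq_matI) auto

lemma inner_S_minus_right:
  assumes "A \<in> carrier_mat n n" "B \<in> carrier_mat n n" "C \<in> carrier_mat n n"
  shows "inner_S A (B - C) = inner_S A B - inner_S A C"
  unfolding minus_eq_rcomb[OF assms(2,3)] inner_S_rcomb[OF assms] by simp

text \<open>Bessel's inequality for one unit vector: with \<open>s = inner_S A B\<close>, the
  residual \<open>B - s A\<close> has squared norm \<open>inner_S B B - s * s\<close>.\<close>

lemma inner_S_unit_le_frob_norm:
  assumes A: "A \<in> carrier_mat n n" "inner_S A A = 1" and B: "B \<in> carrier_mat n n"
  shows "\<bar>inner_S A B\<bar> \<le> frob_norm B"
proof -
  define s where "s = inner_S A B"
  have C: "rcomb 1 B (- s) A \<in> carrier_mat n n" using A B by simp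
  have "inner_S (rcomb 1 B (- s) A) B = inner_S B B - s * s"
    unfolding inner_S_commute[OF C B] inner_S_rcomb[OF B B A(1)] inner_S_commute[OF B A(1)] by (simp add: s_def)
  moreover have "inner_S (rcomb 1 B (- s) A) A = 0"
    unfolding inner_S_commute[OF C A(1)] inner_S_rcomb[OF A(1) B A(1)] using A(2) by (simp add: s_def)
  ultimately have "inner_S (rcomb 1 B (- s) A) (rcomb 1 B (- s) A) = inner_S B B - s * s"
    unfolding inner_S_rcomb[OF C B A(1)] by simp
  then have "s\<^sup>2 \<le> inner_S B B"
    using inner_S_self_nonneg[OF C] by (simp add: power2_eq_square)
  then show ?thesis unfolding frob_norm_def s_def by (metis real_sqrt_abs real_sqrt_le_mono)
qed

text \<open>Divide by \<open>t\<close> and let \<open>t\<close> tend to 0. As the objective is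
  quadratic along a segment, this gives its directional derivative at a minimiser.\<close>

lemma linear_term_nonneg:
  fixes L Q :: real
  assumes "\<And>t. 0 < t \<Longrightarrow> t \<le> 1 \<Longrightarrow> 0 \<le> t * L + t\<^sup>2 * Q"
  shows "0 \<le> L"
proof (rule LIMSEQ_le_const)
  show "(\<lambda>j. L + inverse (real (Suc j)) * Q) \<longlonglongrightarrow> L"
    using tendsto_add[OF tendsto_const tendsto_mult[OF LIMSEQ_inverse_real_of_nat tendsto_const], of L Q] by simp
  have "0 \<le> L + inverse (real (Suc j)) * Q" for j
  proof -
    have "0 \<le> inverse (real (Suc j)) * (L + inverse (real (Suc j)) * Q)"
      using assms[of "inverse (real (Suc j))"] by (simp add: power2_eq_square algebra_simps inverse_le_1_iff)
    then show ?thesis by (simp add: zero_le_mult_iff)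
  qed
  then show "\<exists>N. \<forall>j\<ge>N. 0 \<le> L + inverse (real (Suc j)) * Q" by blast
qed

context Sn_basis
begin

text \<open>Parseval's identity with only \<open>X\<close> expanded. The left factor may lie outside
  \<open>Sn\<close>, as \<open>spectral_op\<close> has been shown to have the right size and no
  more.\<close>

lemma inner_S_coordinates:
  assumes "A \<in> carrier_mat n n" "X \<in> Sn rc n"
  shows "inner_S A X = (\<Sum>k<d. inner_S (\<Theta> k) X * inner_S (\<Theta> k) A)"
proof -
  have "inner_S A X = inner_S A (lin_comb n \<Theta> (\<lambda>k. inner_S (\<Theta> k) X) {..<d})"
    using coordinate_expansion[OF assms(2)] by simp
  also have "\<dots> = (\<Sum>k<d. inner_S (\<Theta> k) X * inner_S A (\<Theta> k))"
    by (rule inner_S_lin_comb[OF assms(1) order_refl])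
  also have "\<dots> = (\<Sum>k<d. inner_S (\<Theta> k) X * inner_S (\<Theta> k) A)"
    by (intro sum.cong refl) (subst inner_S_commute[OF assms(1) basis_carrier], auto)
  finally show ?thesis .
qed

lemma frob_norm_square_coordinates:
  assumes "X \<in> Sn rc n"
  shows "(frob_norm X)\<^sup>2 = (\<Sum>k<d. (inner_S (\<Theta> k) X)\<^sup>2)"
  using frob_norm_square[OF SnD(1)[OF assms]] inner_S_coordinates[OF SnD(1)[OF assms] assms]
  by (simp add: power2_eq_square)

lemma coordinate_le_frob_norm:
  assumes "k < d" "B \<in> carrier_mat n n"
  shows "\<bar>inner_S (\<Theta> k) B\<bar> \<le> frob_norm B"
  using inner_S_unit_le_frob_norm[OF basis_carrier[OF assms(1)] _ assms(2)] basis_orth[OF assms(1,1)] by simp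

text \<open>The derivative of the objective from \<open>X\<close> towards \<open>Z\<close>, divided
  by \<rho>. The residual of a sample is its noise term minus \<rho> times a coordinate of
  \<open>D\<close>, so the data term contributes the empirical frequency times \<open>D\<close> and
  a noise average. Writing \<open>X - Xt\<close> as the error minus \<open>Xt - Xb\<close> splits
  the proximal term into \<open>\<gamma> * \<rho> * D\<close> and the last summand of the constant
  part.\<close>

lemma optimality_variational_inequality:
  fixes obsv :: "nat \<Rightarrow> nat" and noise :: "nat \<Rightarrow> real" and Xb X :: "complex mat"
    and \<rho> :: real
  defines "D \<equiv> \<lambda>k. (inner_S (\<Theta> k) X - inner_S (\<Theta> k) Xb) / \<rho>"
  assumes \<alpha>: "\<alpha> \<subseteq> {..<d}" and \<beta>: "\<beta> = {..<d} - \<alpha>" and Xb: "Xb \<in> Sn rc n"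
    and opt: "is_optimal rc n f \<Theta> \<alpha> Xb m obsv (\<lambda>i. inner_S (\<Theta> (obsv i)) Xb + \<nu> * noise i) Xt \<rho> \<gamma> X"
    and m: "m > 0" and obs: "\<And>i. i < m \<Longrightarrow> obsv i \<in> \<beta>" and Xt: "Xt \<in> Sn rc n"
    and \<rho>: "\<rho> > 0" and Z: "feasible rc n \<Theta> \<alpha> Xb Z"
  shows "0 \<le> (\<Sum>k\<in>\<beta>.
      ((real (card {i. i < m \<and> obsv i = k}) / m + \<gamma> * \<rho>) * D k +
       (inner_S (\<Theta> k) (1\<^sub>m n - spectral_op n f Xt)
         - \<nu> * ((\<Sum>i<m. if obsv i = k then noise i else 0) / (m * \<rho>))
         - \<gamma> * (inner_S (\<Theta> k) Xt - inner_S (\<Theta> k) Xb)))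
      * (inner_S (\<Theta> k) Z - inner_S (\<Theta> k) X))"
    (is "0 \<le> (\<Sum>k\<in>\<beta>. (?a k * D k + ?c k) * _)")
proof -
  have feasX: "feasible rc n \<Theta> \<alpha> Xb X" using opt by (simp add: is_optimal_def)
  then have XS: "X \<in> Sn rc n" and ZS: "Z \<in> Sn rc n" using Z by (auto simp: feasible_def)
  define A where "A = 1\<^sub>m n - spectral_op n f Xt"
  have A: "A \<in> carrier_mat n n"
    using spectral_op_carrier[OF Xt] by (simp add: A_def minus_carrier_mat)
  define x where "x = (\<lambda>k. inner_S (\<Theta> k) X)"
  define xb where "xb = (\<lambda>k. inner_S (\<Theta> k) Xb)"
  define xt where "xt = (\<lambda>k. inner_S (\<Theta> k) Xt)"
  define A' where "A' = (\<lambda>k. inner_S (\<Theta> k) A)"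
  define h where "h = (\<lambda>k. inner_S (\<Theta> k) Z - inner_S (\<Theta> k) X)"
  define e where "e = (\<lambda>i. xb (obsv i) + \<nu> * noise i - x (obsv i))"
  \<comment> \<open>\<open>L\<close> and \<open>Q\<close> are the coefficients of \<open>t\<close>
    and \<open>t^2\<close> in the increase of the objective from \<open>X\<close> to the point
    \<open>W\<close> of the segment.\<close>
  define L where "L = - (1 / m) * (\<Sum>i<m. e i * h (obsv i)) +
    \<rho> * ((\<Sum>k<d. A' k * h k) + \<gamma> * (\<Sum>k<d. (x k - xt k) * h k))"
  define Q where "Q = (1 / (2 * m)) * (\<Sum>i<m. (h (obsv i))\<^sup>2) + \<rho> * (\<gamma> / 2 * (\<Sum>k<d. (h k)\<^sup>2))"
  have obsd: "obsv i < d" if "i < m" for i using obs[OF that] \<beta> by auto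
  have "0 \<le> L"
  proof (rule linear_term_nonneg[where Q = Q])
    fix t :: real assume t: "0 < t" "t \<le> 1"
    define W where "W = rcomb (1 - t) X t Z"
    have WS: "W \<in> Sn rc n" unfolding W_def by (rule Sn_rcomb[OF XS ZS])
    have w: "\<forall>k<d. inner_S (\<Theta> k) W = x k + t * h k"
    proof (intro allI impI)
      fix k assume kd: "k < d"
      show "inner_S (\<Theta> k) W = x k + t * h k"
      unfolding W_def inner_S_rcomb[OF basis_carrier[OF kd] SnD(1)[OF XS] SnD(1)[OF ZS]]
      by (simp add: x_def h_def algebra_simps)
    qed
    have feasW: "feasible rc n \<Theta> \<alpha> Xb W"
    proof -
      have "psd W" unfolding W_def
        using feasX Z t XS ZS by (intro psd_rcomb) (auto simp: feasible_def)
      moreover have "inner_S (\<Theta> k) W = inner_S (\<Theta> k) Xb" if "k \<in> \<alpha>" for k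
        using w feasX Z \<alpha> that by (auto simp: feasible_def x_def h_def)
      ultimately show ?thesis using WS by (simp add: feasible_def)
    qed
    have obj: "objective n f \<Theta> m obsv (\<lambda>i. inner_S (\<Theta> (obsv i)) Xb + \<nu> * noise i) Xt \<rho> \<gamma> V =
      (1 / (2 * m)) * (\<Sum>i<m. (e i - s * h (obsv i))\<^sup>2) +
      \<rho> * ((\<Sum>k<d. A' k * (x k + s * h k)) + \<gamma> / 2 * (\<Sum>k<d. (x k + s * h k - xt k)\<^sup>2))"
      if V: "V \<in> Sn rc n" "\<forall>k<d. inner_S (\<Theta> k) V = x k + s * h k" for V and s :: real
    proof -
      have "(\<Sum>i<m. (inner_S (\<Theta> (obsv i)) Xb + \<nu> * noise i - inner_S (\<Theta> (obsv i)) V)\<^sup>2) =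
          (\<Sum>i<m. (e i - s * h (obsv i))\<^sup>2)"
        using V(2) obsd by (intro sum.cong refl) (simp add: e_def xb_def algebra_simps)
      moreover have "inner_S A V = (\<Sum>k<d. A' k * (x k + s * h k))"
        unfolding inner_S_coordinates[OF A V(1)] using V(2) by (intro sum.cong refl) (simp add: A'_def)
      moreover have "(frob_norm (V - Xt))\<^sup>2 = (\<Sum>k<d. (x k + s * h k - xt k)\<^sup>2)"
      proof -
        have "V - Xt \<in> Sn rc n"
          unfolding minus_eq_rcomb[OF SnD(1)[OF V(1)] SnD(1)[OF Xt]] by (rule Sn_rcomb[OF V(1) Xt])
        then show ?thesis
          unfolding frob_norm_square_coordinates
          using V Xt basis_carrier SnD(1)
          by (subst frob_norm_square_coordinates, simp)
            (intro sum.cong refl, subst inner_S_minus_right[of _ n], auto simp: xt_def)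
      qed
      ultimately show ?thesis by (simp add: objective_def A_def)
    qed
    have le: "(1 / (2 * m)) * (\<Sum>i<m. (e i - 0 * h (obsv i))\<^sup>2) +
        \<rho> * ((\<Sum>k<d. A' k * (x k + 0 * h k)) + \<gamma> / 2 * (\<Sum>k<d. (x k + 0 * h k - xt k)\<^sup>2)) \<le>
      (1 / (2 * m)) * (\<Sum>i<m. (e i - t * h (obsv i))\<^sup>2) +
        \<rho> * ((\<Sum>k<d. A' k * (x k + t * h k)) + \<gamma> / 2 * (\<Sum>k<d. (x k + t * h k - xt k)\<^sup>2))"
    proof -
      have x0: "\<forall>k<d. inner_S (\<Theta> k) X = x k + 0 * h k" by (simp add: x_def)
      have "objective n f \<Theta> m obsv (\<lambda>i. inner_S (\<Theta> (obsv i)) Xb + \<nu> * noise i) Xt \<rho> \<gamma> X \<le>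
          objective n f \<Theta> m obsv (\<lambda>i. inner_S (\<Theta> (obsv i)) Xb + \<nu> * noise i) Xt \<rho> \<gamma> W"
        using opt feasW unfolding is_optimal_def by blast
      then show ?thesis unfolding obj[OF XS x0] obj[OF WS w] .
    qed
    have 1: "(\<Sum>i<m. (e i - t * h (obsv i))\<^sup>2) =
        (\<Sum>i<m. (e i)\<^sup>2) - 2 * t * (\<Sum>i<m. e i * h (obsv i)) + t\<^sup>2 * (\<Sum>i<m. (h (obsv i))\<^sup>2)"
      by (simp add: power2_eq_square algebra_simps sum.distrib sum_subtractf sum_distrib_left)
    have 2: "(\<Sum>k<d. (x k + t * h k - xt k)\<^sup>2) =
        (\<Sum>k<d. (x k - xt k)\<^sup>2) + 2 * t * (\<Sum>k<d. (x k - xt k) * h k) + t\<^sup>2 * (\<Sum>k<d. (h k)\<^sup>2)"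
      by (simp add: power2_eq_square algebra_simps sum.distrib sum_subtractf sum_distrib_left)
    have 3: "(\<Sum>k<d. A' k * (x k + t * h k)) = (\<Sum>k<d. A' k * x k) + t * (\<Sum>k<d. A' k * h k)"
      by (simp add: algebra_simps sum.distrib sum_distrib_left)
    show "0 \<le> t * L + t\<^sup>2 * Q"
      using le m unfolding 1 2 3 L_def Q_def by (simp add: field_simps)
  qed
  also have "L = \<rho> * (\<Sum>k\<in>\<beta>. (?a k * D k + ?c k) * h k)"
  proof -
    have h\<alpha>: "h k = 0" if "k \<in> \<alpha>" for k
      using feasX Z that by (simp add: feasible_def h_def)
    have restr: "(\<Sum>k<d. g k * h k) = (\<Sum>k\<in>\<beta>. g k * h k)" for g :: "nat \<Rightarrow> real"
      by (rule sum.mono_neutral_right) (auto simp: \<beta> h\<alpha>)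
    have x: "x k = xb k + \<rho> * D k" for k using \<rho> by (simp add: x_def xb_def D_def)
    \<comment> \<open>Samples are regrouped by the basis index they observe, which turns the sum
      over \<open>i\<close> into frequencies and noise totals for each \<open>k\<close>.\<close>
    have "(\<Sum>i<m. e i * h (obsv i)) = (\<Sum>i<m. \<Sum>k\<in>\<beta>. if obsv i = k then (\<nu> * noise i - \<rho> * D k) * h k else 0)"
    proof (intro sum.cong refl)
      fix i assume "i \<in> {..<m}"
      then have "obsv i \<in> \<beta>" "finite \<beta>" using obs by (auto simp: \<beta>)
      then show "e i * h (obsv i) = (\<Sum>k\<in>\<beta>. if obsv i = k then (\<nu> * noise i - \<rho> * D k) * h k else 0)"
        by (simp add: e_def x)
    qed
    also have "\<dots> = (\<Sum>k\<in>\<beta>. \<Sum>i<m. if obsv i = k then (\<nu> * noise i - \<rho> * D k) * h k else 0)"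
      by (rule sum.swap)
    also have "\<dots> = (\<Sum>k\<in>\<beta>. (\<nu> * (\<Sum>i<m. if obsv i = k then noise i else 0)
        - \<rho> * D k * card {i. i < m \<and> obsv i = k}) * h k)"
    proof (intro sum.cong refl)
      fix k
      have "(\<Sum>i<m. if obsv i = k then (\<nu> * noise i - \<rho> * D k) * h k else 0) =
        (\<Sum>i<m. \<nu> * h k * (if obsv i = k then noise i else 0) - \<rho> * D k * h k * (if obsv i = k then 1 else 0))"
        by (intro sum.cong refl) (auto simp: algebra_simps)
      also have "(\<Sum>i<m. if obsv i = k then 1 else 0) = real (card {i. i < m \<and> obsv i = k})"
        by (simp add: sum.If_cases lessThan_def Collect_conj_eq Int_commute)
      then have "(\<Sum>i<m. \<nu> * h k * (if obsv i = k then noise i else 0) - \<rho> * D k * h k * (if obsv i = k then 1 else 0)) =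
        \<nu> * h k * (\<Sum>i<m. if obsv i = k then noise i else 0) - \<rho> * D k * h k * card {i. i < m \<and> obsv i = k}"
        by (simp only: sum_subtractf sum_distrib_left[symmetric])
      finally show "(\<Sum>i<m. if obsv i = k then (\<nu> * noise i - \<rho> * D k) * h k else 0) =
        (\<nu> * (\<Sum>i<m. if obsv i = k then noise i else 0) - \<rho> * D k * card {i. i < m \<and> obsv i = k}) * h k"
        by (simp add: algebra_simps)
    qed
    finally have "L = (\<Sum>k\<in>\<beta>. - (1 / m) * ((\<nu> * (\<Sum>i<m. if obsv i = k then noise i else 0)
        - \<rho> * D k * card {i. i < m \<and> obsv i = k}) * h k) + (\<rho> * (A' k * h k) + \<rho> * \<gamma> * ((x k - xt k) * h k)))"
      unfolding L_def restr by (simp only: sum.distrib sum_distrib_left distrib_left mult.assoc)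
    also have "\<dots> = (\<Sum>k\<in>\<beta>. \<rho> * ((?a k * D k + ?c k) * h k))"
    proof (intro sum.cong refl)
      fix k
      show "- (1 / m) * ((\<nu> * (\<Sum>i<m. if obsv i = k then noise i else 0)
        - \<rho> * D k * card {i. i < m \<and> obsv i = k}) * h k) + (\<rho> * (A' k * h k) + \<rho> * \<gamma> * ((x k - xt k) * h k))
        = \<rho> * ((?a k * D k + ?c k) * h k)"
        unfolding x A_def[symmetric] using m \<rho> by (simp add: A'_def xb_def xt_def field_simps)
    qed
    finally show ?thesis by (simp add: sum_distrib_left)
  qed
  finally show ?thesis using \<rho> by (simp add: h_def zero_le_mult_iff)
qed

text \<open>Complementary slackness supplies the factorisation. The pairing of \<open>S\<close> with
  \<open>Xb\<close> is a sum of nonnegative terms, eigenvalue times diagonal form value; being 0, it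
  makes the eigenvectors with positive eigenvalue null vectors of \<open>S\<close>. So
  \<open>S\<close> lives on the trailing columns and its compression \<open>L\<close> is the
  solution.\<close>

lemma dual_slack_solves_system:
  assumes E: "eig_decomp n Xb P lam" and Xb: "psd Xb" and Preal: "rc \<Longrightarrow> real_mat P"
    and \<beta>: "\<beta> \<subseteq> {..<d}" and p: "\<And>k. k \<in> \<beta> \<Longrightarrow> p k > 0" and A: "A \<in> carrier_mat n n"
    and S: "S \<in> Sn rc n" "\<And>W. W \<in> Sn rc n \<Longrightarrow> psd W \<Longrightarrow> 0 \<le> inner_S S W" "inner_S S Xb = 0"
    and grad: "\<And>k. k \<in> \<beta> \<Longrightarrow> inner_S (\<Theta> k) S = p k * Dh k + inner_S (\<Theta> k) A"
    and r: "r = vec_space.rank n Xb"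
    and comp: "\<And>x y. r \<le> x \<Longrightarrow> x < n \<Longrightarrow> r \<le> y \<Longrightarrow> y < n \<Longrightarrow>
      sesq n (lin_comb n \<Theta> Dh \<beta>) (\<lambda>i. P $$ (i,x)) (\<lambda>i. P $$ (i,y)) = 0"
  shows "\<exists>\<Lambda>. \<Lambda> \<in> Sn rc (n - r) \<and> psd \<Lambda> \<and>
    (let P2 = mat n (n - r) (\<lambda>(i,j). P $$ (i, r + j)) in
      mat_adjoint P2 * Qdag n \<Theta> p \<beta> (P2 * \<Lambda> * mat_adjoint P2) * P2
      = mat_adjoint P2 * Qdag n \<Theta> p \<beta> A * P2)"
proof -
  note ev = psd_eigenvalues_rank[OF E Xb, folded r]
  note Pc = eig_decompD(1)[OF E]
  have Snn: "0 \<le> Re (sesq n S u u)" for u using dual_cone_psd[OF S(1,2)] .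
  have null: "sesq n S (\<lambda>i. P $$ (i,a)) v = 0" if a: "a < r" for a v
  proof (rule sesq_null_orthogonal[OF S(1) Snn])
    have "(\<Sum>a<n. lam a * Re (sesq n S (\<lambda>i. P $$ (i,a)) (\<lambda>i. P $$ (i,a)))) = 0"
      using S(3) inner_S_eig_decomp[OF SnD(1)[OF S(1)] E] by simp
    moreover have "0 \<le> lam a * Re (sesq n S (\<lambda>i. P $$ (i,a)) (\<lambda>i. P $$ (i,a)))" if "a < n" for a
      using Snn ev(2)[of a] ev(3)[of a] that by (cases "a < r") auto
    ultimately have "lam a * Re (sesq n S (\<lambda>i. P $$ (i,a)) (\<lambda>i. P $$ (i,a))) = 0"
      using a ev(1) by (subst (asm) sum_nonneg_eq_0_iff) auto
    then show "Re (sesq n S (\<lambda>i. P $$ (i,a)) (\<lambda>i. P $$ (i,a))) = 0" using ev(2)[OF a] by simp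
  qed
  define P2 where "P2 = mat n (n - r) (\<lambda>(i,j). P $$ (i, r + j))"
  define L where "L = mat (n - r) (n - r) (\<lambda>(a,b). sesq n S (\<lambda>i. P $$ (i, r + a)) (\<lambda>i. P $$ (i, r + b)))"
  have P2: "P2 \<in> carrier_mat n (n - r)" by (simp add: P2_def)
  have L: "L \<in> Sn rc (n - r)"
    unfolding L_def using Preal Pc by (intro compressed_Sn[OF S(1)]) (auto simp: real_mat_def)
  have "psd L" unfolding L_def by (rule compressed_psd[OF S(1) L[unfolded L_def] Snn])
  have S_eq: "P2 * L * mat_adjoint P2 = S"
    unfolding P2_def L_def by (rule rank_columns_compression[OF E S(1) ev(1) null])
  have Qc: "Qdag n \<Theta> p \<beta> X \<in> carrier_mat n n" for X by (simp add: Qdag_def lin_comb_carrier)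
  have Qs: "sesq n (Qdag n \<Theta> p \<beta> X) u v = (\<Sum>k\<in>\<beta>. complex_of_real (inner_S (\<Theta> k) X / p k) * sesq n (\<Theta> k) u v)"
    for X u v unfolding Qdag_def by (rule sesq_sum_mat) (rule lin_comb_index)
  have "mat_adjoint P2 * Qdag n \<Theta> p \<beta> S * P2 = mat_adjoint P2 * Qdag n \<Theta> p \<beta> A * P2"
  proof (rule eq_matI)
    fix a b assume "a < dim_row (mat_adjoint P2 * Qdag n \<Theta> p \<beta> A * P2)"
      "b < dim_col (mat_adjoint P2 * Qdag n \<Theta> p \<beta> A * P2)"
    then have ab: "a < n - r" "b < n - r" using P2 by auto
    define u where "u = (\<lambda>i. P2 $$ (i,a))"
    define v where "v = (\<lambda>i. P2 $$ (i,b))"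
    have "sesq n (lin_comb n \<Theta> Dh \<beta>) u v = sesq n (lin_comb n \<Theta> Dh \<beta>) (\<lambda>i. P $$ (i,r + a)) (\<lambda>i. P $$ (i,r + b))"
      using ab by (intro sesq_cong) (auto simp: u_def v_def P2_def)
    also have "\<dots> = 0" using ab by (intro comp) auto
    finally have "(\<Sum>k\<in>\<beta>. complex_of_real (Dh k) * sesq n (\<Theta> k) u v) = 0"
      using sesq_sum_mat[where X = "lin_comb n \<Theta> Dh \<beta>" and u = u and v = v, OF lin_comb_index] by simp
    moreover have "complex_of_real (inner_S (\<Theta> k) S / p k) = complex_of_real (Dh k) + complex_of_real (inner_S (\<Theta> k) A / p k)"
      if "k \<in> \<beta>" for k
    proof -
      have "inner_S (\<Theta> k) S / p k = Dh k + inner_S (\<Theta> k) A / p k"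
        using grad[OF that] p[OF that] by (simp add: add_divide_distrib)
      then show ?thesis by (simp only: of_real_add)
    qed
    ultimately have "sesq n (Qdag n \<Theta> p \<beta> S) u v = sesq n (Qdag n \<Theta> p \<beta> A) u v"
      unfolding Qs by (simp add: distrib_right sum.distrib)
    then show "(mat_adjoint P2 * Qdag n \<Theta> p \<beta> S * P2) $$ (a,b) = (mat_adjoint P2 * Qdag n \<Theta> p \<beta> A * P2) $$ (a,b)"
      unfolding compression_index[OF Qc P2 ab] u_def v_def .
  qed (use P2 in auto)
  then show ?thesis
    using L \<open>psd L\<close> unfolding Let_def P2_def[symmetric] by (intro exI[of _ L]) (simp add: S_eq)
qed

text \<open>The deterministic core: for each \<open>j\<close> an outcome and a sample size have been
  fixed, and only limits along \<open>j\<close> remain. The parameters \<gamma> need not converge;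
  they only have to stay bounded.\<close>

theorem solvable_of_approximating_outcomes:
  fixes obsv :: "nat \<Rightarrow> nat \<Rightarrow> nat" and noise :: "nat \<Rightarrow> nat \<Rightarrow> real" and m :: "nat \<Rightarrow> nat"
    and Xb :: "complex mat" and Xj Xt :: "nat \<Rightarrow> complex mat" and \<rho> \<gamma> :: "nat \<Rightarrow> real"
  assumes \<alpha>: "\<alpha> \<subseteq> {..<d}" and \<beta>: "\<beta> = {..<d} - \<alpha>" and p: "\<And>k. k \<in> \<beta> \<Longrightarrow> p k > 0"
    and Xb: "Xb \<in> Sn rc n" "psd Xb"
    and slater: "\<exists>X0\<in>Sn rc n. pd X0 \<and> (\<forall>k\<in>\<alpha>. inner_S (\<Theta> k) X0 = inner_S (\<Theta> k) Xb)"
    and E: "eig_decomp n Xb P lam" and Preal: "rc \<Longrightarrow> real_mat P"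
    and opt: "\<And>j. is_optimal rc n f \<Theta> \<alpha> Xb (m j) (obsv j)
      (\<lambda>i. inner_S (\<Theta> (obsv j i)) Xb + \<nu> * noise j i) (Xt j) (\<rho> j) (\<gamma> j) (Xj j)"
    and m: "\<And>j. m j > 0" and obs: "\<And>j i. obsv j i \<in> \<beta>" and Xt: "\<And>j. Xt j \<in> Sn rc n"
    and rk: "\<And>j. vec_space.rank n (Xj j) = vec_space.rank n Xb"
    and \<rho>: "\<And>j. \<rho> j > 0" "\<rho> \<longlonglongrightarrow> 0" and \<gamma>: "\<And>j. 0 \<le> \<gamma> j" "\<And>j. \<gamma> j \<le> K"
    and freq: "\<And>k. k \<in> \<beta> \<Longrightarrow> (\<lambda>j. real (card {i. i < m j \<and> obsv j i = k}) / m j) \<longlonglongrightarrow> p k"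
    and noise0: "\<And>k. k \<in> \<beta> \<Longrightarrow> (\<lambda>j. (\<Sum>i<m j. if obsv j i = k then noise j i else 0) / (m j * \<rho> j)) \<longlonglongrightarrow> 0"
    and Xt_lim: "(\<lambda>j. frob_norm (Xt j - Xb)) \<longlonglongrightarrow> 0"
    and F_lim: "(\<lambda>j. frob_norm (spectral_op n f (Xt j) - spectral_op n f Xb)) \<longlonglongrightarrow> 0"
    and r: "r = vec_space.rank n Xb"
  shows "\<exists>\<Lambda>. \<Lambda> \<in> Sn rc (n - r) \<and> psd \<Lambda> \<and>
    (let P2 = mat n (n - r) (\<lambda>(i,j). P $$ (i, r + j)) in
      mat_adjoint P2 * Qdag n \<Theta> p \<beta> (P2 * \<Lambda> * mat_adjoint P2) * P2
      = mat_adjoint P2 * Qdag n \<Theta> p \<beta> (1\<^sub>m n - spectral_op n f Xb) * P2)"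
proof -
  define a where "a = (\<lambda>j k. real (card {i. i < m j \<and> obsv j i = k}) / m j + \<gamma> j * \<rho> j)"
  define c where "c = (\<lambda>j k. inner_S (\<Theta> k) (1\<^sub>m n - spectral_op n f (Xt j))
    - \<nu> * ((\<Sum>i<m j. if obsv j i = k then noise j i else 0) / (m j * \<rho> j))
    - \<gamma> j * (inner_S (\<Theta> k) (Xt j) - inner_S (\<Theta> k) Xb))"
  define c' where "c' = (\<lambda>k. inner_S (\<Theta> k) (1\<^sub>m n - spectral_op n f Xb))"
  note F = spectral_op_carrier
  have bounded_mult: "(\<lambda>j. \<gamma> j * x j) \<longlonglongrightarrow> 0" if "x \<longlonglongrightarrow> 0" for x :: "nat \<Rightarrow> real"
  proof (rule Lim_null_comparison)
    show "(\<lambda>j. \<bar>K\<bar> * \<bar>x j\<bar>) \<longlonglongrightarrow> 0"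
      using tendsto_mult[OF tendsto_const tendsto_rabs[OF that]] by simp
    show "\<forall>\<^sub>F j in sequentially. norm (\<gamma> j * x j) \<le> \<bar>K\<bar> * \<bar>x j\<bar>"
      using \<gamma> by (intro always_eventually allI) (auto simp: abs_mult intro!: mult_right_mono order_trans[OF \<gamma>(2) abs_ge_self])
  qed
  have a_lim: "(\<lambda>j. a j k) \<longlonglongrightarrow> p k" if "k \<in> \<beta>" for k
    using tendsto_add[OF freq[OF that] bounded_mult[OF \<rho>(2)]] by (simp add: a_def)
  have c_lim: "(\<lambda>j. c j k) \<longlonglongrightarrow> c' k" if k: "k \<in> \<beta>" for k
  proof -
    have kd: "k < d" using k by (simp add: \<beta>)
    have "(\<lambda>j. inner_S (\<Theta> k) (Xt j) - inner_S (\<Theta> k) Xb) \<longlonglongrightarrow> 0"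
    proof (rule Lim_null_comparison[OF _ Xt_lim], intro always_eventually allI)
      fix j show "norm (inner_S (\<Theta> k) (Xt j) - inner_S (\<Theta> k) Xb) \<le> frob_norm (Xt j - Xb)"
        using coordinate_le_frob_norm[OF kd, of "Xt j - Xb"]
          inner_S_minus_right[OF basis_carrier[OF kd] SnD(1)[OF Xt] SnD(1)[OF Xb(1)]] SnD(1)[OF Xb(1)]
        by (simp add: minus_carrier_mat)
    qed
    moreover have "(\<lambda>j. inner_S (\<Theta> k) (1\<^sub>m n - spectral_op n f (Xt j)) - c' k) \<longlonglongrightarrow> 0"
    proof (rule Lim_null_comparison[OF _ F_lim], intro always_eventually allI)
      fix j
      have "inner_S (\<Theta> k) (1\<^sub>m n - spectral_op n f (Xt j)) - c' k =
          - inner_S (\<Theta> k) (spectral_op n f (Xt j) - spectral_op n f Xb)"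
        unfolding c'_def inner_S_minus_right[OF basis_carrier[OF kd] one_carrier_mat F[OF Xt]]
          inner_S_minus_right[OF basis_carrier[OF kd] one_carrier_mat F[OF Xb(1)]]
          inner_S_minus_right[OF basis_carrier[OF kd] F[OF Xt] F[OF Xb(1)]] by simp
      then show "norm (inner_S (\<Theta> k) (1\<^sub>m n - spectral_op n f (Xt j)) - c' k) \<le>
          frob_norm (spectral_op n f (Xt j) - spectral_op n f Xb)"
        using coordinate_le_frob_norm[OF kd minus_carrier_mat[OF F[OF Xb(1)]]] by simp
    qed
    then have "(\<lambda>j. inner_S (\<Theta> k) (1\<^sub>m n - spectral_op n f (Xt j))) \<longlonglongrightarrow> c' k"
      by (simp add: LIM_zero_iff)
    ultimately have "(\<lambda>j. c j k) \<longlonglongrightarrow> c' k - \<nu> * 0 - 0"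
      unfolding c_def by (intro tendsto_diff tendsto_mult tendsto_const bounded_mult noise0[OF k])
    then show ?thesis by simp
  qed
  have fin: "finite \<beta>" by (simp add: \<beta>)
  \<comment> \<open>Half the least probability leaves a strict margin, so that the converging
    coefficients eventually exceed \<mu>; the value 1 is a default for empty \<beta>.\<close>
  obtain \<mu> where \<mu>: "\<mu> > 0" "\<And>k. k \<in> \<beta> \<Longrightarrow> \<mu> < p k"
  proof (cases "\<beta> = {}")
    case True then show ?thesis using that[of 1] by simp
  next
    case False
    define q where "q = Min (p ` \<beta>)"
    have "q > 0" using False fin p by (auto simp: q_def)
    moreover have "q \<le> p k" if "k \<in> \<beta>" for k using that fin by (simp add: q_def)
    ultimately show ?thesis using that[of "q / 2"] by (smt (verit) field_sum_of_halves)
  qed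
  have "\<forall>\<^sub>F j in sequentially. \<forall>k\<in>\<beta>. \<mu> < a j k"
    using fin a_lim \<mu>(2) by (intro eventually_ball_finite ballI order_tendstoD(1)) auto
  \<comment> \<open>The lower bound must hold for every index of the sequence, so the first
    \<open>N\<close> terms are dropped by a shift.\<close>
  then obtain N where N: "\<And>j k. N \<le> j \<Longrightarrow> k \<in> \<beta> \<Longrightarrow> \<mu> < a j k"
    by (auto simp: eventually_sequentially)
  have "\<exists>Dh. \<exists>S\<in>Sn rc n. (\<forall>k\<in>\<beta>. inner_S (\<Theta> k) S = p k * Dh k + c' k) \<and>
    (\<forall>W\<in>Sn rc n. psd W \<longrightarrow> 0 \<le> inner_S S W) \<and> inner_S S Xb = 0 \<and>
    (\<forall>x y. vec_space.rank n Xb \<le> x \<and> x < n \<and> vec_space.rank n Xb \<le> y \<and> y < n \<longrightarrow>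
      sesq n (lin_comb n \<Theta> Dh \<beta>) (\<lambda>i. P $$ (i,x)) (\<lambda>i. P $$ (i,y)) = 0)"
  proof (rule limit_optimality_uniform[OF \<alpha> \<beta> Xb slater E, of "\<lambda>j. Xj (j + N)" "\<lambda>j. \<rho> (j + N)"
        "\<lambda>j. a (j + N)" p "\<lambda>j. c (j + N)" c' \<mu>])
    show "feasible rc n \<Theta> \<alpha> Xb (Xj (j + N))" for j using opt[of "j + N"] by (simp add: is_optimal_def)
    show "\<mu> \<le> a (j + N) k" if "k \<in> \<beta>" for j k using N[of "j + N" k] that by simp
    fix j Z assume Z: "feasible rc n \<Theta> \<alpha> Xb Z"
    show "0 \<le> (\<Sum>k\<in>\<beta>. (a (j + N) k * ((inner_S (\<Theta> k) (Xj (j + N)) - inner_S (\<Theta> k) Xb) / \<rho> (j + N)) + c (j + N) k)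
        * (inner_S (\<Theta> k) Z - inner_S (\<Theta> k) (Xj (j + N))))"
      unfolding a_def c_def
      by (rule optimality_variational_inequality[OF \<alpha> \<beta> Xb(1) opt m obs Xt \<rho>(1) Z])
  qed (use rk \<rho>(1) \<mu>(1) LIMSEQ_ignore_initial_segment[OF \<rho>(2)] LIMSEQ_ignore_initial_segment[OF a_lim]
      LIMSEQ_ignore_initial_segment[OF c_lim] in auto)
  then obtain Dh S where S: "S \<in> Sn rc n" "\<And>k. k \<in> \<beta> \<Longrightarrow> inner_S (\<Theta> k) S = p k * Dh k + c' k"
      "\<And>W. W \<in> Sn rc n \<Longrightarrow> psd W \<Longrightarrow> 0 \<le> inner_S S W" "inner_S S Xb = 0"
    and comp: "\<And>x y. vec_space.rank n Xb \<le> x \<Longrightarrow> x < n \<Longrightarrow> vec_space.rank n Xb \<le> y \<Longrightarrow> y < n \<Longrightarrow>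
      sesq n (lin_comb n \<Theta> Dh \<beta>) (\<lambda>i. P $$ (i,x)) (\<lambda>i. P $$ (i,y)) = 0"
    by blast
  show ?thesis
    using \<beta> p S comp minus_carrier_mat[OF F[OF Xb(1)]]
    by (intro dual_slack_solves_system[OF E Xb(2) Preal, of \<beta> p _ S Dh]) (auto simp: c'_def r)
qed

end

section \<open>Sampling\<close>

context prob_space
begin

text \<open>Chebyshev's inequality: orthogonality removes the cross terms, so the second moment of
  the sum is at most \<open>m\<close>.\<close>

lemma orthogonal_sum_tail_bound:
  fixes U :: "nat \<Rightarrow> 'a \<Rightarrow> real"
  assumes [measurable]: "\<And>i. U i \<in> borel_measurable M"
    and int: "\<And>i j. integrable M (\<lambda>w. U i w * U j w)"
    and orth: "\<And>i j. i \<noteq> j \<Longrightarrow> expectation (\<lambda>w. U i w * U j w) = 0"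
    and var: "\<And>i. expectation (\<lambda>w. U i w * U i w) \<le> 1" and t: "t > 0"
  shows "prob {w \<in> space M. t \<le> \<bar>\<Sum>i<m. U i w\<bar>} \<le> m / t\<^sup>2"
proof -
  have sq: "(\<Sum>i<m. U i w)\<^sup>2 = (\<Sum>i<m. \<Sum>j<m. U i w * U j w)" for w
    by (simp add: power2_eq_square sum_product)
  have "prob {w \<in> space M. t \<le> \<bar>\<Sum>i<m. U i w\<bar>} \<le> expectation (\<lambda>w. (\<Sum>i<m. U i w)\<^sup>2) / t\<^sup>2"
    using t int by (intro second_moment_method) (auto simp: sq)
  also have "expectation (\<lambda>w. (\<Sum>i<m. U i w)\<^sup>2) = (\<Sum>i<m. \<Sum>j<m. expectation (\<lambda>w. U i w * U j w))"
    using int by (simp add: sq)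
  also have "\<dots> = (\<Sum>i<m. expectation (\<lambda>w. U i w * U i w))"
  proof (intro sum.cong refl)
    fix i assume "i \<in> {..<m}"
    then have "(\<Sum>j<m. expectation (\<lambda>w. U i w * U j w)) = (\<Sum>j\<in>{i}. expectation (\<lambda>w. U i w * U j w))"
      using orth by (intro sum.mono_neutral_right) auto
    then show "(\<Sum>j<m. expectation (\<lambda>w. U i w * U j w)) = expectation (\<lambda>w. U i w * U i w)" by simp
  qed
  also have "\<dots> \<le> m" using sum_mono[of "{..<m}", OF var] by simp
  finally show ?thesis using t by (simp add: divide_right_mono)
qed

text \<open>The normalisation \<open>s\<close> is left open because two are used: \<open>m\<close>
  for frequencies, and \<open>m * \<rho> m\<close> for the noise, where the condition on
  \<open>s\<close> amounts to divergence of \<open>sqrt m * \<rho> m\<close>.\<close>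

lemma orthogonal_sum_scaled_tail_tendsto:
  fixes U :: "nat \<Rightarrow> 'a \<Rightarrow> real" and s :: "nat \<Rightarrow> real"
  assumes "\<And>i. U i \<in> borel_measurable M"
    and "\<And>i j. integrable M (\<lambda>w. U i w * U j w)"
    and "\<And>i j. i \<noteq> j \<Longrightarrow> expectation (\<lambda>w. U i w * U j w) = 0"
    and "\<And>i. expectation (\<lambda>w. U i w * U i w) \<le> 1"
    and s: "\<And>m. m > 0 \<Longrightarrow> s m > 0" "(\<lambda>m. m / (s m)\<^sup>2) \<longlonglongrightarrow> 0" and \<epsilon>: "\<epsilon> > 0"
  shows "(\<lambda>m. prob {w \<in> space M. \<epsilon> \<le> \<bar>(\<Sum>i<m. U i w) / s m\<bar>}) \<longlonglongrightarrow> 0"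
proof (rule Lim_null_comparison)
  show "(\<lambda>m. 1 / \<epsilon>\<^sup>2 * (m / (s m)\<^sup>2)) \<longlonglongrightarrow> 0"
    using tendsto_mult[OF tendsto_const s(2), of "1 / \<epsilon>\<^sup>2"] by simp
  show "\<forall>\<^sub>F m in sequentially. norm (prob {w \<in> space M. \<epsilon> \<le> \<bar>(\<Sum>i<m. U i w) / s m\<bar>}) \<le> 1 / \<epsilon>\<^sup>2 * (m / (s m)\<^sup>2)"
    using eventually_gt_at_top[of 0]
  proof eventually_elim
    case (elim m)
    have sm: "s m > 0" using s(1) elim by simp
    then have "{w \<in> space M. \<epsilon> \<le> \<bar>(\<Sum>i<m. U i w) / s m\<bar>} = {w \<in> space M. \<epsilon> * s m \<le> \<bar>\<Sum>i<m. U i w\<bar>}"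
      by (auto simp: pos_le_divide_eq)
    then have "prob {w \<in> space M. \<epsilon> \<le> \<bar>(\<Sum>i<m. U i w) / s m\<bar>} \<le> m / (\<epsilon> * s m)\<^sup>2"
      using orthogonal_sum_tail_bound[where t = "\<epsilon> * s m" and m = m, OF assms(1-4)] \<epsilon> sm by simp
    then show ?case by (simp add: power_mult_distrib)
  qed
qed

text \<open>If no such outcome existed, \<open>R m\<close> would be almost surely covered by the bad
  events, although \<open>3 / 4\<close> exceeds \<open>1 / 2 + 1 / 8\<close>. The event
  \<open>C m\<close> is kept apart because stochastic boundedness makes its probability small, not
  vanishing. Monotonicity of the measure asks for measurability of the covering set only, so
  \<open>R m\<close> may be any set.\<close>

lemma eventually_exists_outcome:
  assumes "finite I" and B: "\<And>i m. i \<in> I \<Longrightarrow> B i m \<in> events" "\<And>i. i \<in> I \<Longrightarrow> (\<lambda>m. prob (B i m)) \<longlonglongrightarrow> 0"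
    and C: "\<And>m. C m \<in> events" "\<forall>\<^sub>F m in sequentially. prob (C m) < 1 / 2"
    and R: "(\<lambda>m. prob (R m)) \<longlonglongrightarrow> 1" and G: "AE w in M. G w"
  shows "\<forall>\<^sub>F m in sequentially. \<exists>w. w \<in> R m \<and> G w \<and> w \<notin> C m \<and> (\<forall>i\<in>I. w \<notin> B i m)"
proof -
  have "(\<lambda>m. \<Sum>i\<in>I. prob (B i m)) \<longlonglongrightarrow> (\<Sum>i\<in>I. 0)" by (intro tendsto_sum B)
  then have "\<forall>\<^sub>F m in sequentially. (\<Sum>i\<in>I. prob (B i m)) < 1 / 8"
    by (rule order_tendstoD(2)) simp
  moreover have "\<forall>\<^sub>F m in sequentially. 3 / 4 < prob (R m)"
    using R by (rule order_tendstoD(1)) simp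
  ultimately show ?thesis
    using C(2)
  proof eventually_elim
    case (elim m)
    show ?case
    proof (rule ccontr)
      assume "\<not> ?case"
      then have "AE w in M. w \<in> R m \<longrightarrow> w \<in> C m \<union> (\<Union>i\<in>I. B i m)"
        using G by (auto elim!: eventually_mono)
      then have "prob (R m) \<le> prob (C m \<union> (\<Union>i\<in>I. B i m))"
        using B(1) C(1) assms(1) by (intro finite_measure_mono_AE) auto
      also have "\<dots> \<le> prob (C m) + prob (\<Union>i\<in>I. B i m)"
        using B(1) C(1) assms(1) by (intro measure_Un_le) auto
      also have "prob (\<Union>i\<in>I. B i m) \<le> (\<Sum>i\<in>I. prob (B i m))"
        using B(1) assms(1) by (intro finite_measure_subadditive_finite) auto
      finally show False using elim by linarith
    qed
  qed
qed

end

text \<open>The sum type gathers observations and noise into a single independent family, so that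
  mixed products of both kinds factor; observations are cast to reals to share the target
  space.\<close>

locale sampling = prob_space +
  fixes obs :: "nat \<Rightarrow> 'a \<Rightarrow> nat" and noise :: "nat \<Rightarrow> 'a \<Rightarrow> real" and \<beta> :: "nat set" and p :: "nat \<Rightarrow> real"
  assumes indep: "indep_vars (\<lambda>_. borel) (\<lambda>i. case i of Inl k \<Rightarrow> (\<lambda>w. real (obs k w)) | Inr k \<Rightarrow> noise k) UNIV"
    and obs_dist: "\<And>i k. k \<in> \<beta> \<Longrightarrow> prob {w \<in> space M. obs i w = k} = p k"
    and noise_int: "\<And>i. integrable M (noise i)" "\<And>i. integrable M (\<lambda>w. (noise i w)\<^sup>2)"
    and noise_mean: "\<And>i. expectation (noise i) = 0"
    and noise_var: "\<And>i. expectation (\<lambda>w. (noise i w)\<^sup>2) = 1"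
    and finite_\<beta>: "finite \<beta>" and p_sum: "(\<Sum>k\<in>\<beta>. p k) = 1"
begin

lemma real_obs_measurable: "(\<lambda>w. real (obs i w)) \<in> borel_measurable M"
proof -
  have "random_variable borel (case Inl i of Inl k \<Rightarrow> (\<lambda>w. real (obs k w)) | Inr k \<Rightarrow> noise k)"
    using indep unfolding indep_vars_def2 by blast
  then show ?thesis by simp
qed

lemma obs_event [measurable]: "{w \<in> space M. obs i w = k} \<in> events"
proof -
  have "{w \<in> space M. real (obs i w) = real k} \<in> events"
    using real_obs_measurable[of i] by measurable
  then show ?thesis by simp
qed

lemma noise_measurable [measurable]: "noise i \<in> borel_measurable M"
  using noise_int(1)[of i] by simp

text \<open>The masses on \<beta> already add up to 1, and the countably many exceptional null sets
  can be united.\<close>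

lemma AE_obs_in: "AE w in M. \<forall>i. obs i w \<in> \<beta>"
  unfolding AE_all_countable
proof
  fix i
  have "prob (\<Union>k\<in>\<beta>. {w \<in> space M. obs i w = k}) = (\<Sum>k\<in>\<beta>. prob {w \<in> space M. obs i w = k})"
    using finite_\<beta> by (intro finite_measure_finite_Union) (auto simp: disjoint_family_on_def)
  then have "prob (\<Union>k\<in>\<beta>. {w \<in> space M. obs i w = k}) = 1" by (simp add: obs_dist p_sum)
  then have "AE w in M. w \<in> (\<Union>k\<in>\<beta>. {w \<in> space M. obs i w = k})" by (rule AE_prob_1)
  then show "AE w in M. obs i w \<in> \<beta>" by (auto elim!: eventually_mono)
qed

definition hit :: "nat \<Rightarrow> nat \<Rightarrow> 'a \<Rightarrow> real" where
  "hit k i w = (if obs i w = k then 1 else 0)"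

lemma hit_measurable [measurable]: "hit k i \<in> borel_measurable M"
  unfolding hit_def by measurable

lemma hit_integrable: "integrable M (hit k i)"
  by (rule integrable_const_bound[of _ 1]) (auto simp: hit_def)

lemma hit_expectation: "k \<in> \<beta> \<Longrightarrow> expectation (hit k i) = p k"
proof -
  assume k: "k \<in> \<beta>"
  have "expectation (hit k i) = expectation (indicator {w \<in> space M. obs i w = k})"
    by (intro Bochner_Integration.integral_cong) (auto simp: hit_def)
  then show ?thesis using obs_dist[OF k] by simp
qed

text \<open>The shift \<open>c\<close> covers both uses: \<open>p k\<close> centres the indicators
  for the frequencies, and 0 leaves them as weights of the noise.\<close>

lemma indep_transformed:
  "indep_vars (\<lambda>_. borel) (\<lambda>i. case i of Inl j \<Rightarrow> (\<lambda>w. hit k j w - c) | Inr j \<Rightarrow> noise j) UNIV"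
proof -
  define Y :: "nat + nat \<Rightarrow> real \<Rightarrow> real" where
    "Y = (\<lambda>i x. case i of Inl j \<Rightarrow> (if x = real k then 1 else 0) - c | Inr j \<Rightarrow> x)"
  have "Y i \<in> borel_measurable borel" for i by (cases i) (auto simp: Y_def)
  then have "indep_vars (\<lambda>_. borel) (\<lambda>i w. Y i ((case i of Inl k \<Rightarrow> (\<lambda>w. real (obs k w)) | Inr k \<Rightarrow> noise k) w)) UNIV"
    by (intro indep_vars_compose2[OF indep]) auto
  also have "(\<lambda>i w. Y i ((case i of Inl k \<Rightarrow> (\<lambda>w. real (obs k w)) | Inr k \<Rightarrow> noise k) w)) =
      (\<lambda>i. case i of Inl j \<Rightarrow> (\<lambda>w. hit k j w - c) | Inr j \<Rightarrow> noise j)"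
    by (auto simp: fun_eq_iff Y_def hit_def split: sum.splits)
  finally show ?thesis .
qed

text \<open>Centred indicators have products bounded by 1 and are orthogonal for distinct samples,
  so the weak law holds with variance ratio \<open>1 / m\<close>.\<close>

lemma frequency_tail_tendsto:
  assumes k: "k \<in> \<beta>" and \<epsilon>: "\<epsilon> > 0"
  shows "(\<lambda>m. prob {w \<in> space M. \<epsilon> \<le> \<bar>(\<Sum>i<m. hit k i w - p k) / m\<bar>}) \<longlonglongrightarrow> 0"
proof (rule orthogonal_sum_scaled_tail_tendsto)
  have p01: "0 \<le> p k" "p k \<le> 1" using obs_dist[OF k, of 0, symmetric] by auto
  have bd: "\<bar>(hit k i w - p k) * (hit k j w - p k)\<bar> \<le> 1" for i j w
    using mult_mono[of "\<bar>hit k i w - p k\<bar>" 1 "\<bar>hit k j w - p k\<bar>" 1] p01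
    by (auto simp: abs_mult hit_def)
  show int: "integrable M (\<lambda>w. (hit k i w - p k) * (hit k j w - p k))" for i j
    using bd by (intro integrable_const_bound[of _ 1]) auto
  show "expectation (\<lambda>w. (hit k i w - p k) * (hit k i w - p k)) \<le> 1" for i
    using bd[of i _ i] by (intro integral_le_const int) (auto intro!: AE_I2 dest: abs_le_D1)
  show "expectation (\<lambda>w. (hit k i w - p k) * (hit k j w - p k)) = 0" if "i \<noteq> j" for i j
  proof -
    let ?X = "\<lambda>i. case i of Inl j \<Rightarrow> (\<lambda>w. hit k j w - p k) | Inr j \<Rightarrow> noise j"
    have "expectation (\<lambda>w. \<Prod>x\<in>{Inl i, Inl j}. ?X x w) = (\<Prod>x\<in>{Inl i, Inl j}. expectation (?X x))"
      using hit_integrable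
      by (intro indep_vars_lebesgue_integral indep_vars_subset[OF indep_transformed]) auto
    then show ?thesis using that hit_integrable by (simp add: hit_expectation[OF k] prob_space)
  qed
  show "(\<lambda>m. real m / (real m)\<^sup>2) \<longlonglongrightarrow> 0"
  proof -
    have "real m / (real m)\<^sup>2 = 1 / real m" for m by (simp add: power2_eq_square)
    then show ?thesis using lim_1_over_n[where 'a = real] by (simp only:)
  qed
qed (use \<epsilon> in auto)

text \<open>For distinct samples the cross moment is the mean of a product of four independent
  variables, two of them with mean 0. On the diagonal the indicator is at most 1, so the noise
  variance is a bound. The variance ratio is the inverse square of
  \<open>sqrt m * \<rho> m\<close>.\<close>

lemma noise_tail_tendsto:
  fixes \<rho> :: "nat \<Rightarrow> real"
  assumes \<rho>: "\<And>m. \<rho> m > 0" "filterlim (\<lambda>m. sqrt (real m) * \<rho> m) at_top sequentially" and \<epsilon>: "\<epsilon> > 0"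
  shows "(\<lambda>m. prob {w \<in> space M. \<epsilon> \<le> \<bar>(\<Sum>i<m. hit k i w * noise i w) / (m * \<rho> m)\<bar>}) \<longlonglongrightarrow> 0"
proof (rule orthogonal_sum_scaled_tail_tendsto)
  let ?X = "\<lambda>i. case i of Inl j \<Rightarrow> (\<lambda>w. hit k j w - 0) | Inr j \<Rightarrow> noise j"
  have prod: "(\<Prod>x\<in>{Inl i, Inl j, Inr i, Inr j}. ?X x w) = (hit k i w * noise i w) * (hit k j w * noise j w)"
    if "i \<noteq> j" for i j w using that by simp
  have Xint: "integrable M (?X x)" for x
    using hit_integrable noise_int(1) by (cases x) auto
  have diag: "(hit k i w * noise i w) * (hit k i w * noise i w) \<le> (noise i w)\<^sup>2" for i w
    by (simp add: hit_def power2_eq_square)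
  have int_diag: "integrable M (\<lambda>w. (hit k i w * noise i w) * (hit k i w * noise i w))" for i
    by (rule Bochner_Integration.integrable_bound[OF noise_int(2)[of i]])
      (auto simp: hit_def power2_eq_square)
  show "integrable M (\<lambda>w. (hit k i w * noise i w) * (hit k j w * noise j w))" for i j
  proof (cases "i = j")
    case False
    have "integrable M (\<lambda>w. \<Prod>x\<in>{Inl i, Inl j, Inr i, Inr j}. ?X x w)"
      by (intro indep_vars_integrable indep_vars_subset[OF indep_transformed] Xint) auto
    then show ?thesis unfolding prod[OF False] .
  qed (use int_diag in simp)
  show "expectation (\<lambda>w. (hit k i w * noise i w) * (hit k j w * noise j w)) = 0" if "i \<noteq> j" for i j
  proof -
    have "expectation (\<lambda>w. \<Prod>x\<in>{Inl i, Inl j, Inr i, Inr j}. ?X x w) =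
        (\<Prod>x\<in>{Inl i, Inl j, Inr i, Inr j}. expectation (?X x))"
      by (intro indep_vars_lebesgue_integral indep_vars_subset[OF indep_transformed] Xint) auto
    also have "\<dots> = 0" using that by (simp add: noise_mean)
    finally show ?thesis unfolding prod[OF that] .
  qed
  show "expectation (\<lambda>w. (hit k i w * noise i w) * (hit k i w * noise i w)) \<le> 1" for i
    using integral_mono[OF int_diag noise_int(2) diag, of i] by (simp add: noise_var)
  show "(\<lambda>m. real m / (real m * \<rho> m)\<^sup>2) \<longlonglongrightarrow> 0"
  proof -
    have "((\<lambda>x::real. 1 / x\<^sup>2) \<longlongrightarrow> 0) at_top" by real_asymp
    then have lim: "(\<lambda>m. 1 / (sqrt (real m) * \<rho> m)\<^sup>2) \<longlonglongrightarrow> 0"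
      by (rule filterlim_compose[OF _ \<rho>(2)])
    have "1 / (sqrt (real m) * \<rho> m)\<^sup>2 = real m / (real m * \<rho> m)\<^sup>2" for m
      by (simp add: power_mult_distrib) (simp add: power2_eq_square)
    with lim show ?thesis by simp
  qed
qed (use \<epsilon> \<rho>(1) in auto)

lemma sum_hit_minus: "m > 0 \<Longrightarrow> (\<Sum>i<m. hit k i w - p k) / m = real (card {i. i < m \<and> obs i w = k}) / m - p k"
proof -
  assume m: "m > 0"
  have "(\<Sum>i<m. hit k i w) = real (card {i. i < m \<and> obs i w = k})"
    unfolding hit_def by (simp add: sum.If_cases lessThan_def Collect_conj_eq Int_commute)
  then show ?thesis using m by (simp add: sum_subtractf diff_divide_distrib)
qed

lemma sum_hit_noise: "(\<Sum>i<m. hit k i w * noise i w) = (\<Sum>i<m. if obs i w = k then noise i w else 0)"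
  by (intro sum.cong) (auto simp: hit_def)

end

text \<open>Measurability of a random matrix is understood entrywise here. The entry formula for the
  norm transfers it to the distance, which makes large deviations of the initial estimator
  events.\<close>

lemma frob_norm_minus_measurable:
  assumes X: "\<And>w. w \<in> space M \<Longrightarrow> X w \<in> carrier_mat n n" and Y: "Y \<in> carrier_mat n n"
    and [measurable]: "\<And>i j. i < n \<Longrightarrow> j < n \<Longrightarrow> (\<lambda>w. X w $$ (i,j)) \<in> borel_measurable M"
  shows "(\<lambda>w. frob_norm (X w - Y)) \<in> borel_measurable M"
proof -
  have eq: "frob_norm (X w - Y) = sqrt (\<Sum>i<n. \<Sum>j<n. (cmod (X w $$ (i,j) - Y $$ (i,j)))\<^sup>2)"
    if w: "w \<in> space M" for w
  proof -
    have Z: "X w - Y \<in> carrier_mat n n" using Y by (rule minus_carrier_mat)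
    show ?thesis
      unfolding frob_norm_def inner_S_eq[OF Z Z] cmod_power2
      by (intro arg_cong[of _ _ sqrt] sum.cong refl) (use X[OF w] Y in \<open>simp add: power2_eq_square algebra_simps\<close>)
  qed
  have "(\<lambda>w. sqrt (\<Sum>i<n. \<Sum>j<n. (cmod (X w $$ (i,j) - Y $$ (i,j)))\<^sup>2)) \<in> borel_measurable M"
    by measurable
  then show ?thesis using eq by (subst measurable_cong) auto
qed

theorem mainTheorem14:
  fixes M :: "'w measure"
    and realcase :: bool and n r d :: nat
    and \<Theta> :: "nat \<Rightarrow> complex mat" and \<alpha> \<beta> :: "nat set" and p :: "nat \<Rightarrow> real"
    and Xbar Pbar :: "complex mat" and lamb :: "nat \<Rightarrow> real"
    and obs :: "nat \<Rightarrow> 'w \<Rightarrow> nat" and noise :: "nat \<Rightarrow> 'w \<Rightarrow> real" and \<nu> :: real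
    and f :: "real vec \<Rightarrow> real vec"
    and Xtilde Xhat :: "nat \<Rightarrow> 'w \<Rightarrow> complex mat"
    and rho :: "nat \<Rightarrow> real" and gamma :: "nat \<Rightarrow> 'w \<Rightarrow> real"
  assumes P: "prob_space M"
    \<comment> \<open>orthonormal basis of S^n\<close>
    and basis_in: "\<forall>k<d. \<Theta> k \<in> Sn realcase n"
    and basis_orth: "\<forall>j<d. \<forall>k<d. inner_S (\<Theta> j) (\<Theta> k) = (if j = k then 1 else 0)"
    and basis_span: "\<forall>X\<in>Sn realcase n. \<exists>c. X = lin_comb n \<Theta> c {..<d}"
    and alpha: "\<alpha> \<subseteq> {..<d}" and beta: "\<beta> = {..<d} - \<alpha>"
    and p_pos: "\<forall>k\<in>\<beta>. p k > 0" and p_sum: "(\<Sum>k\<in>\<beta>. p k) = 1"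
    \<comment> \<open>the unknown matrix and its eigendecomposition\<close>
    and Xbar_S: "Xbar \<in> Sn realcase n" and Xbar_psd: "psd Xbar"
    and rank_Xbar: "vec_space.rank n Xbar = r" and r_pos: "r \<ge> 1"
    and eig: "eig_decomp n Xbar Pbar lamb"
    and Pbar_real: "realcase \<longrightarrow> real_mat Pbar"
    \<comment> \<open>sampling model\<close>
    and indep: "prob_space.indep_vars M (\<lambda>_. borel)
          (\<lambda>i. case i of Inl k \<Rightarrow> (\<lambda>w. real (obs k w)) | Inr k \<Rightarrow> noise k) UNIV"
    and obs_dist: "\<forall>i. \<forall>k\<in>\<beta>. measure M {w \<in> space M. obs i w = k} = p k"
    and noise_ident: "\<forall>i. distr M borel (noise i) = distr M borel (noise 0)"
    and noise_int: "\<forall>i. integrable M (noise i) \<and> integrable M (\<lambda>w. (noise i w)\<^sup>2)"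
    and noise_mean: "\<forall>i. prob_space.expectation M (noise i) = 0"
    and noise_var: "\<forall>i. prob_space.expectation M (\<lambda>w. (noise i w)\<^sup>2) = 1"
    and nu_pos: "\<nu> > 0"
    \<comment> \<open>spectral operator\<close>
    and f_sym: "symmetric_fun n f"
    and F_cont: "\<forall>\<epsilon>>0. \<exists>\<delta>>0. \<forall>X. X \<in> Sn realcase n \<and> psd X \<and> frob_norm (X - Xbar) < \<delta> \<longrightarrow>
          frob_norm (spectral_op n f X - spectral_op n f Xbar) < \<epsilon>"
    \<comment> \<open>initial estimator: positive semidefinite, consistent\<close>
    and Xtilde_S: "\<forall>m. \<forall>w\<in>space M. Xtilde m w \<in> Sn realcase n \<and> psd (Xtilde m w)"
    and Xtilde_meas: "\<forall>m i j. i < n \<longrightarrow> j < n \<longrightarrow> (\<lambda>w. Xtilde m w $$ (i,j)) \<in> borel_measurable M"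
    and Xtilde_cons: "\<forall>\<epsilon>>0. (\<lambda>m. measure M {w \<in> space M. frob_norm (Xtilde m w - Xbar) > \<epsilon>}) \<longlonglongrightarrow> 0"
    \<comment> \<open>parameters\<close>
    and rho_pos: "\<forall>m. rho m > 0"
    and rho_lim: "rho \<longlonglongrightarrow> 0"
    and rho_sqrt: "filterlim (\<lambda>m. sqrt (real m) * rho m) at_top sequentially"
    and gamma_nonneg: "\<forall>m. \<forall>w\<in>space M. gamma m w \<ge> 0"
    and gamma_meas: "\<forall>m. gamma m \<in> borel_measurable M"
    and gamma_Op1: "\<forall>\<epsilon>>0. \<exists>K. \<forall>\<^sub>F m in sequentially. measure M {w \<in> space M. \<bar>gamma m w\<bar> > K} < \<epsilon>"
    \<comment> \<open>Slater condition\<close>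
    and slater: "\<exists>X0\<in>Sn realcase n. pd X0 \<and> (\<forall>k\<in>\<alpha>. inner_S (\<Theta> k) X0 = inner_S (\<Theta> k) Xbar)"
    \<comment> \<open>the estimator is an optimal solution of the rank-correction problem\<close>
    and Xhat_opt: "\<forall>m>0. \<forall>w\<in>space M. is_optimal realcase n f \<Theta> \<alpha> Xbar m (\<lambda>i. obs i w)
          (\<lambda>i. inner_S (\<Theta> (obs i w)) Xbar + \<nu> * noise i w) (Xtilde m w) (rho m) (gamma m w) (Xhat m w)"
    and Xhat_meas: "\<forall>m i j. i < n \<longrightarrow> j < n \<longrightarrow> (\<lambda>w. Xhat m w $$ (i,j)) \<in> borel_measurable M"
    \<comment> \<open>rank consistency\<close>
    and rank_cons: "(\<lambda>m. measure M {w \<in> space M. vec_space.rank n (Xhat m w) = r}) \<longlonglongrightarrow> 1"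
  shows "\<exists>\<Lambda>. \<Lambda> \<in> Sn realcase (n - r) \<and> psd \<Lambda> \<and>
    (let P2 = mat n (n - r) (\<lambda>(i,j). Pbar $$ (i, r + j)) in
      mat_adjoint P2 * Qdag n \<Theta> p \<beta> (P2 * \<Lambda> * mat_adjoint P2) * P2
      = mat_adjoint P2 * Qdag n \<Theta> p \<beta> (1\<^sub>m n - spectral_op n f Xbar) * P2)"
proof -
  interpret Sn_basis realcase n d \<Theta>
    using basis_in basis_orth basis_span by unfold_locales auto
  have fin: "finite \<beta>" by (simp add: beta)
  interpret sampling M obs noise \<beta> p
    using P indep obs_dist noise_int noise_mean noise_var fin p_sum
    by (intro sampling.intro sampling_axioms.intro) auto
  obtain K where K: "\<forall>\<^sub>F m in sequentially. prob {w \<in> space M. \<bar>gamma m w\<bar> > K} < 1 / 2"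
    using gamma_Op1[rule_format, of "1 / 2"] by auto
  have Xbc: "Xbar \<in> carrier_mat n n" by (rule SnD(1)[OF Xbar_S])
  have frob_meas [measurable]: "(\<lambda>w. frob_norm (Xtilde m w - Xbar)) \<in> borel_measurable M" for m
    using Xtilde_S Xtilde_meas by (intro frob_norm_minus_measurable[OF _ Xbc]) (auto dest: SnD(1))
  note [measurable] = gamma_meas[rule_format]
  \<comment> \<open>\<open>Q j m w\<close> collects everything required of an outcome at accuracy
    \<open>1 / (j + 1)\<close>, so that one choice over \<open>j\<close> produces the whole
    sequence.\<close>
  define Q where "Q = (\<lambda>j m w. m > j \<and> w \<in> space M \<and> (\<forall>i. obs i w \<in> \<beta>) \<and> vec_space.rank n (Xhat m w) = r \<and>
      gamma m w \<le> K \<and>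
      (\<forall>k\<in>\<beta>. \<bar>real (card {i. i < m \<and> obs i w = k}) / m - p k\<bar> \<le> 1 / real (Suc j)) \<and>
      (\<forall>k\<in>\<beta>. \<bar>(\<Sum>i<m. if obs i w = k then noise i w else 0) / (m * rho m)\<bar> \<le> 1 / real (Suc j)) \<and>
      frob_norm (Xtilde m w - Xbar) \<le> 1 / real (Suc j) \<and>
      frob_norm (spectral_op n f (Xtilde m w) - spectral_op n f Xbar) \<le> 1 / real (Suc j))"
  have good: "\<exists>m w. Q j m w" for j
  proof -
    define \<epsilon> where "\<epsilon> = 1 / real (Suc j)"
    have \<epsilon>: "\<epsilon> > 0" by (simp add: \<epsilon>_def)
    obtain \<delta> where \<delta>: "\<delta> > 0" "\<And>X. X \<in> Sn realcase n \<Longrightarrow> psd X \<Longrightarrow> frob_norm (X - Xbar) < \<delta> \<Longrightarrow>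
        frob_norm (spectral_op n f X - spectral_op n f Xbar) < \<epsilon>"
      using F_cont[rule_format, OF \<epsilon>] by metis
    \<comment> \<open>The bad event is a strict excess over this threshold, so a good outcome is
      within it, hence strictly within the continuity radius \<delta>; halving \<delta> provides the
      strictness.\<close>
    define \<delta>' where "\<delta>' = min \<epsilon> (\<delta> / 2)"
    have \<delta>': "\<delta>' > 0" "\<delta>' \<le> \<epsilon>" "\<delta>' < \<delta>" using \<epsilon> \<delta>(1) by (auto simp: \<delta>'_def)
    \<comment> \<open>The tag \<open>t\<close> selects the kind of deviation. The third kind does
      not depend on a basis index, so \<open>(2,0)\<close> carries a dummy 0.\<close>
    define B :: "nat \<times> nat \<Rightarrow> nat \<Rightarrow> 'w set" where "B = (\<lambda>(t,k) m.
      if t = 0 then {w \<in> space M. \<epsilon> \<le> \<bar>(\<Sum>i<m. hit k i w - p k) / m\<bar>}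
      else if t = 1 then {w \<in> space M. \<epsilon> \<le> \<bar>(\<Sum>i<m. hit k i w * noise i w) / (m * rho m)\<bar>}
      else {w \<in> space M. frob_norm (Xtilde m w - Xbar) > \<delta>'})"
    have "\<forall>\<^sub>F m in sequentially. \<exists>w. w \<in> {w \<in> space M. vec_space.rank n (Xhat m w) = r} \<and>
        (\<forall>i. obs i w \<in> \<beta>) \<and> w \<notin> {w \<in> space M. \<bar>gamma m w\<bar> > K} \<and>
        (\<forall>i\<in>({0,1} \<times> \<beta>) \<union> {(2,0)}. w \<notin> B i m)"
    proof (rule eventually_exists_outcome[OF _ _ _ _ K rank_cons AE_obs_in])
      show "B i m \<in> events" for i m
        unfolding B_def by (cases i) simp
      show "(\<lambda>m. prob (B i m)) \<longlonglongrightarrow> 0" if "i \<in> ({0,1} \<times> \<beta>) \<union> {(2,0)}" for i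
        using that frequency_tail_tendsto[OF _ \<epsilon>] noise_tail_tendsto[OF rho_pos[rule_format] rho_sqrt \<epsilon>]
          Xtilde_cons[rule_format, OF \<delta>'(1)] by (auto simp: B_def)
    qed (use fin in auto)
    then obtain N where N: "\<And>m. m \<ge> N \<Longrightarrow> \<exists>w. w \<in> {w \<in> space M. vec_space.rank n (Xhat m w) = r} \<and>
        (\<forall>i. obs i w \<in> \<beta>) \<and> w \<notin> {w \<in> space M. \<bar>gamma m w\<bar> > K} \<and>
        (\<forall>i\<in>({0,1} \<times> \<beta>) \<union> {(2,0)}. w \<notin> B i m)"
      unfolding eventually_sequentially by blast
    \<comment> \<open>\<open>Suc j\<close> makes the sample size positive and larger than
      \<open>j\<close>, so the chosen sizes tend to infinity.\<close>
    define m where "m = max N (Suc j)"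
    have m: "m > j" "m > 0" by (auto simp: m_def)
    obtain w where w: "w \<in> space M" "vec_space.rank n (Xhat m w) = r" "\<forall>i. obs i w \<in> \<beta>"
      "\<bar>gamma m w\<bar> \<le> K" and wB: "\<forall>i\<in>({0,1} \<times> \<beta>) \<union> {(2,0)}. w \<notin> B i m"
      using N[of m] by (auto simp: m_def)
    have "\<bar>real (card {i. i < m \<and> obs i w = k}) / m - p k\<bar> \<le> \<epsilon>" if "k \<in> \<beta>" for k
      unfolding sum_hit_minus[OF m(2), symmetric]
      using wB[rule_format, of "(0,k)"] that w(1) by (auto simp: B_def)
    moreover have "\<bar>(\<Sum>i<m. if obs i w = k then noise i w else 0) / (m * rho m)\<bar> \<le> \<epsilon>" if "k \<in> \<beta>" for k
      using wB[rule_format, of "(1,k)"] that w(1) by (simp add: B_def sum_hit_noise)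
    moreover have "frob_norm (Xtilde m w - Xbar) \<le> \<delta>'"
      using wB[rule_format, of "(2,0)"] w(1) by (simp add: B_def)
    moreover from this have "frob_norm (spectral_op n f (Xtilde m w) - spectral_op n f Xbar) \<le> \<epsilon>"
      using \<delta>(2)[of "Xtilde m w"] \<delta>' Xtilde_S w(1) by (auto intro: less_imp_le)
    ultimately show ?thesis
      using m w \<delta>' unfolding Q_def \<epsilon>_def[symmetric] by (intro exI[of _ m] exI[of _ w]) auto
  qed
  obtain m w where mw: "\<And>j. Q j (m j) (w j)" using good by metis
  have m: "m j > j"
    and w: "w j \<in> space M" "obs i (w j) \<in> \<beta>" "vec_space.rank n (Xhat (m j) (w j)) = r" "gamma (m j) (w j) \<le> K"
    and Xt: "frob_norm (Xtilde (m j) (w j) - Xbar) \<le> 1 / real (Suc j)"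
    and Ft: "frob_norm (spectral_op n f (Xtilde (m j) (w j)) - spectral_op n f Xbar) \<le> 1 / real (Suc j)"
    for i j using mw[of j] unfolding Q_def by blast+
  have freq: "\<bar>real (card {i. i < m j \<and> obs i (w j) = k}) / m j - p k\<bar> \<le> 1 / real (Suc j)"
    and noise0: "\<bar>(\<Sum>i<m j. if obs i (w j) = k then noise i (w j) else 0) / (m j * rho (m j))\<bar> \<le> 1 / real (Suc j)"
    if "k \<in> \<beta>" for j k using mw[of j] that unfolding Q_def by blast+
  have null: "x \<longlonglongrightarrow> 0" if "\<And>j. \<bar>x j\<bar> \<le> 1 / real (Suc j)" for x :: "nat \<Rightarrow> real"
  proof (rule Lim_null_comparison)
    show "(\<lambda>j. 1 / real (Suc j)) \<longlonglongrightarrow> 0"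
      using LIMSEQ_inverse_real_of_nat by (simp add: inverse_eq_divide)
  qed (use that in auto)
  have frob_nonneg: "0 \<le> frob_norm (X - Y)" if "Y \<in> carrier_mat n n" for X Y
    unfolding frob_norm_def using inner_S_self_nonneg[OF minus_carrier_mat[OF that]] by simp
  have m_top: "filterlim m at_top sequentially"
    using filterlim_at_top_mono[OF filterlim_ident, of m] m less_imp_le by (auto intro: always_eventually)
  show ?thesis
  proof (rule solvable_of_approximating_outcomes[OF alpha beta _ Xbar_S Xbar_psd slater eig, where
        \<gamma> = "\<lambda>j. gamma (m j) (w j)" and \<rho> = "\<lambda>j. rho (m j)" and m = m and K = K and \<nu> = \<nu> and
        obsv = "\<lambda>j i. obs i (w j)" and noise = "\<lambda>j i. noise i (w j)" and
        Xt = "\<lambda>j. Xtilde (m j) (w j)" and Xj = "\<lambda>j. Xhat (m j) (w j)"])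
    show "is_optimal realcase n f \<Theta> \<alpha> Xbar (m j) (\<lambda>i. obs i (w j))
        (\<lambda>i. inner_S (\<Theta> (obs i (w j))) Xbar + \<nu> * noise i (w j))
        (Xtilde (m j) (w j)) (rho (m j)) (gamma (m j) (w j)) (Xhat (m j) (w j))" for j
      using Xhat_opt w(1) m[of j] by auto
    show "(\<lambda>j. rho (m j)) \<longlonglongrightarrow> 0" by (rule filterlim_compose[OF rho_lim m_top])
    show "(\<lambda>j. real (card {i. i < m j \<and> obs i (w j) = k}) / m j) \<longlonglongrightarrow> p k" if "k \<in> \<beta>" for k
      using null[OF freq[OF that]] by (simp add: LIM_zero_iff)
    show "(\<lambda>j. (\<Sum>i<m j. if obs i (w j) = k then noise i (w j) else 0) / (m j * rho (m j))) \<longlonglongrightarrow> 0"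
      if "k \<in> \<beta>" for k using null[OF noise0[OF that]] .
    show "(\<lambda>j. frob_norm (Xtilde (m j) (w j) - Xbar)) \<longlonglongrightarrow> 0"
      using Xt frob_nonneg[OF Xbc] by (intro null) simp
    show "(\<lambda>j. frob_norm (spectral_op n f (Xtilde (m j) (w j)) - spectral_op n f Xbar)) \<longlonglongrightarrow> 0"
      using Ft frob_nonneg[OF spectral_op_carrier[OF Xbar_S]] by (intro null) simp
    show "0 < m j" for j using m[of j] by simp
  qed (use p_pos Pbar_real w Xtilde_S rank_Xbar rho_pos gamma_nonneg in auto)
qed

end
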